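(* Let $(\Phi_t)_{t\in\mathbb Z}$ be a stationary Markov chain possessing an atom $A$, let $h$ be a measurable real-valued function on its state space, and let $X_t=h(\Phi_t)$, $t\in\mathbb Z$, with generic element $X$ and $S_n=X_1+\cdots+X_n$. Let $\alpha>0$ and assume, for the regions $\Lambda_n$ specified below: (i) $(X_t)$ satisfies the regular variation condition $\mathbf{RV}_\alpha$; (ii) $(X_t)$ satisfies the anti-clustering condition $\mathbf{AC}_\alpha$ for a sequence $\delta_k=o(k^{-2})$, $k\to\infty$, and the sets $(\Lambda_n)$, with $b_n=\inf\Lambda_n\to\infty$ as $n\to\infty$; (iii) the limit $b_+=\lim_{k\to\infty}(b_+(k+1)-b_+(k))$ exists; (iv) $\mathbb EX=0$ if $\mathbb E|X|<\infty$; (v) the drift condition $\mathbf{DC}_p$ holds for all $p<\alpha$ ($p>0$). Then $$\lim_{n\to\infty}\sup_{x\in\Lambda_n}\Big|\frac{\mathbb P(S_n>x)}{n\,\mathbb P(|X|>x)}-b_+\Big|=0$$ under the following conditions: - $0<\alpha<1$: $\Lambda_n=(b_n,\infty)$ for any sequence $(b_n)$ satisfying $n\,\mathbb P(|X|>b_n)\to0$. - $\alpha>1$ and $\alpha\ne2$: $\Lambda_n=(b_n,c_n)$ for any sequence $(b_n)$ satisfying $b_n=n^{\max(1/\alpha,\,1/2)+\delta}$ for any $\delta>0$, and $(c_n)$ such that $c_n>b_n$ and $$\mathbb P(\tau_A>n)=o\big(n\,\mathbb P(|X|>c_n)\big),\qquad n\to\infty .$$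
   Context: The chain $(\Phi_t)$ lives on a general state space; the setting is the classical one of Nummelin and of Meyn and Tweedie, in which $(\Phi_t)$ can be seen as the enlargement of a Harris recurrent Markov chain. An atom is a measurable set $A$ such that the one-step transition probabilities $\mathbb P(\Phi_1\in\cdot\mid\Phi_0=y)$ are the same for all $y\in A$. $\tau_A=\min\{n\ge1:\Phi_n\in A\}$ is the first time the chain visits $A$. Condition $\mathbf{DC}_p$: there exist constants $\beta\in(0,1)$, $b>0$ such that for every $y$, $\mathbb E(|h(\Phi_1)|^p\mid\Phi_0=y)\le\beta|h(y)|^p+b\,\mathbf 1_A(y)$. Here $\beta$, $b$ and $A$ may depend on $p$; this dependence is suppressed in the notation. Condition $\mathbf{RV}_\alpha$: for every $d\ge1$ there is a non-null Radon measure $\mu_d$ on the Borel sets of $\overline{\mathbb R}^d\setminus\{\mathbf 0\}$, $\overline{\mathbb R}=\mathbb R\cup\{\pm\infty\}$ (Radon meaning finite on sets bounded away from zero), such that $n\,\mathbb P(a_n^{-1}(X_1,\dots,X_d)\in\cdot)\to\mu_d(\cdot)$ vaguely, where $n\,\mathbb P(|X|>a_n)\to1$, and $\mu_d(tB)=t^{-\alpha}\mu_d(B)$ for all $t>0$ and Borel sets $B$. Under $\mathbf{RV}_\alpha$ the limits $b_+(k)=\lim_{x\to\infty}\mathbb P(S_k>x)/\mathbb P(|X|>x)$, $k\ge1$, exist. Condition $\mathbf{AC}_\alpha$ (for $(\delta_k)$, $(\Lambda_n)$): $\delta_k\downarrow0$ as $k\to\infty$, and $\Lambda_n\subset(0,\infty)$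 with $b_n=\inf\Lambda_n$ satisfy $n\,\mathbb P(|X|>b_n)\to0$ and $$\lim_{k\to\infty}\limsup_{n\to\infty}\sup_{x\in\Lambda_n}\delta_k^{-\alpha}\sum_{j=k}^n\mathbb P(|X_j|>x\delta_k\mid|X_0|>x\delta_k)=0 .$$ *)

theory Defs
  imports "HOL-Probability.Probability" "HOL-Library.Landau_Symbols"
begin

subsection \<open>Markov chains, atoms, drift\<close>

definition past_algebra :: "'w measure \<Rightarrow> 'e measure \<Rightarrow> (int \<Rightarrow> 'w \<Rightarrow> 'e) \<Rightarrow> int \<Rightarrow> 'w measure" where
  "past_algebra M E \<Phi> t =
     vimage_algebra (space M) (\<lambda>\<omega>. \<lambda>s\<in>{..t}. \<Phi> s \<omega>) (PiM {..t} (\<lambda>_. E))"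

text \<open>The kernel \<open>K\<close> is the version of \<open>y \<mapsto> P(\<Phi>_1 \<in> \<cdot> | \<Phi>_0 = y)\<close> to which all statements
  about ``every \<open>y\<close>'' refer.\<close>

definition markov_chain ::
    "'w measure \<Rightarrow> 'e measure \<Rightarrow> ('e \<Rightarrow> 'e measure) \<Rightarrow> (int \<Rightarrow> 'w \<Rightarrow> 'e) \<Rightarrow> bool" where
  "markov_chain M E K \<Phi> \<longleftrightarrow>
     K \<in> E \<rightarrow>\<^sub>M prob_algebra E \<and>
     (\<forall>t. \<Phi> t \<in> M \<rightarrow>\<^sub>M E) \<and>
     (\<forall>t. \<forall>B\<in>sets E.
        AE \<omega> in M. real_cond_exp M (past_algebra M E \<Phi> t)
                     (indicator (\<Phi> (t + 1) -` B \<inter> space M)) \<omega> = measure (K (\<Phi> t \<omega>)) B)"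

definition stationary :: "'w measure \<Rightarrow> 'e measure \<Rightarrow> (int \<Rightarrow> 'w \<Rightarrow> 'e) \<Rightarrow> bool" where
  "stationary M E \<Phi> \<longleftrightarrow>
     (\<forall>s. distr M (PiM UNIV (\<lambda>_. E)) (\<lambda>\<omega> t. \<Phi> (t + s) \<omega>) =
          distr M (PiM UNIV (\<lambda>_. E)) (\<lambda>\<omega> t. \<Phi> t \<omega>))"

definition atom :: "'e measure \<Rightarrow> ('e \<Rightarrow> 'e measure) \<Rightarrow> 'e set \<Rightarrow> bool" where
  "atom E K A \<longleftrightarrow> A \<in> sets E \<and> (\<forall>y\<in>A. \<forall>z\<in>A. K y = K z)"

text \<open>The value is \<open>\<infinity>\<close> if \<open>A\<close> is never visited, since \<open>Inf {} = \<infinity>\<close> in \<^typ>\<open>enat\<close>.\<close>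

definition hitting_time :: "(int \<Rightarrow> 'w \<Rightarrow> 'e) \<Rightarrow> 'e set \<Rightarrow> 'w \<Rightarrow> enat" where
  "hitting_time \<Phi> A \<omega> = Inf (enat ` {n. 1 \<le> n \<and> \<Phi> (int n) \<omega> \<in> A})"

definition drift_condition ::
    "'e measure \<Rightarrow> ('e \<Rightarrow> 'e measure) \<Rightarrow> ('e \<Rightarrow> real) \<Rightarrow> 'e set \<Rightarrow> real \<Rightarrow> bool" where
  "drift_condition E K h A p \<longleftrightarrow>
     (\<exists>\<beta> b. 0 < \<beta> \<and> \<beta> < 1 \<and> 0 < b \<and>
        (\<forall>y\<in>space E. (\<integral>\<^sup>+ z. ennreal (\<bar>h z\<bar> powr p) \<partial>K y)
                        \<le> ennreal (\<beta> * \<bar>h y\<bar> powr p + b * indicator A y)))"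

subsection \<open>Regular variation\<close>

text \<open>The extended space of dimension \<open>d\<close> is the set of extensional functions from \<open>{1..d}\<close> to
  \<^typ>\<open>ereal\<close>. It is second countable, so its Borel sets are those of the product \<open>\<sigma>\<close>-algebra. It is
  also compact, so a subset of the punctured space is relatively compact there iff it is bounded
  away from zero.\<close>

definition punctured :: "nat \<Rightarrow> (nat \<Rightarrow> ereal) set" where
  "punctured d = ({1..d} \<rightarrow>\<^sub>E UNIV) - {\<lambda>i\<in>{1..d}. 0}"

definition punctured_top :: "nat \<Rightarrow> (nat \<Rightarrow> ereal) topology" where
  "punctured_top d = subtopology (product_topology (\<lambda>_. euclidean) {1..d}) (punctured d)"

definition punctured_borel :: "nat \<Rightarrow> (nat \<Rightarrow> ereal) measure" where
  "punctured_borel d = restrict_space (PiM {1..d} (\<lambda>_. borel)) (punctured d)"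

definition bounded_away :: "nat \<Rightarrow> (nat \<Rightarrow> ereal) set \<Rightarrow> bool" where
  "bounded_away d B \<longleftrightarrow> (\<exists>\<epsilon>>0::real. \<forall>x\<in>B. \<exists>i\<in>{1..d}. ereal \<epsilon> \<le> \<bar>x i\<bar>)"

definition radon_punctured :: "nat \<Rightarrow> (nat \<Rightarrow> ereal) measure \<Rightarrow> bool" where
  "radon_punctured d \<mu> \<longleftrightarrow>
     sets \<mu> = sets (punctured_borel d) \<and>
     (\<forall>B\<in>sets \<mu>. bounded_away d B \<longrightarrow> emeasure \<mu> B < \<infinity>)"

text \<open>Test functions are the continuous functions of compact support on the punctured space.\<close>

definition vague_conv ::
    "nat \<Rightarrow> (nat \<Rightarrow> (nat \<Rightarrow> ereal) measure) \<Rightarrow> (nat \<Rightarrow> ereal) measure \<Rightarrow> bool" where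
  "vague_conv d \<nu> \<mu> \<longleftrightarrow>
     (\<forall>f :: (nat \<Rightarrow> ereal) \<Rightarrow> real.
        continuous_map (punctured_top d) euclideanreal f \<and>
        bounded_away d {x \<in> punctured d. f x \<noteq> 0} \<longrightarrow>
        (\<lambda>n. \<integral>x. f x \<partial>\<nu> n) \<longlonglongrightarrow> (\<integral>x. f x \<partial>\<mu>))"

definition scaled_law ::
    "'w measure \<Rightarrow> (int \<Rightarrow> 'w \<Rightarrow> real) \<Rightarrow> (nat \<Rightarrow> real) \<Rightarrow> nat \<Rightarrow> nat \<Rightarrow> (nat \<Rightarrow> ereal) measure" where
  "scaled_law M X a d n =
     scale_measure (of_nat n)
       (restrict_space
         (distr M (PiM {1..d} (\<lambda>_. borel)) (\<lambda>\<omega>. \<lambda>i\<in>{1..d}. ereal (X (int i) \<omega> / a n)))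
         (punctured d))"

text \<open>\<open>P(|X| > x)\<close> for the generic element of a stationary sequence.\<close>

definition abs_tail :: "'w measure \<Rightarrow> (int \<Rightarrow> 'w \<Rightarrow> real) \<Rightarrow> real \<Rightarrow> real" where
  "abs_tail M X x = \<P>(\<omega> in M. \<bar>X 0 \<omega>\<bar> > x)"

definition regularly_varying :: "'w measure \<Rightarrow> (int \<Rightarrow> 'w \<Rightarrow> real) \<Rightarrow> real \<Rightarrow> bool" where
  "regularly_varying M X \<alpha> \<longleftrightarrow>
     (\<exists>a. (\<forall>n. a n > 0) \<and> (\<lambda>n. real n * abs_tail M X (a n)) \<longlonglongrightarrow> 1 \<and>
        (\<forall>d\<ge>1. \<exists>\<mu>. radon_punctured d \<mu> \<and> emeasure \<mu> (space \<mu>) \<noteq> 0 \<and>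
           vague_conv d (scaled_law M X a d) \<mu> \<and>
           (\<forall>t>0. \<forall>B\<in>sets \<mu>.
              emeasure \<mu> ((\<lambda>x. \<lambda>i\<in>{1..d}. ereal t * x i) ` B) =
              ennreal (t powr (-\<alpha>)) * emeasure \<mu> B)))"

subsection \<open>Partial sums and anti-clustering\<close>

definition partial_sum :: "(int \<Rightarrow> 'w \<Rightarrow> real) \<Rightarrow> nat \<Rightarrow> 'w \<Rightarrow> real" where
  "partial_sum X n \<omega> = (\<Sum>i=1..n. X (int i) \<omega>)"

definition b_plus :: "'w measure \<Rightarrow> (int \<Rightarrow> 'w \<Rightarrow> real) \<Rightarrow> nat \<Rightarrow> real" where
  "b_plus M X k = Lim at_top (\<lambda>x. \<P>(\<omega> in M. partial_sum X k \<omega> > x) / abs_tail M X x)"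

text \<open>The suprema are taken in \<^typ>\<open>ereal\<close>, so that none of them is a junk value.\<close>

definition anti_clustering ::
    "'w measure \<Rightarrow> (int \<Rightarrow> 'w \<Rightarrow> real) \<Rightarrow> real \<Rightarrow> (nat \<Rightarrow> real) \<Rightarrow> (nat \<Rightarrow> real set) \<Rightarrow> bool" where
  "anti_clustering M X \<alpha> \<delta> \<Lambda> \<longleftrightarrow>
     (\<forall>k. \<delta> k > 0) \<and> decseq \<delta> \<and> \<delta> \<longlonglongrightarrow> 0 \<and>
     (\<forall>n\<ge>1. \<Lambda> n \<noteq> {} \<and> \<Lambda> n \<subseteq> {0<..}) \<and>
     (\<lambda>n. real n * abs_tail M X (Inf (\<Lambda> n))) \<longlonglongrightarrow> 0 \<and>
     (\<lambda>k. limsup (\<lambda>n. SUP x\<in>\<Lambda> n. ereal (\<delta> k powr (-\<alpha>) *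
         (\<Sum>j=k..n. cond_prob M (\<lambda>\<omega>. \<bar>X (int j) \<omega>\<bar> > x * \<delta> k) (\<lambda>\<omega>. \<bar>X 0 \<omega>\<bar> > x * \<delta> k)))))
       \<longlonglongrightarrow> 0"

end

(* A sum is split at the level \<delta>_k x. For the large parts, telescoping P(T_n > x) over n and
   comparing each increment with the increment over the last k+1 terms costs only joint exceedances at
   distance at least k, which the anti-clustering condition controls; the increments themselves are
   governed by regular variation, which yields b_+.

   The small parts are negligible. For \<alpha> < 1 this is Markov's inequality with Karamata's bounds. For
   \<alpha> > 1 the sum of f = h 1{|h| \<le> L} is written, through the Poisson equation for the kernel killed
   at the atom, as a martingale plus boundary terms plus a constant times the number of visits to the
   atom, where the constant is small because X is centred. The function
   w = min(|h|, L^(1-r) |h|^r) dominates f and satisfies the drift condition with constants that do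
   not depend on L, while E w^(2m) = O(L^(2m) P(|X| > L)) for 2m > \<alpha>. A Rosenthal inequality for even
   moments then bounds the martingale. *)

theory Submission
  imports Defs
begin

section \<open>Regularly varying tails\<close>

text \<open>The obstacle is a gap in moments: drift is granted only for powers p < \<alpha>, while
  for \<alpha> > 1 the truncated sum has to be measured by moments 2m > \<alpha>. The exponent r
  closes it. By concavity of t powr r, a drift of order one with factor \<beta> becomes a drift of w
  with factor \<beta> powr r whatever L is, and 2mr < \<alpha> keeps the 2m-th moment of w finite.
  Squaring h first gives the same for w^2, which controls conditional variances when m >= 2. For 1 <
  \<alpha> < 2 drift of order one and m = 1 suffice; for \<alpha> > 2 drift of order two is
  available and m can be as large as the term n^m / x^(2m) demands. On the atom the Poisson solution
  is a constant c, and Kac's identity c P(A) = E f with centring gives c = O(L P(|X| > L)). The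
  crude bound n for the number of visits is then enough, because n P(|X| > x) tends to 0. The rate
  o(k^(-2)) is dictated by the large parts: dropping the small parts of k terms moves the level by k
  \<delta>_k x, and \<open>b_plus\<close> grows linearly, so the error is of order k^2
  \<delta>_k.\<close>

locale rv_tail =
  fixes F :: "real \<Rightarrow> real" and \<alpha> :: real
  assumes F_pos: "\<And>x. F x > 0"
    and F_le_1: "\<And>x. F x \<le> 1"
    and F_anti: "\<And>x y. x \<le> y \<Longrightarrow> F y \<le> F x"
    and \<alpha>_pos: "\<alpha> > 0"
    and rv: "\<And>t. t > 0 \<Longrightarrow> ((\<lambda>x. F (t * x) / F x) \<longlongrightarrow> t powr (-\<alpha>)) at_top"
begin

text \<open>Regular variation at the single ratio 2 is enough: beyond a threshold, doubling the
  argument multiplies F by less than 2 powr (-p). Iterate along L, 2L, 4L, ...; monotonicity bridges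
  the last gap to v at the price of a factor 2 powr p.\<close>

lemma potter_upper:
  assumes "0 \<le> p" "p < \<alpha>"
  obtains C x0 where "C > 0" "x0 > 0" "\<And>L v. x0 \<le> L \<Longrightarrow> L \<le> v \<Longrightarrow> F v \<le> C * (L / v) powr p * F L"
proof -
  have "2 powr (-\<alpha>) < 2 powr (-p)" using assms by simp
  from order_tendstoD(2)[OF rv[of 2] this] obtain x1 where
    x1: "\<And>x. x \<ge> x1 \<Longrightarrow> F (2 * x) / F x < 2 powr (-p)"
    by (auto simp: eventually_at_top_linorder)
  define x0 where "x0 = max 1 x1"
  have dbl: "F (2 ^ k * L) \<le> (2 ^ k) powr (-p) * F L" if "L \<ge> x0" for L k
  proof (induction k)
    case 0 then show ?case by simp
  next
    case (Suc k)
    have "x0 \<le> 1 * L" using that by simp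
    also have "1 * L \<le> 2 ^ k * L" using that by (intro mult_right_mono) (auto simp: x0_def)
    finally have "x1 \<le> 2 ^ k * L" by (simp add: x0_def)
    from x1[OF this] have "F (2 * (2 ^ k * L)) \<le> 2 powr (-p) * F (2 ^ k * L)"
      using F_pos[of "2 ^ k * L"] by (simp add: divide_simps mult.commute)
    also have "\<dots> \<le> 2 powr (-p) * ((2 ^ k) powr (-p) * F L)"
      using Suc by (intro mult_left_mono) auto
    also have "\<dots> = (2 ^ Suc k) powr (-p) * F L"
      by (simp add: powr_mult)
    finally show ?case by (simp add: mult.assoc)
  qed
  have "F v \<le> 2 powr p * (L / v) powr p * F L" if "x0 \<le> L" "L \<le> v" for L v
  proof -
    have "L > 0" "v > 0" using that by (auto simp: x0_def)
    define k where "k = nat \<lfloor>log 2 (v / L)\<rfloor>"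
    have "log 2 (v / L) \<ge> 0" using that \<open>L > 0\<close> by (subst zero_le_log_cancel_iff) (auto simp: x0_def)
    hence k: "real k \<le> log 2 (v / L)" "log 2 (v / L) < real k + 1" unfolding k_def by linarith+
    have "2 ^ k * L \<le> v"
    proof -
      have "2 powr real k \<le> 2 powr (log 2 (v / L))" using k(1) by simp
      also have "\<dots> = v / L" using \<open>L > 0\<close> \<open>v > 0\<close> by simp
      finally show ?thesis using \<open>L > 0\<close> by (simp add: powr_realpow field_simps)
    qed
    have "v / L \<le> 2 * 2 ^ k"
    proof -
      have "v / L = 2 powr (log 2 (v / L))" using \<open>L > 0\<close> \<open>v > 0\<close> by simp
      also have "\<dots> \<le> 2 powr (real k + 1)" using k(2) by simp
      finally show ?thesis by (simp add: powr_realpow powr_add)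
    qed
    have "F v \<le> F (2 ^ k * L)" by (rule F_anti) fact
    also have "\<dots> \<le> (2 ^ k) powr (-p) * F L" by (rule dbl) fact
    also have "(2 ^ k :: real) powr (-p) \<le> (v / L / 2) powr (-p)"
      using \<open>v / L \<le> 2 * 2 ^ k\<close> assms \<open>L > 0\<close> \<open>v > 0\<close> by (intro powr_mono2') auto
    also have "(v / L / 2) powr (-p) = 2 powr p * (L / v) powr p"
      using \<open>L > 0\<close> \<open>v > 0\<close> by (simp add: powr_minus powr_divide powr_mult field_simps)
    finally show ?thesis using F_pos[of L] by (simp add: mult_right_mono)
  qed
  then show ?thesis by (intro that[of "2 powr p" x0]) (auto simp: x0_def)
qed

text \<open>The companion Potter bound. It has to reach down to every u in (0, L], because truncated
  moments involve arbitrarily small values; iterated doubling only covers u >= x0.\<close>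

lemma potter_lower:
  assumes "q > \<alpha>"
  obtains C x0 where "C > 0" "x0 > 0" "\<And>L u. x0 \<le> L \<Longrightarrow> 0 < u \<Longrightarrow> u \<le> L \<Longrightarrow> F u \<le> C * (L / u) powr q * F L"
proof -
  have "q > 0" using assms \<alpha>_pos by simp
  have "2 powr (-q) < 2 powr (-\<alpha>)" using assms by simp
  from order_tendstoD(1)[OF rv[of 2] this] obtain x1 where
    x1: "\<And>x. x \<ge> x1 \<Longrightarrow> F (2 * x) / F x > 2 powr (-q)"
    by (auto simp: eventually_at_top_linorder)
  define x0 where "x0 = max 1 x1"
  have dbl: "F u \<le> (2 ^ k) powr q * F (2 ^ k * u)" if "u \<ge> x0" for u k
  proof (induction k)
    case 0 then show ?case by simp
  next
    case (Suc k)
    have "x0 \<le> 1 * u" using that by simp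
    also have "1 * u \<le> 2 ^ k * u" using that by (intro mult_right_mono) (auto simp: x0_def)
    finally have "x1 \<le> 2 ^ k * u" by (simp add: x0_def)
    from x1[OF this] have *: "F (2 ^ k * u) \<le> 2 powr q * F (2 * (2 ^ k * u))"
      using F_pos[of "2 ^ k * u"] by (simp add: divide_simps powr_minus mult.commute)
    have "F u \<le> (2 ^ k) powr q * F (2 ^ k * u)" by (rule Suc)
    also have "\<dots> \<le> (2 ^ k) powr q * (2 powr q * F (2 * (2 ^ k * u)))"
      using * by (intro mult_left_mono) auto
    also have "\<dots> = (2 ^ Suc k) powr q * F (2 ^ Suc k * u)"
      by (simp add: powr_mult mult.assoc)
    finally show ?case .
  qed
  have main: "F u \<le> 2 powr q * (L / u) powr q * F L" if "x0 \<le> u" "u \<le> L" for L u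
  proof -
    have "L > 0" "u > 0" using that by (auto simp: x0_def)
    define k where "k = nat \<lceil>log 2 (L / u)\<rceil>"
    have "log 2 (L / u) \<ge> 0" using that \<open>u > 0\<close> by (subst zero_le_log_cancel_iff) (auto simp: x0_def)
    hence k: "log 2 (L / u) \<le> real k" "real k < log 2 (L / u) + 1" unfolding k_def by linarith+
    have "L \<le> 2 ^ k * u"
    proof -
      have "L / u = 2 powr (log 2 (L / u))" using \<open>L > 0\<close> \<open>u > 0\<close> by simp
      also have "\<dots> \<le> 2 powr real k" using k(1) by simp
      finally show ?thesis using \<open>u > 0\<close> by (simp add: powr_realpow field_simps)
    qed
    have "2 ^ k \<le> 2 * (L / u)"
    proof -
      have "2 powr real k \<le> 2 powr (log 2 (L / u) + 1)" using k(2) by simp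
      also have "\<dots> = 2 * (L / u)" using \<open>L > 0\<close> \<open>u > 0\<close> by (simp add: powr_add)
      finally show ?thesis by (simp add: powr_realpow)
    qed
    have "F u \<le> (2 ^ k) powr q * F (2 ^ k * u)" by (rule dbl) fact
    also have "\<dots> \<le> (2 ^ k) powr q * F L" using \<open>L \<le> 2 ^ k * u\<close> by (intro mult_left_mono F_anti) auto
    also have "\<dots> \<le> (2 * (L / u)) powr q * F L"
      using \<open>2 ^ k \<le> 2 * (L / u)\<close> \<open>q > 0\<close> F_pos[of L] by (intro mult_right_mono powr_mono2) auto
    also have "\<dots> = 2 powr q * (L / u) powr q * F L"
      using \<open>L > 0\<close> \<open>u > 0\<close> by (simp add: powr_mult powr_divide)
    finally show ?thesis .
  qed
  \<comment> \<open>The factor 1 / F x0 covers u < x0: there F u is at most 1 = F x0 / F x0, the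
    bound known at x0 applies, and (L / x0) powr q is at most (L / u) powr q.\<close>
  have "F u \<le> 2 powr q / F x0 * (L / u) powr q * F L" if "x0 \<le> L" "0 < u" "u \<le> L" for L u
  proof (cases "x0 \<le> u")
    case True
    have "2 powr q * 1 \<le> 2 powr q * (1 / F x0)"
      using F_le_1[of x0] F_pos[of x0] by (intro mult_left_mono) (auto simp: field_simps)
    hence "2 powr q * (L / u) powr q * F L \<le> 2 powr q / F x0 * (L / u) powr q * F L"
      using F_pos[of L] by (intro mult_right_mono) auto
    with main[OF True \<open>u \<le> L\<close>] show ?thesis by linarith
  next
    case False
    have "x0 > 0" by (simp add: x0_def)
    have "F u \<le> F x0 / F x0" using F_le_1[of u] F_pos[of x0] by simp
    also have "\<dots> \<le> 2 powr q * (L / x0) powr q * F L / F x0"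
      using main[of x0 L] that F_pos[of x0] by (intro divide_right_mono) auto
    also have "\<dots> = 2 powr q / F x0 * (L / x0) powr q * F L" by simp
    also have "\<dots> \<le> 2 powr q / F x0 * (L / u) powr q * F L"
      using F_pos[of x0] F_pos[of L] that False \<open>q > 0\<close> \<open>x0 > 0\<close>
      by (intro mult_right_mono mult_left_mono powr_mono2 divide_left_mono) auto
    finally show ?thesis .
  qed
  then show ?thesis
    using F_pos[of x0] by (intro that[of "2 powr q / F x0" x0]) (auto simp: x0_def)
qed

lemma tail_lower_bound:
  assumes "q > \<alpha>"
  obtains c x0 where "c > 0" "x0 > 0" "\<And>x. x0 \<le> x \<Longrightarrow> F x \<ge> c * x powr (-q)"
proof -
  from potter_lower[OF assms] obtain C x0 where C: "C > 0" "x0 > 0"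
    "\<And>L u. x0 \<le> L \<Longrightarrow> 0 < u \<Longrightarrow> u \<le> L \<Longrightarrow> F u \<le> C * (L / u) powr q * F L" by blast
  show ?thesis
  proof (rule that[of "F x0 * x0 powr q / C" x0])
    show "F x0 * x0 powr q / C > 0" using C F_pos[of x0] by simp
    fix x assume "x0 \<le> x"
    with C(3)[of x x0] C(1,2) have "F x0 \<le> C * (x / x0) powr q * F x" by simp
    also have "(x / x0) powr q = x powr q / x0 powr q"
      using C \<open>x0 \<le> x\<close> by (simp add: powr_divide)
    finally show "F x0 * x0 powr q / C * x powr (-q) \<le> F x"
      using C \<open>x0 \<le> x\<close> by (simp add: powr_minus field_simps)
  qed fact
qed

section \<open>Karamata's bounds for truncated moments\<close>

context
  fixes M :: "'w measure" and Y :: "'w \<Rightarrow> real"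
  assumes M: "prob_space M" and Y[measurable]: "Y \<in> borel_measurable M"
    and F_eq: "\<And>x. F x = measure M {\<omega> \<in> space M. Y \<omega> > x}"
begin

lemma emeasure_tail: "emeasure M {\<omega> \<in> space M. Y \<omega> > x} = ennreal (F x)"
proof -
  interpret prob_space M by fact
  show ?thesis by (simp add: F_eq emeasure_eq_measure)
qed

text \<open>Dyadic shells: for L / 2 ^ Suc k < Y <= L / 2 ^ k the integrand is at most (L / 2 ^ k)
  powr q, and the shell has probability at most F (L / 2 ^ Suc k). Potter's bound turns the sum over
  k into a geometric series.\<close>

lemma truncated_moment_lower:
  assumes "q > \<alpha>"
  obtains C x0 where "C > 0" "x0 > 0"
    "\<And>L. x0 \<le> L \<Longrightarrow> (\<integral>\<^sup>+\<omega>. ennreal (Y \<omega> powr q) * indicator {0<..L} (Y \<omega>) \<partial>M) \<le> ennreal (C * L powr q * F L)"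
proof -
  \<comment> \<open>Strictly between \<alpha> and q: the Potter bound needs r > \<alpha>, and the
    ratio 2 powr (r - q) of the series needs r < q.\<close>
  define r where "r = (\<alpha> + q) / 2"
  have r: "\<alpha> < r" "r < q" using assms by (auto simp: r_def)
  have "q > 0" using assms \<alpha>_pos by simp
  from potter_lower[OF r(1)] obtain C x0 where C: "C > 0" "x0 > 0"
    "\<And>L u. x0 \<le> L \<Longrightarrow> 0 < u \<Longrightarrow> u \<le> L \<Longrightarrow> F u \<le> C * (L / u) powr r * F L" by blast
  define s where "s = (2::real) powr (r - q)"
  have s: "0 < s" "s < 1" using r powr_less_mono[of _ 0 2] by (auto simp: s_def)
  have "(\<integral>\<^sup>+\<omega>. ennreal (Y \<omega> powr q) * indicator {0<..L} (Y \<omega>) \<partial>M)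
      \<le> ennreal (C * 2 powr r / (1 - s) * L powr q * F L)" if L: "x0 \<le> L" for L
  proof -
    have "L > 0" using L C by simp
    have pt: "ennreal (Y \<omega> powr q) * indicator {0<..L} (Y \<omega>)
      \<le> (\<Sum>k. ennreal ((L / 2 ^ k) powr q) * indicator {\<omega> \<in> space M. Y \<omega> > L / 2 ^ Suc k} \<omega>)" (is "_ \<le> suminf ?g")
      if "\<omega> \<in> space M" for \<omega>
    proof (cases "0 < Y \<omega> \<and> Y \<omega> \<le> L")
      case True
      define k where "k = nat \<lfloor>log 2 (L / Y \<omega>)\<rfloor>"
      have "log 2 (L / Y \<omega>) \<ge> 0" using True by (subst zero_le_log_cancel_iff) auto
      hence k: "real k \<le> log 2 (L / Y \<omega>)" "log 2 (L / Y \<omega>) < real k + 1" unfolding k_def by linarith+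
      have "2 powr real k \<le> 2 powr (log 2 (L / Y \<omega>))" using k(1) by simp
      hence k1: "2 ^ k \<le> L / Y \<omega>" using True by (simp add: powr_realpow)
      have "2 powr (log 2 (L / Y \<omega>)) < 2 powr (real k + 1)" using k(2) by simp
      hence k2: "L / Y \<omega> < 2 * 2 ^ k" using True by (simp add: powr_realpow powr_add)
      have "Y \<omega> \<le> L / 2 ^ k" using k1 True by (simp add: field_simps)
      hence "ennreal (Y \<omega> powr q) * indicator {0<..L} (Y \<omega>) \<le> ?g k"
        using k2 True that \<open>q > 0\<close> by (auto simp: field_simps intro!: ennreal_leI powr_mono2)
      also have "\<dots> \<le> suminf ?g"
        using sum_le_suminf[of ?g "{k}"] by (simp del: sum_mult_indicator)
      finally show ?thesis .
    qed auto
    have "(\<integral>\<^sup>+\<omega>. ennreal (Y \<omega> powr q) * indicator {0<..L} (Y \<omega>) \<partial>M)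
      \<le> (\<integral>\<^sup>+\<omega>. (\<Sum>k. ennreal ((L / 2 ^ k) powr q) * indicator {\<omega> \<in> space M. Y \<omega> > L / 2 ^ Suc k} \<omega>) \<partial>M)"
      by (intro nn_integral_mono pt)
    also have "\<dots> = (\<Sum>k. ennreal ((L / 2 ^ k) powr q) * ennreal (F (L / 2 ^ Suc k)))"
      by (subst nn_integral_suminf) (auto simp: nn_integral_cmult emeasure_tail)
    also have "\<dots> \<le> (\<Sum>k. ennreal (L powr q * C * 2 powr r * F L * s ^ k))"
    proof (intro suminf_le summableI)
      fix k
      have "F (L / 2 ^ Suc k) \<le> C * (L / (L / 2 ^ Suc k)) powr r * F L"
        using L \<open>L > 0\<close> by (intro C(3)) (auto simp: field_simps intro: order_trans[OF _ mult_left_mono[of 1]])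
      also have "L / (L / 2 ^ Suc k) = 2 ^ Suc k" using \<open>L > 0\<close> by simp
      finally have "(L / 2 ^ k) powr q * F (L / 2 ^ Suc k) \<le> (L / 2 ^ k) powr q * (C * (2 ^ Suc k) powr r * F L)"
        by (intro mult_left_mono) auto
      also have "\<dots> = L powr q * C * 2 powr r * F L * s ^ k"
      proof -
        have "s ^ k = (2 ^ k) powr r / (2 ^ k) powr q"
          by (simp add: s_def powr_diff powr_divide powr_powr mult.commute flip: powr_realpow)
        then show ?thesis using \<open>L > 0\<close> by (simp add: powr_divide powr_mult)
      qed
      finally show "ennreal ((L / 2 ^ k) powr q) * ennreal (F (L / 2 ^ Suc k)) \<le> ennreal (L powr q * C * 2 powr r * F L * s ^ k)"
        using F_pos[of "L / 2 ^ Suc k"] by (simp flip: ennreal_mult add: ennreal_leI)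
    qed
    also have "\<dots> = ennreal (\<Sum>k. L powr q * C * 2 powr r * F L * s ^ k)"
      using s C F_pos[of L] by (intro suminf_ennreal2 summable_mult summable_geometric) auto
    also have "(\<Sum>k. L powr q * C * 2 powr r * F L * s ^ k) = L powr q * C * 2 powr r * F L * (1 / (1 - s))"
      using s by (subst suminf_mult) (auto simp: suminf_geometric intro!: summable_geometric)
    finally show ?thesis by (simp add: field_simps)
  qed
  then show ?thesis using C s by (intro that[of "C * 2 powr r / (1 - s)" x0]) auto
qed

text \<open>The same shells above L. Now F must decay faster than the integrand grows, so the Potter
  exponent lies between p and \<alpha>.\<close>

lemma truncated_moment_upper:
  assumes "0 < p" "p < \<alpha>"
  obtains C x0 where "C > 0" "x0 > 0"
    "\<And>L. x0 \<le> L \<Longrightarrow> (\<integral>\<^sup>+\<omega>. ennreal (Y \<omega> powr p) * indicator {L<..} (Y \<omega>) \<partial>M) \<le> ennreal (C * L powr p * F L)"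
proof -
  define r where "r = (\<alpha> + p) / 2"
  have r: "0 \<le> r" "p < r" "r < \<alpha>" using assms by (auto simp: r_def)
  from potter_upper[OF r(1,3)] obtain C x0 where C: "C > 0" "x0 > 0"
    "\<And>L v. x0 \<le> L \<Longrightarrow> L \<le> v \<Longrightarrow> F v \<le> C * (L / v) powr r * F L" by blast
  define s where "s = (2::real) powr (p - r)"
  have s: "0 < s" "s < 1" using r powr_less_mono[of _ 0 2] by (auto simp: s_def)
  have "(\<integral>\<^sup>+\<omega>. ennreal (Y \<omega> powr p) * indicator {L<..} (Y \<omega>) \<partial>M)
      \<le> ennreal (C * 2 powr p / (1 - s) * L powr p * F L)" if L: "x0 \<le> L" for L
  proof -
    have "L > 0" using L C by simp
    have pt: "ennreal (Y \<omega> powr p) * indicator {L<..} (Y \<omega>)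
      \<le> (\<Sum>k. ennreal ((2 ^ Suc k * L) powr p) * indicator {\<omega> \<in> space M. Y \<omega> > 2 ^ k * L} \<omega>)" (is "_ \<le> suminf ?g")
      if "\<omega> \<in> space M" for \<omega>
    proof (cases "L < Y \<omega>")
      case True
      \<comment> \<open>The shells 2 ^ k * L < Y <= 2 ^ Suc k * L are open on the left to match the
        strict inequality in the tail; hence a ceiling minus one, against the floor used below
        L.\<close>
      define k where "k = nat (\<lceil>log 2 (Y \<omega> / L)\<rceil> - 1)"
      have "log 2 (Y \<omega> / L) > 0" using True \<open>L > 0\<close> by (subst zero_less_log_cancel_iff) auto
      hence k: "real k < log 2 (Y \<omega> / L)" "log 2 (Y \<omega> / L) \<le> real k + 1" unfolding k_def by linarith+
      have pos: "Y \<omega> > 0" using True \<open>L > 0\<close> by simp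
      have "2 powr real k < 2 powr (log 2 (Y \<omega> / L))" using k(1) by simp
      hence k1: "2 ^ k < Y \<omega> / L" using pos \<open>L > 0\<close> by (simp add: powr_realpow)
      have "2 powr (log 2 (Y \<omega> / L)) \<le> 2 powr (real k + 1)" using k(2) by simp
      hence k2: "Y \<omega> / L \<le> 2 * 2 ^ k" using pos \<open>L > 0\<close> by (simp add: powr_realpow powr_add)
      have "ennreal (Y \<omega> powr p) * indicator {L<..} (Y \<omega>) \<le> ?g k"
        using k1 k2 True that \<open>L > 0\<close> pos assms by (auto simp: field_simps intro!: ennreal_leI powr_mono2)
      also have "\<dots> \<le> suminf ?g"
        using sum_le_suminf[of ?g "{k}"] by (simp del: sum_mult_indicator)
      finally show ?thesis .
    qed auto
    have "(\<integral>\<^sup>+\<omega>. ennreal (Y \<omega> powr p) * indicator {L<..} (Y \<omega>) \<partial>M)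
      \<le> (\<integral>\<^sup>+\<omega>. (\<Sum>k. ennreal ((2 ^ Suc k * L) powr p) * indicator {\<omega> \<in> space M. Y \<omega> > 2 ^ k * L} \<omega>) \<partial>M)"
      by (intro nn_integral_mono pt)
    also have "\<dots> = (\<Sum>k. ennreal ((2 ^ Suc k * L) powr p) * ennreal (F (2 ^ k * L)))"
      by (subst nn_integral_suminf) (auto simp: nn_integral_cmult emeasure_tail)
    also have "\<dots> \<le> (\<Sum>k. ennreal (L powr p * C * 2 powr p * F L * s ^ k))"
    proof (intro suminf_le summableI)
      fix k
      have "F (2 ^ k * L) \<le> C * (L / (2 ^ k * L)) powr r * F L"
        using L \<open>L > 0\<close> by (intro C(3)) auto
      also have "L / (2 ^ k * L) = 1 / 2 ^ k" using \<open>L > 0\<close> by simp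
      finally have "(2 ^ Suc k * L) powr p * F (2 ^ k * L) \<le> (2 ^ Suc k * L) powr p * (C * (1 / 2 ^ k) powr r * F L)"
        by (intro mult_left_mono) auto
      also have "\<dots> = L powr p * C * 2 powr p * F L * s ^ k"
      proof -
        have "s ^ k = (2 ^ k) powr p / (2 ^ k) powr r"
          by (simp add: s_def powr_diff powr_divide powr_powr mult.commute flip: powr_realpow)
        then show ?thesis using \<open>L > 0\<close> by (simp add: powr_divide powr_mult)
      qed
      finally show "ennreal ((2 ^ Suc k * L) powr p) * ennreal (F (2 ^ k * L)) \<le> ennreal (L powr p * C * 2 powr p * F L * s ^ k)"
        using F_pos[of "2 ^ k * L"] by (simp flip: ennreal_mult add: ennreal_leI)
    qed
    also have "\<dots> = ennreal (\<Sum>k. L powr p * C * 2 powr p * F L * s ^ k)"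
      using s C F_pos[of L] by (intro suminf_ennreal2 summable_mult summable_geometric) auto
    also have "(\<Sum>k. L powr p * C * 2 powr p * F L * s ^ k) = L powr p * C * 2 powr p * F L * (1 / (1 - s))"
      using s by (subst suminf_mult) (auto simp: suminf_geometric intro!: summable_geometric)
    finally show ?thesis by (simp add: field_simps)
  qed
  then show ?thesis using C s by (intro that[of "C * 2 powr p / (1 - s)" x0]) auto
qed

end

end

section \<open>From vague convergence to tails\<close>

definition clamp_real :: "real \<Rightarrow> real \<Rightarrow> real" where
  "clamp_real R x = max (-R) (min R x)"

text \<open>A sum of extended reals is not continuous where opposite infinities meet. Cutting every
  coordinate at \<plusminus>R gives a continuous real substitute, exact as long as no coordinate
  exceeds R.\<close>

definition clamp_ereal :: "real \<Rightarrow> ereal \<Rightarrow> real" where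
  "clamp_ereal R x = real_of_ereal (max (ereal (-R)) (min (ereal R) x))"

text \<open>For s < t, a continuous function squeezed between the indicators of x >= t and of x >
  s.\<close>

definition ramp :: "real \<Rightarrow> real \<Rightarrow> real \<Rightarrow> real" where
  "ramp s t x = max 0 (min 1 ((x - s) / (t - s)))"

lemma clamp_ereal_ereal [simp]: "clamp_ereal R (ereal x) = clamp_real R x"
  by (simp add: clamp_ereal_def clamp_real_def max_def min_def)

lemma clamp_real_eq: "\<bar>x\<bar> \<le> R \<Longrightarrow> clamp_real R x = x"
  by (auto simp: clamp_real_def)

lemma clamp_ereal_eq: "\<bar>x\<bar> \<le> ereal R \<Longrightarrow> clamp_ereal R x = real_of_ereal x"
  by (cases x) (auto simp: clamp_real_eq)

lemma abs_clamp_ereal_le: "R \<ge> 0 \<Longrightarrow> ereal \<bar>clamp_ereal R x\<bar> \<le> \<bar>x\<bar>"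
  by (cases x) (auto simp: clamp_real_def)

lemma continuous_on_clamp_ereal: "R \<ge> 0 \<Longrightarrow> continuous_on UNIV (clamp_ereal R)"
proof -
  assume "R \<ge> 0"
  have "max (ereal (-R)) (min (ereal R) x) \<noteq> \<infinity> \<and> max (ereal (-R)) (min (ereal R) x) \<noteq> -\<infinity>" for x
    by (cases x) (auto simp: max_def min_def)
  then have "range (\<lambda>x. max (ereal (-R)) (min (ereal R) x)) \<subseteq> UNIV - {\<infinity>, -\<infinity>}" by auto
  moreover have "continuous_on UNIV (\<lambda>x. max (ereal (-R)) (min (ereal R) x))"
    by (intro continuous_on_max continuous_on_min continuous_on_const continuous_on_id)
  ultimately show ?thesis
    unfolding clamp_ereal_def by (intro continuous_on_compose2[OF continuous_on_real]) auto
qed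

lemma measurable_clamp_ereal [measurable]: "R \<ge> 0 \<Longrightarrow> clamp_ereal R \<in> borel_measurable borel"
  by (intro borel_measurable_continuous_onI continuous_on_clamp_ereal)

lemma ramp_range: "0 \<le> ramp s t x" "ramp s t x \<le> 1"
  by (auto simp: ramp_def)

lemma ramp_eq_0: "s < t \<Longrightarrow> x \<le> s \<Longrightarrow> ramp s t x = 0"
  by (auto simp: ramp_def divide_nonpos_pos)

lemma ramp_eq_1: "s < t \<Longrightarrow> t \<le> x \<Longrightarrow> ramp s t x = 1"
  by (auto simp: ramp_def)

lemma continuous_on_ramp: "s < t \<Longrightarrow> continuous_on UNIV (ramp s t)"
  unfolding ramp_def by (intro continuous_intros) auto

lemma measurable_ramp [measurable]: "ramp s t \<in> borel_measurable borel"
  unfolding ramp_def by measurable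

text \<open>Removing the origin costs nothing as f vanishes there. Both Bochner integrals are routed
  through the nonnegative integral, so the identity also covers a divergent one, where both sides
  are 0 by convention.\<close>

lemma integral_scaled_law:
  fixes X :: "int \<Rightarrow> 'w \<Rightarrow> real"
  assumes [measurable]: "\<And>i. X i \<in> borel_measurable M"
    and f[measurable]: "f \<in> borel_measurable (PiM {1..d} (\<lambda>_. borel))"
    and f0: "f (\<lambda>i\<in>{1..d}. 0) = 0" and pos: "\<And>x. 0 \<le> f x"
  shows "(\<integral>x. f x \<partial>scaled_law M X a d n) = real n * (\<integral>\<omega>. f (\<lambda>i\<in>{1..d}. ereal (X (int i) \<omega> / a n)) \<partial>M)"
proof -
  let ?P = "PiM {1..d} (\<lambda>_. borel :: ereal measure)"
  let ?T = "\<lambda>\<omega>. \<lambda>i\<in>{1..d}. ereal (X (int i) \<omega> / a n)"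
  have T[measurable]: "?T \<in> M \<rightarrow>\<^sub>M ?P" by measurable
  have "{\<lambda>i\<in>{1..d}. 0 :: ereal} = PiE {1..d} (\<lambda>_. {0})" by auto
  also have "\<dots> \<in> sets ?P" by (intro sets_PiM_I_finite) auto
  finally have "{\<lambda>i\<in>{1..d}. 0} \<in> sets ?P" .
  then have ps: "punctured d \<inter> space (distr M ?P ?T) \<in> sets (distr M ?P ?T)"
  proof -
    assume "{\<lambda>i\<in>{1..d}. 0} \<in> sets ?P"
    moreover have "punctured d \<inter> space (distr M ?P ?T) = space ?P - {\<lambda>i\<in>{1..d}. 0}"
      by (auto simp: punctured_def space_PiM)
    ultimately show ?thesis by simp
  qed
  have fm: "f \<in> borel_measurable (scaled_law M X a d n)"
  proof -
    have "sets (scaled_law M X a d n) = sets (restrict_space ?P (punctured d))"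
      by (simp add: scaled_law_def cong: sets_restrict_space_cong)
    then show ?thesis using measurable_restrict_space1[OF f] by (simp cong: measurable_cong_sets)
  qed
  have "(\<integral>\<^sup>+x. ennreal (f x) \<partial>scaled_law M X a d n)
      = of_nat n * (\<integral>\<^sup>+x. ennreal (f x) * indicator (punctured d) x \<partial>distr M ?P ?T)"
    unfolding scaled_law_def using ps
    by (subst nn_integral_scale_measure) (auto simp: nn_integral_restrict_space simp del: One_nat_def intro!: measurable_restrict_space1)
  also have "(\<integral>\<^sup>+x. ennreal (f x) * indicator (punctured d) x \<partial>distr M ?P ?T) = (\<integral>\<^sup>+x. ennreal (f x) \<partial>distr M ?P ?T)"
    by (intro nn_integral_cong) (auto simp: punctured_def space_PiM f0 simp del: One_nat_def split: split_indicator)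
  also have "\<dots> = (\<integral>\<^sup>+\<omega>. ennreal (f (?T \<omega>)) \<partial>M)"
    by (subst nn_integral_distr) (auto simp del: One_nat_def)
  finally have *: "(\<integral>\<^sup>+x. ennreal (f x) \<partial>scaled_law M X a d n) = of_nat n * (\<integral>\<^sup>+\<omega>. ennreal (f (?T \<omega>)) \<partial>M)" .
  have "(\<integral>x. f x \<partial>scaled_law M X a d n) = enn2real (\<integral>\<^sup>+x. ennreal (f x) \<partial>scaled_law M X a d n)"
    using fm pos by (intro integral_eq_nn_integral) auto
  also have "\<dots> = real n * enn2real (\<integral>\<^sup>+\<omega>. ennreal (f (?T \<omega>)) \<partial>M)"
    unfolding * by (simp add: enn2real_mult)
  also have "enn2real (\<integral>\<^sup>+\<omega>. ennreal (f (?T \<omega>)) \<partial>M) = (\<integral>\<omega>. f (?T \<omega>) \<partial>M)"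
    using pos by (intro integral_eq_nn_integral[symmetric]) (auto simp del: One_nat_def)
  finally show ?thesis .
qed

text \<open>Two instances matter: the sum, whose tail yields \<open>b_plus\<close>, and the sum of
  absolute values, which yields the tail of |X| and the control of extreme coordinates. Homogeneity
  is stated for restricted functions because points of the product space are extensional.\<close>

locale homogeneous_functional =
  fixes d :: nat and \<phi> :: "(nat \<Rightarrow> real) \<Rightarrow> real"
  assumes cont: "continuous_map (product_topology (\<lambda>_. euclideanreal) {1..d}) euclideanreal \<phi>"
    and meas[measurable]: "\<phi> \<in> borel_measurable (PiM {1..d} (\<lambda>_. borel))"
    and hom: "\<And>t y. t > 0 \<Longrightarrow> \<phi> (\<lambda>i\<in>{1..d}. t * y i) = t * \<phi> (\<lambda>i\<in>{1..d}. y i)"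
    and bound: "\<And>y. \<phi> y \<le> (\<Sum>i=1..d. \<bar>y i\<bar>)"

lemma homogeneous_functional_sum: "homogeneous_functional d (\<lambda>y. \<Sum>i=1..d. y i)"
  by standard (auto simp: sum_distrib_left intro!: continuous_map_sum continuous_map_product_projection sum_mono)

lemma homogeneous_functional_sum_abs: "homogeneous_functional d (\<lambda>y. \<Sum>i=1..d. \<bar>y i\<bar>)"
  by standard (auto simp: sum_distrib_left abs_mult intro!: continuous_map_sum continuous_map_real_abs
    continuous_map_product_projection)

locale vague_limit =
  fixes M :: "'w measure" and X :: "int \<Rightarrow> 'w \<Rightarrow> real" and a :: "nat \<Rightarrow> real" and d :: nat
    and \<mu> :: "(nat \<Rightarrow> ereal) measure" and \<alpha> :: real
  assumes M: "prob_space M" and X_meas[measurable]: "\<And>i. X i \<in> borel_measurable M"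
    and a_pos: "\<And>n. a n > 0" and \<alpha>_pos: "\<alpha> > 0" and d_pos: "d \<ge> 1"
    and radon: "radon_punctured d \<mu>" and vague: "vague_conv d (scaled_law M X a d) \<mu>"
    and homog: "\<And>t B. t > 0 \<Longrightarrow> B \<in> sets \<mu> \<Longrightarrow>
        emeasure \<mu> ((\<lambda>x. \<lambda>i\<in>{1..d}. ereal t * x i) ` B) = ennreal (t powr (-\<alpha>)) * emeasure \<mu> B"
begin

abbreviation "I \<equiv> {1..d}"

lemma sets_\<mu>: "sets \<mu> = sets (restrict_space (PiM I (\<lambda>_. borel)) (punctured d))"
  using radon by (simp add: radon_punctured_def punctured_borel_def)

lemma space_\<mu>: "space \<mu> = punctured d"
  using sets_eq_imp_space_eq[OF sets_\<mu>] by (auto simp: space_restrict_space space_PiM punctured_def)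

lemma measurable_\<mu>: "f \<in> PiM I (\<lambda>_. borel) \<rightarrow>\<^sub>M N \<Longrightarrow> f \<in> \<mu> \<rightarrow>\<^sub>M N"
  unfolding measurable_cong_sets[OF sets_\<mu> refl] by (rule measurable_restrict_space1)

lemma finite_measure_bounded_away:
  "B \<in> sets \<mu> \<Longrightarrow> bounded_away d B \<Longrightarrow> emeasure \<mu> B < \<infinity>"
  using radon by (auto simp: radon_punctured_def)

definition exceed :: "real \<Rightarrow> (nat \<Rightarrow> ereal) set" where
  "exceed R = {x \<in> punctured d. \<exists>i\<in>I. \<bar>x i\<bar> > ereal R}"

text \<open>Infinite coordinates are read as 0 by \<open>real_of_ereal\<close>. This is harmless:
  such points lie in \<open>exceed R\<close> for every R, and the mass of \<open>exceed R\<close>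
  tends to 0 by scaling.\<close>

definition super :: "((nat \<Rightarrow> real) \<Rightarrow> real) \<Rightarrow> real \<Rightarrow> (nat \<Rightarrow> ereal) set" where
  "super \<phi> t = {x \<in> punctured d. \<phi> (\<lambda>i\<in>I. real_of_ereal (x i)) > t}"

lemma exceed_sets [measurable]: "exceed R \<in> sets \<mu>"
proof -
  have "(\<lambda>x. \<exists>i\<in>I. \<bar>x i\<bar> > ereal R) \<in> measurable \<mu> (count_space UNIV)"
    by (rule measurable_\<mu>) measurable
  from predE[OF this] show ?thesis by (simp add: exceed_def space_\<mu>)
qed

lemma emeasure_exceed_finite: "R > 0 \<Longrightarrow> emeasure \<mu> (exceed R) < \<infinity>"
  by (intro finite_measure_bounded_away exceed_sets)
     (auto simp: exceed_def bounded_away_def intro!: exI[of _ R] less_imp_le)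

text \<open>The scaling hypothesis speaks of images, whereas the sets in use are level sets.
  Multiplication by t is a bijection of the punctured space, with inverse multiplication by 1 / t
  also at infinite coordinates.\<close>

lemma scale_image:
  assumes "t > 0" and P: "\<And>x. x \<in> punctured d \<Longrightarrow> P (\<lambda>i\<in>I. ereal t * x i) \<longleftrightarrow> Q x"
  shows "(\<lambda>x. \<lambda>i\<in>I. ereal t * x i) ` {x \<in> punctured d. Q x} = {x \<in> punctured d. P x}"
proof -
  have sc: "(\<lambda>i\<in>I. ereal s * x i) \<in> punctured d" if "x \<in> punctured d" "s > 0" for x s
  proof -
    obtain i where "i \<in> I" "x i \<noteq> 0"
    proof (rule ccontr)
      assume "\<not> thesis"
      then have "\<forall>i\<in>I. x i = 0" using that by blast
      then have "x = (\<lambda>i\<in>I. 0)" using \<open>x \<in> punctured d\<close>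
        by (auto simp: punctured_def PiE_def extensional_def fun_eq_iff)
      then show False using \<open>x \<in> punctured d\<close> by (simp add: punctured_def)
    qed
    then have "(\<lambda>i\<in>I. ereal s * x i) \<noteq> (\<lambda>i\<in>I. 0)"
      using \<open>s > 0\<close> by (auto simp: fun_eq_iff restrict_def)
    then show ?thesis by (auto simp: punctured_def)
  qed
  have inv: "(\<lambda>i\<in>I. ereal t * ((\<lambda>i\<in>I. ereal (1 / t) * x i) i)) = x" if "x \<in> punctured d" for x
  proof (rule ext)
    fix i
    have "ereal t * (ereal (1 / t) * x i) = x i"
      using \<open>t > 0\<close> by (cases "x i") auto
    then show "(\<lambda>i\<in>I. ereal t * ((\<lambda>i\<in>I. ereal (1 / t) * x i) i)) i = x i"
      using that by (auto simp: punctured_def PiE_def extensional_def)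
  qed
  show ?thesis
  proof (intro equalityI subsetI)
    fix x assume "x \<in> (\<lambda>x. \<lambda>i\<in>I. ereal t * x i) ` {x \<in> punctured d. Q x}"
    then show "x \<in> {x \<in> punctured d. P x}" using sc[OF _ \<open>t > 0\<close>] P by auto
  next
    fix x assume x: "x \<in> {x \<in> punctured d. P x}"
    let ?y = "\<lambda>i\<in>I. ereal (1 / t) * x i"
    have "?y \<in> punctured d" using x \<open>t > 0\<close> by (intro sc) auto
    moreover have "Q ?y" using P[OF \<open>?y \<in> punctured d\<close>] inv[of x] x by auto
    ultimately show "x \<in> (\<lambda>x. \<lambda>i\<in>I. ereal t * x i) ` {x \<in> punctured d. Q x}"
      using inv[of x] x by (intro image_eqI[of _ _ ?y]) auto
  qed
qed

lemma measure_exceed: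
  assumes "R > 0"
  shows "measure \<mu> (exceed R) = R powr (-\<alpha>) * measure \<mu> (exceed 1)"
proof -
  have "(\<lambda>x. \<lambda>i\<in>I. ereal R * x i) ` exceed 1 = exceed R"
    unfolding exceed_def
  proof (rule scale_image[OF assms])
    fix x :: "nat \<Rightarrow> ereal" 
    have "ereal R < \<bar>ereal R * y\<bar> \<longleftrightarrow> ereal 1 < \<bar>y\<bar>" for y
      using assms by (cases y) (auto simp: abs_mult)
    then show "(\<exists>i\<in>I. ereal R < \<bar>(\<lambda>i\<in>I. ereal R * x i) i\<bar>) = (\<exists>i\<in>I. ereal 1 < \<bar>x i\<bar>)" by simp
  qed
  with homog[OF assms, of "exceed 1"] show ?thesis
    by (simp add: measure_def enn2real_mult exceed_sets)
qed

end

locale vague_limit_functional = vague_limit + homogeneous_functional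
begin

definition test :: "real \<Rightarrow> real \<Rightarrow> real \<Rightarrow> (nat \<Rightarrow> ereal) \<Rightarrow> real" where
  "test R s t x = ramp s t (\<phi> (\<lambda>i\<in>I. clamp_ereal R (x i)))"

lemma super_sets [measurable]: "super \<phi> t \<in> sets \<mu>"
proof -
  have "(\<lambda>x. \<phi> (\<lambda>i\<in>I. real_of_ereal (x i)) > t) \<in> measurable \<mu> (count_space UNIV)"
    by (rule measurable_\<mu>) measurable
  from predE[OF this] show ?thesis by (simp add: super_def space_\<mu>)
qed

text \<open>Pigeonhole on \<open>bound\<close>: if the functional exceeds t, one of the d
  coordinates is at least t / d in absolute value.\<close>

lemma bounded_away_functional:
  assumes "t > 0" and S: "\<And>x. x \<in> S \<Longrightarrow> \<phi> (\<lambda>i\<in>I. u (x i)) > t" and u: "\<And>y. ereal \<bar>u y\<bar> \<le> \<bar>y\<bar>"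
  shows "bounded_away d S"
  unfolding bounded_away_def
proof (intro exI conjI ballI)
  show "t / d > 0" using \<open>t > 0\<close> d_pos by simp
  fix x assume "x \<in> S"
  have "\<exists>i\<in>I. \<bar>u (x i)\<bar> \<ge> t / d"
  proof (rule ccontr)
    assume "\<not> ?thesis"
    then have "(\<Sum>i=1..d. \<bar>u (x i)\<bar>) \<le> (\<Sum>i=1..d. t / d)" by (intro sum_mono) (auto simp: not_le less_imp_le)
    also have "\<dots> = t" using d_pos by simp
    finally show False using S[OF \<open>x \<in> S\<close>] bound[of "\<lambda>i\<in>I. u (x i)"] by simp
  qed
  then obtain i where "i \<in> I" "\<bar>u (x i)\<bar> \<ge> t / d" by auto
  then show "\<exists>i\<in>I. ereal (t / d) \<le> \<bar>x i\<bar>" using u[of "x i"] by (meson ereal_less_eq(3) order_trans)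
qed

lemma emeasure_super_finite: "t > 0 \<Longrightarrow> emeasure \<mu> (super \<phi> t) < \<infinity>"
proof (intro finite_measure_bounded_away super_sets)
  assume "t > 0"
  have "ereal \<bar>real_of_ereal y\<bar> \<le> \<bar>y\<bar>" for y by (cases y) auto
  then show "bounded_away d (super \<phi> t)" using \<open>t > 0\<close>
    by (intro bounded_away_functional[where u = real_of_ereal and t = t]) (auto simp: super_def)
qed

lemma measure_super:
  assumes "t > 0"
  shows "measure \<mu> (super \<phi> t) = t powr (-\<alpha>) * measure \<mu> (super \<phi> 1)"
proof -
  have "(\<lambda>x. \<lambda>i\<in>I. ereal t * x i) ` super \<phi> 1 = super \<phi> t"
    unfolding super_def
  proof (rule scale_image[OF assms])
    fix x :: "nat \<Rightarrow> ereal"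
    have "(\<lambda>i\<in>I. real_of_ereal ((\<lambda>i\<in>I. ereal t * x i) i)) = (\<lambda>i\<in>I. t * real_of_ereal (x i))"
      by (auto simp: fun_eq_iff)
    then show "(t < \<phi> (\<lambda>i\<in>I. real_of_ereal ((\<lambda>i\<in>I. ereal t * x i) i))) = (1 < \<phi> (\<lambda>i\<in>I. real_of_ereal (x i)))"
      using hom[OF assms, of "\<lambda>i. real_of_ereal (x i)"] assms by simp
  qed
  with homog[OF assms super_sets[of 1]] show ?thesis
    by (simp add: measure_def enn2real_mult)
qed

context
  fixes R s t :: real
  assumes R: "R > 0" and st: "0 < s" "s < t"
begin

lemma measurable_clamp_R [measurable]: "clamp_ereal R \<in> borel_measurable borel"
  using R by (intro measurable_clamp_ereal) simp

text \<open>Clamping makes the composition continuous on the whole extended space, infinite points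
  included, and s > 0 keeps its support away from the origin; so it is an admissible test
  function.\<close>

lemma test_tendsto:
  "(\<lambda>n. real n * (\<integral>\<omega>. ramp s t (\<phi> (\<lambda>i\<in>I. clamp_real R (X (int i) \<omega> / a n))) \<partial>M))
     \<longlonglongrightarrow> (\<integral>x. test R s t x \<partial>\<mu>)"
proof -
  have 1: "continuous_map (product_topology (\<lambda>_. euclidean) I) (product_topology (\<lambda>_. euclideanreal) I)
     (\<lambda>x. \<lambda>i\<in>I. clamp_ereal R (x i))"
    unfolding continuous_map_componentwise
  proof (intro conjI ballI)
    fix k assume k: "k \<in> I"
    have "continuous_map (product_topology (\<lambda>_. euclidean) I) euclideanreal (clamp_ereal R \<circ> (\<lambda>x. x k))"
      using continuous_on_clamp_ereal[of R] R k
      by (intro continuous_map_compose[of _ euclidean] continuous_map_product_projection) auto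
    then show "continuous_map (product_topology (\<lambda>_. euclidean) I) euclideanreal (\<lambda>x. (\<lambda>i\<in>I. clamp_ereal R (x i)) k)"
      using k by (simp add: o_def)
  qed auto
  have 2: "continuous_map euclideanreal euclideanreal (ramp s t)"
    using continuous_on_ramp[OF st(2)] by simp
  have c: "continuous_map (punctured_top d) euclideanreal (test R s t)"
    unfolding punctured_top_def test_def
    using continuous_map_compose[OF continuous_map_compose[OF 1 cont] 2]
    by (intro continuous_map_from_subtopology) (simp add: o_def)
  have b: "bounded_away d {x \<in> punctured d. test R s t x \<noteq> 0}"
  proof (rule bounded_away_functional[where u = "clamp_ereal R" and t = s])
    fix x assume "x \<in> {x \<in> punctured d. test R s t x \<noteq> 0}"
    then show "s < \<phi> (\<lambda>i\<in>I. clamp_ereal R (x i))"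
      using ramp_eq_0[OF st(2)] by (auto simp: test_def not_le[symmetric])
  qed (use st R abs_clamp_ereal_le in auto)
  have m: "test R s t \<in> borel_measurable (PiM I (\<lambda>_. borel))"
    unfolding test_def by measurable
  have z: "test R s t (\<lambda>i\<in>I. 0) = 0"
  proof -
    have "(\<lambda>i\<in>I. clamp_ereal R ((\<lambda>i\<in>I. 0) i)) = (\<lambda>i\<in>I. 0)"
      using R by (auto simp: clamp_ereal_def zero_ereal_def max_def min_def)
    moreover have "\<phi> (\<lambda>i\<in>I. 0) \<le> s" using bound[of "\<lambda>i\<in>I. 0"] st by simp
    ultimately show ?thesis using st by (simp add: test_def ramp_eq_0)
  qed
  have "(\<lambda>n. \<integral>x. test R s t x \<partial>scaled_law M X a d n) \<longlonglongrightarrow> (\<integral>x. test R s t x \<partial>\<mu>)"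
    using vague c b by (auto simp: vague_conv_def)
  also have "(\<lambda>n. \<integral>x. test R s t x \<partial>scaled_law M X a d n) =
     (\<lambda>n. real n * (\<integral>\<omega>. ramp s t (\<phi> (\<lambda>i\<in>I. clamp_real R (X (int i) \<omega> / a n))) \<partial>M))"
    by (subst integral_scaled_law[OF X_meas m z])
       (auto simp: test_def ramp_range cong: restrict_cong)
  finally show ?thesis .
qed

text \<open>Off \<open>exceed R\<close> nothing is clamped and the ramp lies between the indicators
  of two superlevel sets; on \<open>exceed R\<close> the indicator of that set pays for any
  discrepancy.\<close>

lemma test_upper: "(\<integral>x. test R s t x \<partial>\<mu>) \<le> measure \<mu> (super \<phi> s) + measure \<mu> (exceed R)"
  and test_lower: "measure \<mu> (super \<phi> t) \<le> (\<integral>x. test R s t x \<partial>\<mu>) + measure \<mu> (exceed R)"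
proof -
  have m[measurable]: "test R s t \<in> borel_measurable \<mu>"
    unfolding test_def by (intro measurable_\<mu>) measurable
  have eq: "(\<lambda>i\<in>I. clamp_ereal R (x i)) = (\<lambda>i\<in>I. real_of_ereal (x i))"
    if "x \<in> punctured d" "x \<notin> exceed R" for x
    using that by (auto simp: exceed_def fun_eq_iff not_less intro!: clamp_ereal_eq)
  have i1: "integrable \<mu> (\<lambda>x. indicat_real (super \<phi> r) x + indicat_real (exceed R) x)" if "r > 0" for r
    using emeasure_super_finite[OF that] emeasure_exceed_finite[OF R]
    by (intro Bochner_Integration.integrable_add integrable_real_indicator) auto
  have up: "test R s t x \<le> indicat_real (super \<phi> s) x + indicat_real (exceed R) x" if "x \<in> space \<mu>" for x
  proof (cases "x \<in> exceed R")
    case True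
    then show ?thesis using ramp_range(2)[of s t] by (auto simp: test_def intro: add_increasing)
  next
    case False
    then show ?thesis using that eq[of x] ramp_range(2)[of s t] ramp_eq_0[OF st(2)]
      by (auto simp: test_def space_\<mu> super_def not_less split: split_indicator)
  qed
  have lo: "indicat_real (super \<phi> t) x \<le> test R s t x + indicat_real (exceed R) x" if "x \<in> space \<mu>" for x
  proof (cases "x \<in> exceed R")
    case True
    then show ?thesis using ramp_range(1)[of s t] by (auto simp: test_def intro!: add_increasing split: split_indicator)
  next
    case False
    then show ?thesis using that eq[of x] ramp_range(1)[of s t] ramp_eq_1[OF st(2)]
      by (auto simp: test_def space_\<mu> super_def split: split_indicator)
  qed
  have i: "integrable \<mu> (test R s t)"
    by (rule Bochner_Integration.integrable_bound[OF i1[OF st(1)]])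
       (use up ramp_range in \<open>auto simp: test_def intro!: AE_I2\<close>)
  have int: "(\<integral>x. indicat_real (super \<phi> r) x + indicat_real (exceed R) x \<partial>\<mu>)
    = measure \<mu> (super \<phi> r) + measure \<mu> (exceed R)" if "r > 0" for r
    using emeasure_super_finite[OF that] emeasure_exceed_finite[OF R] by (subst Bochner_Integration.integral_add) auto
  show "(\<integral>x. test R s t x \<partial>\<mu>) \<le> measure \<mu> (super \<phi> s) + measure \<mu> (exceed R)"
    using integral_mono[OF i i1[OF st(1)] up] int[OF st(1)] by simp
  have "(\<integral>x. indicat_real (super \<phi> t) x \<partial>\<mu>) \<le> (\<integral>x. test R s t x + indicat_real (exceed R) x \<partial>\<mu>)"
    using i st emeasure_super_finite[of t] emeasure_exceed_finite[OF R] by (intro integral_mono lo) auto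
  then show "measure \<mu> (super \<phi> t) \<le> (\<integral>x. test R s t x \<partial>\<mu>) + measure \<mu> (exceed R)"
    using i emeasure_exceed_finite[OF R] by simp
qed

text \<open>The same sandwich for the random vector, homogeneity moving a n across \<phi>. The price
  is now the probability that some coordinate exceeds R * a n.\<close>

lemma sample_upper: "(\<integral>\<omega>. ramp s t (\<phi> (\<lambda>i\<in>I. clamp_real R (X (int i) \<omega> / a n))) \<partial>M)
      \<le> measure M {\<omega> \<in> space M. \<phi> (\<lambda>i\<in>I. X (int i) \<omega>) > s * a n}
        + measure M {\<omega> \<in> space M. \<exists>i\<in>I. \<bar>X (int i) \<omega>\<bar> > R * a n}"
    and sample_lower: "measure M {\<omega> \<in> space M. \<phi> (\<lambda>i\<in>I. X (int i) \<omega>) > t * a n}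
      \<le> (\<integral>\<omega>. ramp s t (\<phi> (\<lambda>i\<in>I. clamp_real R (X (int i) \<omega> / a n))) \<partial>M)
        + measure M {\<omega> \<in> space M. \<exists>i\<in>I. \<bar>X (int i) \<omega>\<bar> > R * a n}"
proof -
  interpret prob_space M by (rule M)
  note One_nat_def [simp del]
  let ?r = "\<lambda>\<omega>. ramp s t (\<phi> (\<lambda>i\<in>I. clamp_real R (X (int i) \<omega> / a n)))"
  let ?A = "\<lambda>s. {\<omega> \<in> space M. \<phi> (\<lambda>i\<in>I. X (int i) \<omega>) > s * a n}"
  let ?B = "{\<omega> \<in> space M. \<exists>i\<in>I. \<bar>X (int i) \<omega>\<bar> > R * a n}"
  have [measurable]: "clamp_real R \<in> borel_measurable borel" unfolding clamp_real_def by measurable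
  have m[measurable]: "?r \<in> borel_measurable M" "?A s \<in> sets M" "?A t \<in> sets M" "?B \<in> sets M" by measurable
  have hm: "\<phi> (\<lambda>i\<in>I. X (int i) \<omega> / a n) = \<phi> (\<lambda>i\<in>I. X (int i) \<omega>) / a n" for \<omega>
    using hom[of "1 / a n" "\<lambda>i. X (int i) \<omega>"] a_pos[of n] by simp
  have eq: "\<phi> (\<lambda>i\<in>I. clamp_real R (X (int i) \<omega> / a n)) = \<phi> (\<lambda>i\<in>I. X (int i) \<omega>) / a n"
    if "\<omega> \<in> space M" "\<omega> \<notin> ?B" for \<omega>
  proof -
    have "(\<lambda>i\<in>I. clamp_real R (X (int i) \<omega> / a n)) = (\<lambda>i\<in>I. X (int i) \<omega> / a n)"
    proof (intro restrict_ext clamp_real_eq)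
      fix i assume "i \<in> I"
      then have "\<bar>X (int i) \<omega>\<bar> \<le> R * a n" using that by (auto simp: not_less)
      then show "\<bar>X (int i) \<omega> / a n\<bar> \<le> R" using a_pos[of n] by (simp add: field_simps)
    qed
    then show ?thesis by (simp only: hm)
  qed
  have i: "integrable M ?r"
    by (rule integrable_const_bound[of _ 1]) (use ramp_range m(1) in \<open>auto simp del: One_nat_def\<close>)
  have ind: "integrable M (indicat_real S)" if "S \<in> sets M" for S
    using that by (intro integrable_real_indicator) (auto simp: emeasure_eq_measure)
  have up: "?r \<omega> \<le> indicat_real (?A s) \<omega> + indicat_real ?B \<omega>" if "\<omega> \<in> space M" for \<omega>
  proof (cases "\<omega> \<in> ?B")
    case True
    then show ?thesis using ramp_range(2)[of s t] by (auto intro: add_increasing)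
  next
    case False
    show ?thesis unfolding eq[OF that False] using that False ramp_range(2)[of s t] a_pos[of n]
        ramp_eq_0[OF st(2), of "\<phi> (\<lambda>i\<in>I. X (int i) \<omega>) / a n"]
      by (auto simp: field_simps split: split_indicator)
  qed
  have lo: "indicat_real (?A t) \<omega> \<le> ?r \<omega> + indicat_real ?B \<omega>" if "\<omega> \<in> space M" for \<omega>
  proof (cases "\<omega> \<in> ?B")
    case True
    then show ?thesis using ramp_range(1)[of s t] by (auto intro!: add_increasing split: split_indicator)
  next
    case False
    show ?thesis unfolding eq[OF that False] using that False ramp_range(1)[of s t] a_pos[of n]
        ramp_eq_1[OF st(2), of "\<phi> (\<lambda>i\<in>I. X (int i) \<omega>) / a n"]
      by (auto simp: field_simps split: split_indicator)
  qed
  have "(\<integral>\<omega>. ?r \<omega> \<partial>M) \<le> (\<integral>\<omega>. indicat_real (?A s) \<omega> + indicat_real ?B \<omega> \<partial>M)"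
    using i by (intro integral_mono up Bochner_Integration.integrable_add ind m) auto
  then show "(\<integral>\<omega>. ?r \<omega> \<partial>M) \<le> measure M (?A s) + measure M ?B" using m by (simp add: ind)
  have "(\<integral>\<omega>. indicat_real (?A t) \<omega> \<partial>M) \<le> (\<integral>\<omega>. ?r \<omega> + indicat_real ?B \<omega> \<partial>M)"
    using i by (intro integral_mono lo Bochner_Integration.integrable_add ind m) auto
  then show "measure M (?A t) \<le> (\<integral>\<omega>. ?r \<omega> \<partial>M) + measure M ?B" using i m by (simp add: ind)
qed

end

end

text \<open>The error term of the sample sandwich is this very probability, so it must be bounded
  without that sandwich. The sum of absolute values makes this possible: clamping at R cannot hide
  an exceedance of R from a ramp that is already 1 at level R. Scaling makes the limit small for
  large R.\<close>

lemma (in vague_limit) exceed_small: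
  assumes "e > 0"
  obtains R where "R > 0" "measure \<mu> (exceed R) < e"
    "\<forall>\<^sub>F n in sequentially. real n * measure M {\<omega> \<in> space M. \<exists>i\<in>I. \<bar>X (int i) \<omega>\<bar> > R * a n} < e"
proof -
  interpret prob_space M by (rule M)
  let ?\<psi> = "\<lambda>y :: nat \<Rightarrow> real. \<Sum>i=1..d. \<bar>y i\<bar>"
  interpret A: vague_limit_functional M X a d \<mu> \<alpha> ?\<psi>
    by (intro vague_limit_functional.intro vague_limit_axioms homogeneous_functional_sum_abs)
  have "((\<lambda>R. (R / 2) powr (-\<alpha>) * measure \<mu> (super ?\<psi> 1) + R powr (-\<alpha>) * measure \<mu> (exceed 1))
      \<longlongrightarrow> 0 * measure \<mu> (super ?\<psi> 1) + 0 * measure \<mu> (exceed 1)) at_top"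
    using \<alpha>_pos
    by (intro tendsto_intros tendsto_neg_powr filterlim_ident
        filterlim_at_top_mult_tendsto_pos[where f = "\<lambda>_. 1/2" and c = "1/2" and g = "\<lambda>x. x", simplified]) auto
  then have "eventually (\<lambda>R. (R / 2) powr (-\<alpha>) * measure \<mu> (super ?\<psi> 1) + R powr (-\<alpha>) * measure \<mu> (exceed 1) < e) at_top"
    using assms by (intro order_tendstoD(2)) auto
  from eventually_conj[OF this eventually_gt_at_top[of 0]]
  obtain R where R: "R > 0" "(R / 2) powr (-\<alpha>) * measure \<mu> (super ?\<psi> 1) + R powr (-\<alpha>) * measure \<mu> (exceed 1) < e"
    by (auto dest!: eventually_happens)
  then have *: "measure \<mu> (super ?\<psi> (R / 2)) + measure \<mu> (exceed R) < e"
    using A.measure_super[of "R / 2"] measure_exceed[of R] by simp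
  show ?thesis
  proof (rule that[of R])
    show "measure \<mu> (exceed R) < e" using * by (smt (verit) measure_nonneg)
    have "(\<integral>x. A.test R (R / 2) R x \<partial>\<mu>) < e" using A.test_upper[of R "R/2" R] R * by simp
    then have "\<forall>\<^sub>F n in sequentially. real n * (\<integral>\<omega>. ramp (R / 2) R (?\<psi> (\<lambda>i\<in>I. clamp_real R (X (int i) \<omega> / a n))) \<partial>M) < e"
      using R by (intro order_tendstoD(2)[OF A.test_tendsto[of R "R / 2" R]]) auto
    then show "\<forall>\<^sub>F n in sequentially. real n * measure M {\<omega> \<in> space M. \<exists>i\<in>I. \<bar>X (int i) \<omega>\<bar> > R * a n} < e"
    proof (rule eventually_mono)
      fix n
      let ?r = "\<lambda>\<omega>. ramp (R / 2) R (?\<psi> (\<lambda>i\<in>I. clamp_real R (X (int i) \<omega> / a n)))"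
      let ?B = "{\<omega> \<in> space M. \<exists>i\<in>I. \<bar>X (int i) \<omega>\<bar> > R * a n}"
      have [measurable]: "clamp_real R \<in> borel_measurable borel" unfolding clamp_real_def by measurable
      have lo: "indicat_real ?B \<omega> \<le> ?r \<omega>" if "\<omega> \<in> space M" for \<omega>
      proof (cases "\<omega> \<in> ?B")
        case True
        then obtain i where i: "i \<in> I" "\<bar>X (int i) \<omega>\<bar> > R * a n" by auto
        \<comment> \<open>An exceeding coordinate is clamped to exactly R in absolute value, so the
          clamped sum reaches R and the ramp equals 1.\<close>
        have "R = \<bar>clamp_real R (X (int i) \<omega> / a n)\<bar>"
          using i(2) R a_pos[of n] by (auto simp: clamp_real_def abs_if max_def min_def field_simps split: if_splits)
        also have "\<dots> \<le> (\<Sum>i\<in>I. \<bar>clamp_real R (X (int i) \<omega> / a n)\<bar>)"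
          using i(1) by (intro member_le_sum) auto
        finally have "?r \<omega> = 1" using R by (intro ramp_eq_1) auto
        then show ?thesis by (simp split: split_indicator)
      qed (use ramp_range in auto)
      have mB: "?B \<in> sets M" by measurable
      have "integrable M ?r"
        by (rule integrable_const_bound[of _ 1]) (use ramp_range in auto)
      then have "(\<integral>\<omega>. indicat_real ?B \<omega> \<partial>M) \<le> (\<integral>\<omega>. ?r \<omega> \<partial>M)"
        by (intro integral_mono lo integrable_real_indicator mB) (auto simp: emeasure_eq_measure)
      then have "real n * measure M ?B \<le> real n * (\<integral>\<omega>. ?r \<omega> \<partial>M)"
        by (intro mult_left_mono) auto
      then show "real n * (\<integral>\<omega>. ?r \<omega> \<partial>M) < e \<Longrightarrow> real n * measure M ?B < e" by simp
    qed
  qed (use R in auto)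
qed

text \<open>Continuity of t powr (-\<alpha>) in t takes the place of a continuity-set condition: the
  ramp is placed between t and a nearby level s at which the limit value is still on the right side
  of y. The gap is then split into thirds between the two exceedance errors and the limit.\<close>

lemma (in vague_limit_functional) tail_tendsto:
  assumes "t > 0"
  shows "(\<lambda>n. real n * measure M {\<omega> \<in> space M. \<phi> (\<lambda>i\<in>I. X (int i) \<omega>) > t * a n})
     \<longlonglongrightarrow> t powr (-\<alpha>) * measure \<mu> (super \<phi> 1)"
proof (rule order_tendstoI)
  let ?H = "measure \<mu> (super \<phi> 1)"
  let ?P = "\<lambda>t n. real n * measure M {\<omega> \<in> space M. \<phi> (\<lambda>i\<in>I. X (int i) \<omega>) > t * a n}"
  let ?E = "\<lambda>R n. real n * measure M {\<omega> \<in> space M. \<exists>i\<in>I. \<bar>X (int i) \<omega>\<bar> > R * a n}"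
  have c: "isCont (\<lambda>s. s powr (-\<alpha>) * ?H) t" using assms by (intro continuous_intros) auto
  {
    fix y assume y: "t powr (-\<alpha>) * ?H < y"
    have "eventually (\<lambda>s. s powr (-\<alpha>) * ?H < y) (at_left t)"
      using c y by (intro order_tendstoD(2)[of _ "t powr (-\<alpha>) * ?H"]) (auto simp: isCont_def intro: filterlim_mono[OF _ order_refl at_le])
    from eventually_conj[OF this eventually_at_left_real[OF assms]]
    obtain s where s: "s powr (-\<alpha>) * ?H < y" "0 < s" "s < t"
      by (auto dest!: eventually_happens)
    define e where "e = (y - s powr (-\<alpha>) * ?H) / 3"
    have "e > 0" using s by (simp add: e_def)
    have e3: "3 * e = \<bar>y - s powr (-\<alpha>) * ?H\<bar>" using s by (simp add: e_def)
    from exceed_small[OF \<open>e > 0\<close>] obtain R where R: "R > 0" "measure \<mu> (exceed R) < e"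
      "\<forall>\<^sub>F n in sequentially. ?E R n < e" by blast
    have "(\<integral>x. test R s t x \<partial>\<mu>) < s powr (-\<alpha>) * ?H + e"
      using test_upper[OF R(1) s(2,3)] R(2) measure_super[OF s(2)] by simp
    from order_tendstoD(2)[OF test_tendsto[OF R(1) s(2,3)] this] R(3)
    show "\<forall>\<^sub>F n in sequentially. ?P t n < y"
    proof eventually_elim
      case (elim n)
      from sample_lower[OF R(1) s(2,3), of n]
      have "?P t n \<le> real n * (\<integral>\<omega>. ramp s t (\<phi> (\<lambda>i\<in>I. clamp_real R (X (int i) \<omega> / a n))) \<partial>M) + ?E R n"
        by (subst distrib_left[symmetric], intro mult_left_mono) auto
      then show ?case using elim e3 s by linarith
    qed
  next
    fix y assume y: "y < t powr (-\<alpha>) * ?H"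
    have "eventually (\<lambda>s. y < s powr (-\<alpha>) * ?H) (at_right t)"
      using c y by (intro order_tendstoD(1)[of _ "t powr (-\<alpha>) * ?H"]) (auto simp: isCont_def intro: filterlim_mono[OF _ order_refl at_le])
    from eventually_conj[OF this eventually_at_right_real[of t "t + 1"]]
    obtain s where s: "y < s powr (-\<alpha>) * ?H" "t < s"
      by (auto dest!: eventually_happens)
    define e where "e = (s powr (-\<alpha>) * ?H - y) / 3"
    have "e > 0" using s by (simp add: e_def)
    have e3: "3 * e = \<bar>y - s powr (-\<alpha>) * ?H\<bar>" using s by (simp add: e_def)
    from exceed_small[OF \<open>e > 0\<close>] obtain R where R: "R > 0" "measure \<mu> (exceed R) < e"
      "\<forall>\<^sub>F n in sequentially. ?E R n < e" by blast
    have "(\<integral>x. test R t s x \<partial>\<mu>) > s powr (-\<alpha>) * ?H - e"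
      using test_lower[OF R(1) assms s(2)] R(2) measure_super[of s] assms s by simp
    from order_tendstoD(1)[OF test_tendsto[OF R(1) assms s(2)] this] R(3)
    show "\<forall>\<^sub>F n in sequentially. y < ?P t n"
    proof eventually_elim
      case (elim n)
      from sample_upper[OF R(1) assms s(2), of n]
      have "real n * (\<integral>\<omega>. ramp t s (\<phi> (\<lambda>i\<in>I. clamp_real R (X (int i) \<omega> / a n))) \<partial>M) \<le> ?P t n + ?E R n"
        by (subst distrib_left[symmetric], intro mult_left_mono) auto
      then show ?case using elim e3 s by linarith
    qed
  }
qed

section \<open>From the normalising sequence to arbitrary levels\<close>

lemma isCont_powr_pos: "0 < t \<Longrightarrow> isCont (\<lambda>s. s powr r * (c::real)) t"
  by (intro continuous_intros) auto

context
  fixes F :: "real \<Rightarrow> real" and a :: "nat \<Rightarrow> real" and \<alpha> :: real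
  assumes F_anti: "\<And>x y. x \<le> y \<Longrightarrow> F y \<le> F x" and F_nonneg: "\<And>x. F x \<ge> 0"
    and a_pos: "\<And>n. a n > 0" and \<alpha>_pos: "\<alpha> > 0"
    and lim: "\<And>t. t > 0 \<Longrightarrow> (\<lambda>n. real n * F (t * a n)) \<longlonglongrightarrow> t powr (-\<alpha>)"
begin

lemma tail_at_quantiles_tendsto_0: "t > 0 \<Longrightarrow> (\<lambda>n. F (t * a n)) \<longlonglongrightarrow> 0"
proof -
  assume "t > 0"
  have "(\<lambda>n. (real n * F (t * a n)) * inverse (real n)) \<longlonglongrightarrow> t powr (-\<alpha>) * 0"
    by (intro tendsto_intros lim \<open>t > 0\<close> tendsto_inverse_0_at_top filterlim_real_sequentially)
  then have "(\<lambda>n. (real n * F (t * a n)) * inverse (real n)) \<longlonglongrightarrow> 0" by simp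
  then show ?thesis
    by (rule Lim_transform_eventually) (auto intro!: eventually_mono[OF eventually_gt_at_top[of 0]])
qed

text \<open>If F vanished at x, positivity of F (t * a n) for large n would force a n below every u
  > 0, hence F u = 0 for all u > 0, contradicting F (a n) > 0.\<close>

lemma tail_pos: "F x > 0"
proof (rule ccontr)
  assume "\<not> F x > 0"
  then have Fx: "F x = 0" using F_nonneg[of x] by linarith
  have ev: "\<forall>\<^sub>F n in sequentially. F (t * a n) > 0" if "t > 0" for t
  proof -
    have "\<forall>\<^sub>F n in sequentially. real n * F (t * a n) > 0"
      using that by (intro order_tendstoD(1)[OF lim]) auto
    then show ?thesis by eventually_elim (use F_nonneg in \<open>auto simp: zero_less_mult_iff\<close>)
  qed
  have "F u \<le> 0" if "u > 0" for u
  proof (rule tendsto_lowerbound[OF tail_at_quantiles_tendsto_0[of 1]])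
    have x: "x > 0"
    proof -
      obtain n where "F (1 * a n) > 0" using eventually_happens[OF ev[of 1]] by auto
      then have "\<not> x \<le> a n" using F_anti[of x "a n"] Fx by auto
      then show ?thesis using a_pos[of n] by linarith
    qed
    show "\<forall>\<^sub>F n in sequentially. F u \<le> F (1 * a n)"
      using ev[OF divide_pos_pos[OF x \<open>u > 0\<close>]]
    proof eventually_elim
      case (elim n)
      then have "\<not> x \<le> x / u * a n" using F_anti[of x "x / u * a n"] Fx x \<open>u > 0\<close> by auto
      then have "a n \<le> u" using x \<open>u > 0\<close> by (auto simp: field_simps)
      then show ?case using F_anti by simp
    qed
  qed auto
  moreover obtain n where "F (1 * a n) > 0" using eventually_happens[OF ev[of 1]] by auto
  ultimately show False using a_pos[of n] by fastforce
qed

lemma tail_tendsto_0: "(F \<longlongrightarrow> 0) at_top"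
proof (rule order_tendstoI)
  fix y :: real assume "0 < y"
  from order_tendstoD(2)[OF tail_at_quantiles_tendsto_0[of 1] this] obtain n where "F (a n) < y"
    by (auto dest!: eventually_happens)
  then have "F x < y" if "a n \<le> x" for x using F_anti[OF that] by linarith
  then show "\<forall>\<^sub>F x in at_top. F x < y" by (auto simp: eventually_at_top_linorder)
qed (auto intro!: always_eventually less_trans[OF _ tail_pos])

text \<open>Inverts the normalisation n F (a n) -> 1: the index n for which n F x is close to 1, so
  that x is comparable to a n.\<close>

definition quantile_index :: "real \<Rightarrow> nat" where
  "quantile_index x = nat \<lfloor>1 / F x\<rfloor>"

lemma quantile_index_at_top: "filterlim quantile_index sequentially at_top"
proof -
  have "filterlim (\<lambda>x. 1 / F x) at_top at_top"
    using tail_tendsto_0 tail_pos unfolding inverse_eq_divide[symmetric]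
    by (intro filterlim_inverse_at_top) auto
  then show ?thesis unfolding quantile_index_def
    by (intro filterlim_compose[OF filterlim_nat_sequentially] filterlim_compose[OF filterlim_floor_sequentially])
qed

lemma quantile_index_mult_tail: "((\<lambda>x. real (quantile_index x) * F x) \<longlongrightarrow> 1) at_top"
proof (rule tendsto_sandwich)
  show "\<forall>\<^sub>F x in at_top. 1 - F x \<le> real (quantile_index x) * F x"
  proof (intro always_eventually allI)
    fix x
    have "1 / F x - 1 \<le> real (quantile_index x)" unfolding quantile_index_def by linarith
    then have "(1 / F x - 1) * F x \<le> real (quantile_index x) * F x"
      using tail_pos[of x] by (intro mult_right_mono) auto
    then show "1 - F x \<le> real (quantile_index x) * F x" using tail_pos[of x] by (simp add: left_diff_distrib)
  qed
  show "\<forall>\<^sub>F x in at_top. real (quantile_index x) * F x \<le> 1"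
  proof (intro always_eventually allI)
    fix x
    have "0 \<le> 1 / F x" using tail_pos[of x] by simp
    then have "real (quantile_index x) \<le> 1 / F x" unfolding quantile_index_def by linarith
    then show "real (quantile_index x) * F x \<le> 1" using tail_pos[of x] by (simp add: field_simps)
  qed
  show "((\<lambda>x. 1 - F x) \<longlongrightarrow> 1) at_top"
    using tendsto_diff[OF tendsto_const tail_tendsto_0, of 1] by simp
qed auto

text \<open>Along n = \<open>quantile_index x\<close>, n F (t * a n) and n F (s * a n) tend to
  limits on opposite sides of 1, the limit of n F x. Strict inequalities between values of the
  monotone F order the arguments.\<close>

lemma quantile_bounds:
  assumes "0 < s" "s < 1" "1 < t"
  shows "\<forall>\<^sub>F x in at_top. s * a (quantile_index x) < x \<and> x < t * a (quantile_index x)"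
proof -
  have L: "((\<lambda>x. real (quantile_index x) * F (r * a (quantile_index x))) \<longlongrightarrow> r powr (-\<alpha>)) at_top" if "r > 0" for r
    using filterlim_compose[OF lim[OF that] quantile_index_at_top] .
  have "t powr (-\<alpha>) < 1" "1 < s powr (-\<alpha>)"
    using assms \<alpha>_pos powr_less_mono2_neg[of "-\<alpha>" 1 t] powr_less_mono2_neg[of "-\<alpha>" s 1] by auto
  then obtain u v where uv: "t powr (-\<alpha>) < u" "u < 1" "1 < v" "v < s powr (-\<alpha>)"
    using dense[of "t powr (-\<alpha>)" 1] dense[of 1 "s powr (-\<alpha>)"] by blast
  have ev: "\<forall>\<^sub>F x in at_top. real (quantile_index x) * F (t * a (quantile_index x)) < u"
       "\<forall>\<^sub>F x in at_top. v < real (quantile_index x) * F (s * a (quantile_index x))"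
       "\<forall>\<^sub>F x in at_top. u < real (quantile_index x) * F x"
       "\<forall>\<^sub>F x in at_top. real (quantile_index x) * F x < v"
    using order_tendstoD(2)[OF L uv(1)] order_tendstoD(1)[OF L uv(4)] assms
      order_tendstoD[OF quantile_index_mult_tail] uv by auto
  then show ?thesis
  proof eventually_elim
    case (elim x)
    let ?n = "quantile_index x"
    have n: "?n > 0"
      using elim(2) uv(3) by (cases "?n = 0") auto
    have "real ?n * F (t * a ?n) < real ?n * F x" "real ?n * F x < real ?n * F (s * a ?n)"
      using elim by linarith+
    then have "F (t * a ?n) < F x" "F x < F (s * a ?n)" using n by auto
    then show ?case using F_anti[of "t * a ?n" x] F_anti[of x "s * a ?n"] by force
  qed
qed

text \<open>Both numerator and denominator are multiplied by n = \<open>quantile_index x\<close>; x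
  is squeezed between multiples of a n close to 1, and monotonicity of G trades s * x for r * a n
  with r near s. It is used with G = F and with G the tail of a partial sum.\<close>

lemma tail_ratio_tendsto:
  assumes G_anti: "\<And>x y. x \<le> y \<Longrightarrow> G y \<le> G x" and "s > 0"
    and G: "\<And>t. t > 0 \<Longrightarrow> (\<lambda>n. real n * G (t * a n)) \<longlonglongrightarrow> t powr (-\<alpha>) * c"
  shows "((\<lambda>x. G (s * x) / F x) \<longlongrightarrow> s powr (-\<alpha>) * (c::real)) at_top"
proof -
  let ?n = quantile_index
  have L: "((\<lambda>x. (real (?n x) * G (r * a (?n x))) / (real (?n x) * F x)) \<longlongrightarrow> r powr (-\<alpha>) * c / 1) at_top" if "r > 0" for r
    by (intro tendsto_divide quantile_index_mult_tail filterlim_compose[OF G[OF that] quantile_index_at_top]) auto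
  have nz: "\<forall>\<^sub>F x in at_top. ?n x > 0"
    by (rule eventually_compose_filterlim[OF eventually_gt_at_top quantile_index_at_top])
  show ?thesis
  proof (rule order_tendstoI)
    fix y assume "s powr (-\<alpha>) * c < y"
    then have "eventually (\<lambda>r. r powr (-\<alpha>) * c < y) (at_left s)"
      using isCont_powr_pos[OF \<open>s > 0\<close>]
      by (intro order_tendstoD(2)[of _ "s powr (-\<alpha>) * c"]) (auto simp: isCont_def intro: filterlim_mono[OF _ order_refl at_le])
    from eventually_conj[OF this eventually_at_left_real[OF \<open>s > 0\<close>]]
    obtain r where r: "r powr (-\<alpha>) * c < y" "0 < r" "r < s"
      by (auto dest!: eventually_happens)
    have "\<forall>\<^sub>F x in at_top. (real (?n x) * G (r * a (?n x))) / (real (?n x) * F x) < y"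
      using r by (intro order_tendstoD(2)[OF L[OF r(2)]]) simp
    moreover have "\<forall>\<^sub>F x in at_top. (r / s) * a (?n x) < x \<and> x < 2 * a (?n x)"
      using r by (intro quantile_bounds) auto
    ultimately show "\<forall>\<^sub>F x in at_top. G (s * x) / F x < y"
      using nz
    proof eventually_elim
      case (elim x)
      have "r * a (?n x) \<le> s * x" using elim(2) \<open>s > 0\<close> by (simp add: field_simps)
      then have "G (s * x) / F x \<le> G (r * a (?n x)) / F x"
        using G_anti tail_pos[of x] by (intro divide_right_mono) auto
      also have "\<dots> < y" using elim(1,3) by simp
      finally show ?case .
    qed
  next
    fix y assume "y < s powr (-\<alpha>) * c"
    then have "eventually (\<lambda>r. y < r powr (-\<alpha>) * c) (at_right s)"
      using isCont_powr_pos[OF \<open>s > 0\<close>]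
      by (intro order_tendstoD(1)[of _ "s powr (-\<alpha>) * c"]) (auto simp: isCont_def intro: filterlim_mono[OF _ order_refl at_le])
    from eventually_conj[OF this eventually_at_right_real[of s "s + 1"]]
    obtain r where r: "y < r powr (-\<alpha>) * c" "s < r"
      by (auto dest!: eventually_happens)
    have "r > 0" using r \<open>s > 0\<close> by simp
    have "\<forall>\<^sub>F x in at_top. y < (real (?n x) * G (r * a (?n x))) / (real (?n x) * F x)"
      using r by (intro order_tendstoD(1)[OF L[OF \<open>r > 0\<close>]]) simp
    moreover have "\<forall>\<^sub>F x in at_top. (1 / 2) * a (?n x) < x \<and> x < (r / s) * a (?n x)"
      using r \<open>s > 0\<close> by (intro quantile_bounds) auto
    ultimately show "\<forall>\<^sub>F x in at_top. y < G (s * x) / F x"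
      using nz
    proof eventually_elim
      case (elim x)
      have "s * x \<le> r * a (?n x)" using elim(2) \<open>s > 0\<close> by (simp add: field_simps)
      then have "G (r * a (?n x)) / F x \<le> G (s * x) / F x"
        using G_anti tail_pos[of x] by (intro divide_right_mono) auto
      moreover have "y < G (r * a (?n x)) / F x" using elim(1,3) by simp
      ultimately show ?case by linarith
    qed
  qed
qed

end

section \<open>Stationarity and the tails of partial sums\<close>

lemma measurable_shift_process:
  assumes "\<And>t. \<Phi> t \<in> M \<rightarrow>\<^sub>M E"
  shows "(\<lambda>\<omega> t. \<Phi> (t + s :: int) \<omega>) \<in> M \<rightarrow>\<^sub>M PiM UNIV (\<lambda>_. E)"
  by (rule measurable_PiM_single') (use assms in \<open>auto intro: measurable_space\<close>)

lemma stationary_prob: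
  assumes st: "stationary M E \<Phi>" and [measurable]: "\<And>t. \<Phi> t \<in> M \<rightarrow>\<^sub>M E"
    and P: "{f \<in> space (PiM UNIV (\<lambda>_. E)). P f} \<in> sets (PiM UNIV (\<lambda>_. E))"
  shows "measure M {\<omega> \<in> space M. P (\<lambda>t. \<Phi> (t + s) \<omega>)} = measure M {\<omega> \<in> space M. P (\<lambda>t. \<Phi> t \<omega>)}"
proof -
  let ?P = "PiM UNIV (\<lambda>_::int. E)"
  have m: "(\<lambda>\<omega> t. \<Phi> (t + s) \<omega>) \<in> M \<rightarrow>\<^sub>M ?P" "(\<lambda>\<omega> t. \<Phi> t \<omega>) \<in> M \<rightarrow>\<^sub>M ?P"
    using measurable_shift_process[OF assms(2), where s = s] measurable_shift_process[OF assms(2), where s = 0] by simp_all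
  have "measure (distr M ?P (\<lambda>\<omega> t. \<Phi> (t + s) \<omega>)) {f \<in> space ?P. P f} = measure (distr M ?P (\<lambda>\<omega> t. \<Phi> t \<omega>)) {f \<in> space ?P. P f}"
    using st by (simp add: stationary_def)
  moreover have "(\<lambda>\<omega> t. \<Phi> (t + s) \<omega>) -` {f \<in> space ?P. P f} \<inter> space M = {\<omega> \<in> space M. P (\<lambda>t. \<Phi> (t + s) \<omega>)}"
     "(\<lambda>\<omega> t. \<Phi> t \<omega>) -` {f \<in> space ?P. P f} \<inter> space M = {\<omega> \<in> space M. P (\<lambda>t. \<Phi> t \<omega>)}"
    using measurable_space[OF m(1)] measurable_space[OF m(2)] by auto
  ultimately show ?thesis by (simp add: measure_distr[OF m(1) P] measure_distr[OF m(2) P])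
qed

lemma stationary_image:
  assumes st: "stationary M E \<Phi>" and [measurable]: "\<And>t. \<Phi> t \<in> M \<rightarrow>\<^sub>M E" "h \<in> E \<rightarrow>\<^sub>M N"
  shows "stationary M N (\<lambda>t \<omega>. h (\<Phi> t \<omega>))"
  unfolding stationary_def
proof
  fix s :: int
  let ?P = "PiM UNIV (\<lambda>_::int. E)" and ?Q = "PiM UNIV (\<lambda>_::int. N)"
  have m: "(\<lambda>\<omega> t. \<Phi> (t + s) \<omega>) \<in> M \<rightarrow>\<^sub>M ?P" "(\<lambda>\<omega> t. \<Phi> t \<omega>) \<in> M \<rightarrow>\<^sub>M ?P" for s
    using measurable_shift_process[OF assms(2), where s = s] measurable_shift_process[OF assms(2), where s = 0] by simp_all
  have c: "(\<lambda>f t. h (f t)) \<in> ?P \<rightarrow>\<^sub>M ?Q"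
    by (rule measurable_PiM_single') (auto simp: space_PiM PiE_def intro!: measurable_space[OF assms(3)])
  have "distr M ?Q (\<lambda>\<omega> t. h (\<Phi> (t + s) \<omega>)) = distr (distr M ?P (\<lambda>\<omega> t. \<Phi> (t + s) \<omega>)) ?Q (\<lambda>f t. h (f t))"
    by (subst distr_distr[OF c m(1)]) (simp add: o_def)
  also have "\<dots> = distr (distr M ?P (\<lambda>\<omega> t. \<Phi> t \<omega>)) ?Q (\<lambda>f t. h (f t))"
    using st by (simp add: stationary_def)
  also have "\<dots> = distr M ?Q (\<lambda>\<omega> t. h (\<Phi> t \<omega>))"
    by (subst distr_distr[OF c m(2)]) (simp add: o_def)
  finally show "distr M ?Q (\<lambda>\<omega> t. h (\<Phi> (t + s) \<omega>)) = distr M ?Q (\<lambda>\<omega> t. h (\<Phi> t \<omega>))" .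
qed

text \<open>The inversion above is applied to sum |y i| in dimension one and to sum y i in dimension
  k. The case s = 1 shows that the limit behind \<open>b_plus\<close> exists, so \<open>Lim\<close>
  returns it; general s is needed because truncation shifts levels.\<close>

theorem regularly_varying_tails:
  assumes M: "prob_space M" and X[measurable]: "\<And>t. X t \<in> borel_measurable M"
    and st: "stationary M borel X" and "\<alpha> > 0" and rv: "regularly_varying M X \<alpha>"
  shows "rv_tail (abs_tail M X) \<alpha>"
    and "\<And>k s. k \<ge> 1 \<Longrightarrow> s > 0 \<Longrightarrow>
      ((\<lambda>x. \<P>(\<omega> in M. partial_sum X k \<omega> > s * x) / abs_tail M X x) \<longlongrightarrow> s powr (-\<alpha>) * b_plus M X k) at_top"
proof -
  interpret prob_space M by fact
  from rv obtain a where a: "\<And>n. a n > 0" "(\<lambda>n. real n * abs_tail M X (a n)) \<longlonglongrightarrow> 1"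
    and v': "\<forall>d\<ge>1. \<exists>\<mu>. radon_punctured d \<mu> \<and> emeasure \<mu> (space \<mu>) \<noteq> 0 \<and>
           vague_conv d (scaled_law M X a d) \<mu> \<and>
           (\<forall>t>0. \<forall>B\<in>sets \<mu>.
              emeasure \<mu> ((\<lambda>x. \<lambda>i\<in>{1..d}. ereal t * x i) ` B) =
              ennreal (t powr (-\<alpha>)) * emeasure \<mu> B)"
    unfolding regularly_varying_def by blast
  have v: "\<exists>\<mu>. vague_limit M X a d \<mu> \<alpha>" if "d \<ge> 1" for d
  proof -
    from v'[rule_format, OF that] obtain \<mu> where
      "radon_punctured d \<mu>" "vague_conv d (scaled_law M X a d) \<mu>"
      "\<forall>t>0. \<forall>B\<in>sets \<mu>. emeasure \<mu> ((\<lambda>x. \<lambda>i\<in>{1..d}. ereal t * x i) ` B) = ennreal (t powr (-\<alpha>)) * emeasure \<mu> B"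
      by blast
    then show ?thesis using M X a(1) \<open>\<alpha> > 0\<close> that by (intro exI[of _ \<mu>] vague_limit.intro) blast+
  qed
  have anti: "abs_tail M X y \<le> abs_tail M X x" if "x \<le> y" for x y
    unfolding abs_tail_def using that by (intro finite_measure_mono) auto
  \<comment> \<open>\<open>abs_tail\<close> reads time 0, while the vectors of regular variation
    start at time 1.\<close>
  have X1: "measure M {\<omega> \<in> space M. \<bar>X 1 \<omega>\<bar> > x} = abs_tail M X x" for x
    using stationary_prob[OF st X, of "\<lambda>f. \<bar>f 0\<bar> > x" 1] by (simp add: abs_tail_def)
  have lim: "(\<lambda>n. real n * abs_tail M X (t * a n)) \<longlonglongrightarrow> t powr (-\<alpha>)" if "t > 0" for t
  proof -
    obtain \<mu> where "vague_limit M X a 1 \<mu> \<alpha>" using v[of 1] by auto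
    then interpret V: vague_limit_functional M X a 1 \<mu> \<alpha> "\<lambda>y. \<Sum>i=1..1. \<bar>y i\<bar>"
      by (intro vague_limit_functional.intro homogeneous_functional_sum_abs)
    have *: "(\<lambda>n. real n * abs_tail M X (t * a n))
      \<longlonglongrightarrow> t powr (-\<alpha>) * measure \<mu> (V.super (\<lambda>y. \<Sum>i=1..1. \<bar>y i\<bar>) 1)" if "t > 0" for t
      using V.tail_tendsto[OF that] by (simp add: X1)
    \<comment> \<open>The normalisation of a pins the mass of {|x| > 1} in dimension one to
      1.\<close>
    have "measure \<mu> (V.super (\<lambda>y. \<Sum>i=1..1. \<bar>y i\<bar>) 1) = 1"
      using LIMSEQ_unique[OF *[of 1]] a(2) by simp
    with *[OF that] show ?thesis by simp
  qed
  have "abs_tail M X x \<ge> 0" for x by (simp add: abs_tail_def)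
  note ctx = anti this a(1) \<open>\<alpha> > 0\<close> lim
  have ratio: "((\<lambda>x. G (s * x) / abs_tail M X x) \<longlongrightarrow> s powr (-\<alpha>) * c) at_top"
    if "\<And>x y. x \<le> y \<Longrightarrow> G y \<le> G x" "s > 0"
     "\<And>t. t > 0 \<Longrightarrow> (\<lambda>n. real n * G (t * a n)) \<longlonglongrightarrow> t powr (-\<alpha>) * c" for G s c
    by (rule tail_ratio_tendsto[OF ctx that])
  show "rv_tail (abs_tail M X) \<alpha>"
  proof
    show "abs_tail M X x > 0" for x by (rule tail_pos[OF ctx])
    show "abs_tail M X x \<le> 1" for x by (simp add: abs_tail_def)
    show "t > 0 \<Longrightarrow> ((\<lambda>x. abs_tail M X (t * x) / abs_tail M X x) \<longlongrightarrow> t powr (-\<alpha>)) at_top" for t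
      using ratio[of "abs_tail M X" t 1] anti lim by simp
  qed (use anti \<open>\<alpha> > 0\<close> in auto)
  fix k s assume "k \<ge> (1::nat)" "s > (0::real)"
  obtain \<mu> where "vague_limit M X a k \<mu> \<alpha>" using v[OF \<open>k \<ge> 1\<close>] by auto
  then interpret V: vague_limit_functional M X a k \<mu> \<alpha> "\<lambda>y. \<Sum>i=1..k. y i"
    by (intro vague_limit_functional.intro homogeneous_functional_sum)
  define c where "c = measure \<mu> (V.super (\<lambda>y. \<Sum>i=1..k. y i) 1)"
  have lim: "((\<lambda>x. \<P>(\<omega> in M. partial_sum X k \<omega> > s * x) / abs_tail M X x) \<longlongrightarrow> s powr (-\<alpha>) * c) at_top"
    if "s > 0" for s
  proof (rule ratio[OF _ that])
    show "x \<le> y \<Longrightarrow> \<P>(\<omega> in M. partial_sum X k \<omega> > y) \<le> \<P>(\<omega> in M. partial_sum X k \<omega> > x)" for x y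
      by (intro finite_measure_mono) (auto simp: partial_sum_def)
    show "t > 0 \<Longrightarrow> (\<lambda>n. real n * \<P>(\<omega> in M. partial_sum X k \<omega> > t * a n)) \<longlonglongrightarrow> t powr (-\<alpha>) * c" for t
      using V.tail_tendsto[of t] by (simp add: c_def partial_sum_def)
  qed
  have "b_plus M X k = c"
    unfolding b_plus_def using lim[of 1] by (intro tendsto_Lim) auto
  with lim[OF \<open>s > 0\<close>]
  show "((\<lambda>x. \<P>(\<omega> in M. partial_sum X k \<omega> > s * x) / abs_tail M X x) \<longlongrightarrow> s powr (-\<alpha>) * b_plus M X k) at_top"
    by simp
qed

section \<open>Reduction to truncated sums\<close>

definition large_part :: "real \<Rightarrow> real \<Rightarrow> real" where
  "large_part u x = (if \<bar>x\<bar> > u then x else 0)"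

definition small_part :: "real \<Rightarrow> real \<Rightarrow> real" where
  "small_part u x = (if \<bar>x\<bar> \<le> u then x else 0)"

lemma measurable_large_part [measurable]: "large_part u \<in> borel_measurable borel"
  unfolding large_part_def by measurable

lemma measurable_small_part [measurable]: "small_part u \<in> borel_measurable borel"
  unfolding small_part_def by measurable

lemma large_plus_small: "large_part u x + small_part u x = x"
  by (simp add: large_part_def small_part_def)

lemma abs_small_part_le: "u \<ge> 0 \<Longrightarrow> \<bar>small_part u x\<bar> \<le> u"
  by (simp add: small_part_def)

locale stationary_sequence = prob_space M for M :: "'w measure" and X :: "int \<Rightarrow> 'w \<Rightarrow> real" +
  assumes X_meas [measurable]: "\<And>t. X t \<in> borel_measurable M"
    and stat: "stationary M borel X"
begin

lemma shift_prob:
  assumes "{f \<in> space (PiM UNIV (\<lambda>_. borel)). P f} \<in> sets (PiM UNIV (\<lambda>_. borel))"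
  shows "\<P>(\<omega> in M. P (\<lambda>t. X (t + s) \<omega>)) = \<P>(\<omega> in M. P (\<lambda>t. X t \<omega>))"
  by (rule stationary_prob[OF stat X_meas assms])

lemma abs_tail_shift: "\<P>(\<omega> in M. \<bar>X t \<omega>\<bar> > x) = abs_tail M X x"
  using shift_prob[of "\<lambda>f. \<bar>f 0\<bar> > x" t] by (simp add: abs_tail_def)

text \<open>T moves in step j + 1 only if |X_(j+1)| > u, so every increment D j is at most F u in
  absolute value. For j >= k it is compared with the increment over the window of the last k + 1
  terms, which is D k by stationarity; the two can differ only if two exceedances occur more than k
  apart. The first k increments give the boundary term.\<close>

lemma telescoping_bound:
  fixes u y :: real and n k :: nat
  defines "T \<equiv> \<lambda>m \<omega>. \<Sum>i=1..m. large_part u (X (int i) \<omega>)"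
  assumes "y \<ge> 0" "k \<le> n"
  shows "\<bar>\<P>(\<omega> in M. T n \<omega> > y) - real n * (\<P>(\<omega> in M. T (Suc k) \<omega> > y) - \<P>(\<omega> in M. T k \<omega> > y))\<bar>
    \<le> 2 * real k * abs_tail M X u
      + 2 * real n * (\<Sum>l=k..n. \<P>(\<omega> in M. \<bar>X (int l) \<omega>\<bar> > u \<and> \<bar>X 0 \<omega>\<bar> > u))"
proof -
  let ?F = "abs_tail M X u"
  let ?q = "\<lambda>l. \<P>(\<omega> in M. \<bar>X (int l) \<omega>\<bar> > u \<and> \<bar>X 0 \<omega>\<bar> > u)"
  let ?S = "\<Sum>l=k..n. ?q l"
  define p where "p m = \<P>(\<omega> in M. T m \<omega> > y)" for m
  define D where "D j = p (Suc j) - p j" for j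
  have [measurable]: "T m \<in> borel_measurable M" for m unfolding T_def by measurable
  have Tsuc: "T (Suc j) \<omega> = T j \<omega> + large_part u (X (int (Suc j)) \<omega>)" for j \<omega> by (simp add: T_def)
  have int_ind: "integrable M (indicat_real A)" if "A \<in> sets M" for A
    using that by (intro integrable_real_indicator) (auto simp: emeasure_eq_measure)
  have p0: "p 0 = 0" using \<open>y \<ge> 0\<close> by (simp add: p_def T_def)
  have D_le: "\<bar>D j\<bar> \<le> ?F" for j
  proof -
    let ?A = "\<lambda>m. {\<omega> \<in> space M. T m \<omega> > y}" and ?B = "{\<omega> \<in> space M. \<bar>X (int (Suc j)) \<omega>\<bar> > u}"
    have "\<bar>D j\<bar> = \<bar>\<integral>\<omega>. indicat_real (?A (Suc j)) \<omega> - indicat_real (?A j) \<omega> \<partial>M\<bar>"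
      by (subst Bochner_Integration.integral_diff) (auto simp: int_ind D_def p_def)
    also have "\<dots> \<le> (\<integral>\<omega>. \<bar>indicat_real (?A (Suc j)) \<omega> - indicat_real (?A j) \<omega>\<bar> \<partial>M)"
      by (rule integral_abs_bound)
    also have "\<dots> \<le> (\<integral>\<omega>. indicat_real ?B \<omega> \<partial>M)"
      by (intro integral_mono integrable_abs Bochner_Integration.integrable_diff int_ind)
         (auto simp: Tsuc large_part_def simp del: sum.cl_ivl_Suc split: split_indicator)
    also have "\<dots> = ?F" using abs_tail_shift[of u "int (Suc j)"] by simp
    finally show ?thesis .
  qed
  have D_diff: "\<bar>D j - D k\<bar> \<le> 2 * ?S" if "k \<le> j" "j < n" for j
  proof -
    \<comment> \<open>Dropping the first s terms leaves the window of times s + 1, ..., j + 1, which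
      has k + 1 elements.\<close>
    define s where "s = j - k"
    have j: "j = k + s" using that by (simp add: s_def)
    let ?T' = "\<lambda>m \<omega>. \<Sum>i=1..m. large_part u (X (int i + int s) \<omega>)"
    have sh: "\<P>(\<omega> in M. ?T' m \<omega> > y) = p m" for m
      unfolding p_def T_def
      by (rule shift_prob[where P = "\<lambda>f. (\<Sum>i=1..m. large_part u (f (int i))) > y" and s = "int s"]) measurable
    have split: "T (m + s) \<omega> = T s \<omega> + ?T' m \<omega>" for m \<omega>
    proof (induction m)
      case (Suc m)
      then show ?case by (simp add: T_def ac_simps)
    qed simp
    let ?A = "\<lambda>m. {\<omega> \<in> space M. T m \<omega> > y}" and ?A' = "\<lambda>m. {\<omega> \<in> space M. ?T' m \<omega> > y}"
    \<comment> \<open>If |X_(j+1)| <= u, neither sum moves. If it exceeds u but no term of index at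
      most s does, T s = 0 and the two sums coincide. Only \<open>?B\<close> remains, where two
      increments in {-1, 0, 1} differ by at most 2.\<close>
    let ?B = "{\<omega> \<in> space M. \<exists>i\<in>{1..s}. \<bar>X (int (Suc j)) \<omega>\<bar> > u \<and> \<bar>X (int i) \<omega>\<bar> > u}"
    let ?g = "\<lambda>\<omega>. (indicat_real (?A (Suc j)) \<omega> - indicat_real (?A j) \<omega>)
       - (indicat_real (?A' (Suc k)) \<omega> - indicat_real (?A' k) \<omega>)"
    have sets: "?A m \<in> sets M" "?A' m \<in> sets M" "?B \<in> sets M" for m by measurable
    have ig: "integrable M ?g"
      by (intro Bochner_Integration.integrable_diff int_ind sets)
    have iB: "integrable M (\<lambda>\<omega>. 2 * indicat_real ?B \<omega>)"
      by (intro integrable_mult_right int_ind sets)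
    have "\<bar>D j - D k\<bar> = \<bar>\<integral>\<omega>. ?g \<omega> \<partial>M\<bar>"
      using sh[of "Suc k"] sh[of k] by (simp add: int_ind D_def p_def)
    also have "\<dots> \<le> (\<integral>\<omega>. \<bar>?g \<omega>\<bar> \<partial>M)" by (rule integral_abs_bound)
    also have "\<dots> \<le> (\<integral>\<omega>. 2 * indicat_real ?B \<omega> \<partial>M)"
    proof (rule integral_mono[OF integrable_abs[OF ig] iB])
      fix \<omega> assume \<omega>: "\<omega> \<in> space M"
      have ind: "indicat_real {\<omega> \<in> space M. f \<omega> > y} \<omega> = (if f \<omega> > y then 1 else 0)" for f :: "'w \<Rightarrow> real"
        using \<omega> by (simp only: indicator_def mem_Collect_eq of_bool_def simp_thms)
      show "\<bar>?g \<omega>\<bar> \<le> 2 * indicat_real ?B \<omega>"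
      proof (cases "\<omega> \<in> ?B")
        case True
        have "\<bar>?g \<omega>\<bar> \<le> 2" unfolding ind by (simp split: if_split)
        moreover have "indicat_real ?B \<omega> = 1" using True by (rule indicator_simps)
        ultimately show ?thesis by linarith
      next
        case False
        have "?g \<omega> = 0"
        proof (cases "\<bar>X (int (Suc j)) \<omega>\<bar> > u")
          case True
          then have "T s \<omega> = 0" using False \<omega> unfolding T_def by (auto simp: large_part_def intro!: sum.neutral)
          then have "T (Suc j) \<omega> = ?T' (Suc k) \<omega>" "T j \<omega> = ?T' k \<omega>"
            using split[of "Suc k" \<omega>] split[of k \<omega>] by (simp_all only: j add_Suc add_0_left)
          then show ?thesis unfolding ind by (simp only: diff_self)
        next
          case nt: False
          then have "T (Suc j) \<omega> = T j \<omega>" by (simp add: T_def large_part_def)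
          moreover have "?T' (Suc k) \<omega> = ?T' k \<omega>" using nt by (simp add: j large_part_def algebra_simps)
          ultimately show ?thesis unfolding ind by (simp only: diff_self)
        qed
        moreover have "indicat_real ?B \<omega> \<ge> 0" by (rule indicator_pos_le)
        ultimately show ?thesis by linarith
      qed
    qed
    also have "\<dots> = 2 * prob ?B" by simp
    also have "prob ?B \<le> (\<Sum>i\<in>{1..s}. \<P>(\<omega> in M. \<bar>X (int (Suc j)) \<omega>\<bar> > u \<and> \<bar>X (int i) \<omega>\<bar> > u))"
    proof -
      have "?B = (\<Union>i\<in>{1..s}. {\<omega> \<in> space M. \<bar>X (int (Suc j)) \<omega>\<bar> > u \<and> \<bar>X (int i) \<omega>\<bar> > u})" by auto
      then show ?thesis by (auto intro!: finite_measure_subadditive_finite)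
    qed
    \<comment> \<open>The lags j + 1 - i with 1 <= i <= s run through k + 1, ..., j, all inside
      {k..n}.\<close>
    also have "\<dots> = (\<Sum>i\<in>{1..s}. ?q (Suc j - i))"
    proof (rule sum.cong)
      fix i assume i: "i \<in> {1..s}"
      have "\<P>(\<omega> in M. \<bar>X (int (Suc j - i) + int i) \<omega>\<bar> > u \<and> \<bar>X (0 + int i) \<omega>\<bar> > u) = ?q (Suc j - i)"
        by (rule shift_prob[where P = "\<lambda>f. \<bar>f (int (Suc j - i))\<bar> > u \<and> \<bar>f 0\<bar> > u" and s = "int i"]) measurable
      moreover have "int (Suc j - i) + int i = int (Suc j)" using i j by auto
      ultimately show "\<P>(\<omega> in M. \<bar>X (int (Suc j)) \<omega>\<bar> > u \<and> \<bar>X (int i) \<omega>\<bar> > u) = ?q (Suc j - i)" by simp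
    qed simp
    also have "\<dots> = (\<Sum>l\<in>(\<lambda>i. Suc j - i) ` {1..s}. ?q l)"
      by (rule sum.reindex[symmetric, unfolded o_def]) (auto simp: inj_on_def j)
    also have "\<dots> \<le> ?S"
      using that by (intro sum_mono2) (auto simp: j)
    finally show ?thesis by linarith
  qed
  have S0: "?S \<ge> 0" by (intro sum_nonneg) auto
  \<comment> \<open>Since y >= 0 the empty sum is not above y, so p 0 = 0 and p n is the whole sum
    of increments.\<close>
  have "\<bar>p n - real n * D k\<bar> = \<bar>\<Sum>j<n. D j - D k\<bar>"
    using sum_lessThan_telescope[of p n] by (simp add: D_def p0 sum_subtractf)
  also have "\<dots> \<le> (\<Sum>j<n. \<bar>D j - D k\<bar>)" by (rule sum_abs)
  also have "\<dots> \<le> (\<Sum>j<n. (if j < k then 2 * ?F else 0) + 2 * ?S)"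
  proof (rule sum_mono)
    fix j assume "j \<in> {..<n}"
    then show "\<bar>D j - D k\<bar> \<le> (if j < k then 2 * ?F else 0) + 2 * ?S"
      using D_le[of j] D_le[of k] D_diff[of j] S0 by auto
  qed
  also have "\<dots> = (\<Sum>j\<in>{j\<in>{..<n}. j < k}. 2 * ?F) + real n * (2 * ?S)"
    by (simp only: sum.distrib sum.inter_filter[symmetric] finite_lessThan) simp
  also have "{j\<in>{..<n}. j < k} = {..<k}" using \<open>k \<le> n\<close> by auto
  finally show ?thesis by (simp add: p_def D_def)
qed

end

section \<open>Increments of \<open>b_plus\<close> at perturbed levels\<close>

lemma tendsto_scaled_increment:
  fixes f :: "real \<Rightarrow> real"
  assumes "(f has_real_derivative D) (at s)" "v \<longlonglongrightarrow> 0" "(\<lambda>k. c k * v k) \<longlonglongrightarrow> 0"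
  shows "(\<lambda>k. c k * (f (s + v k) - f s)) \<longlonglongrightarrow> 0"
proof -
  \<comment> \<open>Caratheodory's form of the derivative: f (s + v) - f s = g (s + v) * v with g
    continuous at s. The weights c k may be unbounded, only c k * v k has to vanish.\<close>
  from assms(1) obtain g where g: "\<And>z. f z - f s = g z * (z - s)" "isCont g s"
    unfolding CARAT_DERIV by blast
  have "(\<lambda>k. s + v k) \<longlonglongrightarrow> s" using tendsto_add[OF tendsto_const assms(2), of s] by simp
  from isCont_tendsto_compose[OF g(2) this]
  have "(\<lambda>k. (c k * v k) * g (s + v k)) \<longlonglongrightarrow> 0 * g s" by (intro tendsto_mult assms(3))
  then show ?thesis by (simp add: g(1) mult_ac)
qed

lemma linear_growth_of_convergent_increments:
  fixes b :: "nat \<Rightarrow> real"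
  assumes "(\<lambda>k. b (k + 1) - b k) \<longlonglongrightarrow> l"
  obtains C where "C > 0" "\<And>k. \<bar>b k\<bar> \<le> C * (real k + 1)"
proof -
  from convergent_imp_Bseq[OF convergentI[OF assms]] obtain C0 where
    C0: "C0 > 0" "\<And>k. \<bar>b (k + 1) - b k\<bar> \<le> C0" by (auto simp: Bseq_def)
  define C where "C = max C0 \<bar>b 0\<bar>"
  have "\<bar>b k\<bar> \<le> C * (real k + 1)" for k
  proof (induction k)
    case (Suc k)
    have "\<bar>b (Suc k)\<bar> \<le> \<bar>b k\<bar> + C" using C0(2)[of k] by (auto simp: C_def)
    with Suc show ?case by (simp add: algebra_simps)
  qed (simp add: C_def)
  then show ?thesis using C0 by (intro that[of C]) (auto simp: C_def)
qed

lemma inverse_square_smallo_mult: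
  fixes \<delta> c :: "nat \<Rightarrow> real" and B :: real
  assumes \<delta>: "\<delta> \<in> o(\<lambda>k. real k powr (-2))" and c: "\<And>k. k \<ge> 1 \<Longrightarrow> \<bar>c k\<bar> \<le> B * (real k)\<^sup>2"
  shows "(\<lambda>k. c k * \<delta> k) \<longlonglongrightarrow> 0"
proof (rule Lim_null_comparison)
  have "(\<lambda>k. \<delta> k / real k powr (-2)) \<longlonglongrightarrow> 0" using \<delta> by (rule smalloD_tendsto)
  then have "(\<lambda>k. \<delta> k * (real k)\<^sup>2) \<longlonglongrightarrow> 0"
    by (rule Lim_transform_eventually)
       (auto intro!: eventually_mono[OF eventually_gt_at_top[of 0]] simp: powr_minus powr_numeral field_simps)
  then have "(\<lambda>k. \<bar>\<delta> k\<bar> * (real k)\<^sup>2) \<longlonglongrightarrow> 0"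
    by (subst (asm) tendsto_rabs_zero_iff[symmetric]) (simp add: abs_mult)
  from tendsto_mult[OF tendsto_const this, of B]
  show "(\<lambda>k. B * (\<bar>\<delta> k\<bar> * (real k)\<^sup>2)) \<longlonglongrightarrow> 0" by simp
  show "\<forall>\<^sub>F k in sequentially. norm (c k * \<delta> k) \<le> B * (\<bar>\<delta> k\<bar> * (real k)\<^sup>2)"
    using eventually_ge_at_top[of "1::nat"]
  proof eventually_elim
    case (elim k)
    have "\<bar>c k\<bar> * \<bar>\<delta> k\<bar> \<le> (B * (real k)\<^sup>2) * \<bar>\<delta> k\<bar>" using c[OF elim] by (intro mult_right_mono) auto
    then show ?case by (simp add: abs_mult algebra_simps)
  qed
qed

text \<open>The level is shifted by about k \<delta>_k and b grows at most linearly, so each product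
  changes by O(k^2 \<delta>_k), which the rate of \<delta> makes negligible. The sign \<sigma> = -1
  serves the upper estimate (level lowered for k + 1 terms, raised for k terms), \<sigma> = 1 the
  lower one.\<close>

lemma increments_at_shifted_levels:
  fixes b \<delta> :: "nat \<Rightarrow> real"
  assumes b: "(\<lambda>k. b (k + 1) - b k) \<longlonglongrightarrow> l" and \<delta>: "\<delta> \<in> o(\<lambda>k. real k powr (-2))"
    and s: "s > 0" and \<sigma>: "\<bar>\<sigma>\<bar> = 1"
  shows "(\<lambda>k. b (Suc k) * (s + \<sigma> * ((real k + 1) * \<delta> k)) powr (-\<alpha>)
            - b k * (s - \<sigma> * (real k * \<delta> k)) powr (-\<alpha>)) \<longlonglongrightarrow> l * s powr (-\<alpha>)"
proof -
  from linear_growth_of_convergent_increments[OF b] obtain C where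
    C: "C > 0" "\<And>k. \<bar>b k\<bar> \<le> C * (real k + 1)" by blast
  note small = inverse_square_smallo_mult[OF \<delta>]
  have sq: "real k + 1 \<le> 2 * (real k)\<^sup>2" "(real k + 2) * (real k + 1) \<le> 6 * (real k)\<^sup>2" if "k \<ge> 1" for k
  proof -
    have k: "1 \<le> real k" using that by simp
    then have "real k * 1 \<le> real k * real k" by (intro mult_left_mono) auto
    then have "real k \<le> (real k)\<^sup>2" by (simp add: power2_eq_square)
    moreover have "(real k + 2) * (real k + 1) = (real k)\<^sup>2 + 3 * real k + 2"
      by (simp add: power2_eq_square algebra_simps)
    ultimately show "real k + 1 \<le> 2 * (real k)\<^sup>2" "(real k + 2) * (real k + 1) \<le> 6 * (real k)\<^sup>2"
      using k by linarith+
  qed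
  let ?f = "\<lambda>u. u powr (-\<alpha>)"
  have der: "(?f has_real_derivative (-\<alpha>) * s powr (-\<alpha> - 1)) (at s)"
    using s by (intro has_real_derivative_powr)
  have "(\<lambda>k. (\<sigma> * (real k + 1)) * \<delta> k) \<longlonglongrightarrow> 0"
  proof (rule small[of _ 2])
    show "\<bar>\<sigma> * (real k + 1)\<bar> \<le> 2 * (real k)\<^sup>2" if "k \<ge> 1" for k
      using \<sigma> sq(1)[OF that] by (simp add: abs_mult)
  qed
  moreover have "(\<lambda>k. (b (Suc k) * \<sigma> * (real k + 1)) * \<delta> k) \<longlonglongrightarrow> 0"
  proof (rule small[of _ "6 * C"])
    fix k :: nat assume "k \<ge> 1"
    have "\<bar>b (Suc k) * \<sigma> * (real k + 1)\<bar> = \<bar>b (Suc k)\<bar> * (real k + 1)" using \<sigma> by (simp add: abs_mult)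
    also have "\<dots> \<le> (C * (real k + 2)) * (real k + 1)" using C(2)[of "Suc k"] by (intro mult_right_mono) (auto simp: add.commute)
    also have "\<dots> \<le> C * (6 * (real k)\<^sup>2)" using C(1) sq(2)[OF \<open>k \<ge> 1\<close>] unfolding mult.assoc by (intro mult_left_mono) auto
    finally show "\<bar>b (Suc k) * \<sigma> * (real k + 1)\<bar> \<le> 6 * C * (real k)\<^sup>2" by simp
  qed
  ultimately have 1: "(\<lambda>k. b (Suc k) * (?f (s + \<sigma> * ((real k + 1) * \<delta> k)) - ?f s)) \<longlonglongrightarrow> 0"
    by (intro tendsto_scaled_increment[OF der]) (simp_all add: mult_ac)
  have "(\<lambda>k. (- \<sigma> * real k) * \<delta> k) \<longlonglongrightarrow> 0"
  proof (rule small[of _ 2])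
    show "\<bar>- \<sigma> * real k\<bar> \<le> 2 * (real k)\<^sup>2" if "k \<ge> 1" for k
      using \<sigma> sq(1)[OF that] by (simp add: abs_mult)
  qed
  moreover have "(\<lambda>k. (- b k * \<sigma> * real k) * \<delta> k) \<longlonglongrightarrow> 0"
  proof (rule small[of _ "6 * C"])
    fix k :: nat assume "k \<ge> 1"
    have "\<bar>- b k * \<sigma> * real k\<bar> = \<bar>b k\<bar> * real k" using \<sigma> by (simp add: abs_mult)
    also have "\<dots> \<le> (C * (real k + 1)) * (real k + 2)" using C(2)[of k] C(1) by (intro mult_mono) auto
    also have "\<dots> \<le> C * (6 * (real k)\<^sup>2)" using C(1) sq(2)[OF \<open>k \<ge> 1\<close>] unfolding mult.assoc by (intro mult_left_mono) (auto simp: mult.commute)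
    finally show "\<bar>- b k * \<sigma> * real k\<bar> \<le> 6 * C * (real k)\<^sup>2" by simp
  qed
  ultimately have 2: "(\<lambda>k. b k * (?f (s + (- \<sigma> * real k) * \<delta> k) - ?f s)) \<longlonglongrightarrow> 0"
    by (intro tendsto_scaled_increment[OF der]) (simp_all add: mult_ac)
  have "(\<lambda>k. (b (k + 1) - b k) * ?f s + b (Suc k) * (?f (s + \<sigma> * ((real k + 1) * \<delta> k)) - ?f s)
      - b k * (?f (s + (- \<sigma> * real k) * \<delta> k) - ?f s)) \<longlonglongrightarrow> l * ?f s + 0 - 0"
    by (intro tendsto_intros b 1 2)
  then show ?thesis by (simp add: algebra_simps)
qed


section \<open>Uniform large deviations when the small parts are negligible\<close>

context stationary_sequence
begin

text \<open>\<open>Inf\<close> is a genuine lower bound only because the regions lie in (0,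
  \<infinity>); so divergence of the infima turns statements about large x into statements uniform
  over \<open>\<Lambda> n\<close>.\<close>

lemma eventually_in_regions:
  assumes ac: "anti_clustering M X \<alpha> \<delta> \<Lambda>"
    and Inf: "filterlim (\<lambda>n. Inf (\<Lambda> n)) at_top sequentially"
    and Q: "eventually Q at_top"
  shows "\<forall>\<^sub>F n in sequentially. \<forall>x\<in>\<Lambda> n. Q x"
proof -
  obtain N where N: "\<And>x. x \<ge> N \<Longrightarrow> Q x" using Q by (auto simp: eventually_at_top_linorder)
  have "\<forall>\<^sub>F n in sequentially. Inf (\<Lambda> n) \<ge> N" using Inf by (auto simp: filterlim_at_top)
  then show ?thesis using eventually_ge_at_top[of "1::nat"]
  proof eventually_elim
    case (elim n)
    then have "\<Lambda> n \<subseteq> {0<..}" using ac by (simp add: anti_clustering_def)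
    then have "bdd_below (\<Lambda> n)" by (intro bdd_belowI[of _ 0]) auto
    then show ?case using N elim(1) cInf_lower[of _ "\<Lambda> n"] by (meson order_trans)
  qed
qed

lemma large_part_sum_bounds:
  fixes k :: nat and L r y :: real
  assumes "real k * L \<le> r" "L \<ge> 0"
  shows "\<P>(\<omega> in M. (\<Sum>i=1..k. large_part L (X (int i) \<omega>)) > y) \<le> \<P>(\<omega> in M. partial_sum X k \<omega> > y - r)"
    and "\<P>(\<omega> in M. partial_sum X k \<omega> > y + r) \<le> \<P>(\<omega> in M. (\<Sum>i=1..k. large_part L (X (int i) \<omega>)) > y)"
proof -
  have "\<bar>\<Sum>i=1..k. small_part L (X (int i) \<omega>)\<bar> \<le> r" for \<omega>
  proof -
    have "\<bar>\<Sum>i=1..k. small_part L (X (int i) \<omega>)\<bar> \<le> (\<Sum>i=1..k. \<bar>small_part L (X (int i) \<omega>)\<bar>)" by (rule sum_abs)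
    also have "\<dots> \<le> (\<Sum>i=1..k. L)" using assms by (intro sum_mono abs_small_part_le)
    finally show ?thesis using assms by simp
  qed
  note small = this
  have "partial_sum X k \<omega> = (\<Sum>i=1..k. large_part L (X (int i) \<omega>)) + (\<Sum>i=1..k. small_part L (X (int i) \<omega>))" for \<omega>
    by (simp add: partial_sum_def sum.distrib[symmetric] large_plus_small)
  then have "y < (\<Sum>i=1..k. large_part L (X (int i) \<omega>)) \<Longrightarrow> y - r < partial_sum X k \<omega>"
    "y + r < partial_sum X k \<omega> \<Longrightarrow> y < (\<Sum>i=1..k. large_part L (X (int i) \<omega>))" for \<omega> y
    using small[of \<omega>] by (simp_all only:)
  moreover have [measurable]: "partial_sum X k \<in> borel_measurable M" unfolding partial_sum_def by measurable
  ultimately show "\<P>(\<omega> in M. (\<Sum>i=1..k. large_part L (X (int i) \<omega>)) > y) \<le> \<P>(\<omega> in M. partial_sum X k \<omega> > y - r)"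
    and "\<P>(\<omega> in M. partial_sum X k \<omega> > y + r) \<le> \<P>(\<omega> in M. (\<Sum>i=1..k. large_part L (X (int i) \<omega>)) > y)"
    by (auto intro!: finite_measure_mono)
qed

text \<open>The choices are made in the order \<epsilon>, k, n: \<epsilon> is the share of x left to
  the small parts, k is taken large for that \<epsilon>, and with k fixed everything holds for large
  n, uniformly over x in \<open>\<Lambda> n\<close>.\<close>

theorem large_deviations_of_negligible_truncation:
  fixes \<alpha> bp :: real and \<delta> :: "nat \<Rightarrow> real" and \<Lambda> :: "nat \<Rightarrow> real set"
  assumes "\<alpha> > 0" and rv: "regularly_varying M X \<alpha>"
    and ac: "anti_clustering M X \<alpha> \<delta> \<Lambda>"
    and \<delta>: "\<delta> \<in> o(\<lambda>k. real k powr (-2))"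
    and Inf: "filterlim (\<lambda>n. Inf (\<Lambda> n)) at_top sequentially"
    and bp: "(\<lambda>k. b_plus M X (k + 1) - b_plus M X k) \<longlonglongrightarrow> bp"
    and trunc: "\<And>e \<epsilon>. e > 0 \<Longrightarrow> \<epsilon> > 0 \<Longrightarrow> \<forall>\<^sub>F k in sequentially. \<forall>\<^sub>F n in sequentially. \<forall>x\<in>\<Lambda> n.
       \<P>(\<omega> in M. \<bar>\<Sum>i=1..n. small_part (x * \<delta> k) (X (int i) \<omega>)\<bar> > \<epsilon> * x) \<le> e * (real n * abs_tail M X x)"
  shows "(\<lambda>n. SUP x\<in>\<Lambda> n. ereal \<bar>\<P>(\<omega> in M. partial_sum X n \<omega> > x)
                              / (real n * abs_tail M X x) - bp\<bar>) \<longlonglongrightarrow> 0"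
proof -
  let ?F = "abs_tail M X"
  let ?b = "b_plus M X"
  interpret R: rv_tail ?F \<alpha>
    by (rule regularly_varying_tails(1)[OF prob_space_axioms X_meas stat \<open>\<alpha> > 0\<close> rv])
  have G: "((\<lambda>x. \<P>(\<omega> in M. partial_sum X k \<omega> > s * x) / ?F x) \<longlongrightarrow> s powr (-\<alpha>) * ?b k) at_top"
    if "k \<ge> 1" "s > 0" for k s
    by (rule regularly_varying_tails(2)[OF prob_space_axioms X_meas stat \<open>\<alpha> > 0\<close> rv that])
  have \<delta>_pos: "\<delta> k > 0" for k using ac by (simp add: anti_clustering_def)
  have [measurable]: "partial_sum X k \<in> borel_measurable M" for k unfolding partial_sum_def by measurable
  \<comment> \<open>The budget of 10 e: 5 e from telescoping (e for the first k increments, 4 e for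
    joint exceedances), e from the small parts, and 4 e from the increment at k (e for each of two
    tail ratios, e for the limit in k, e for the factor (1 - \<epsilon>) powr (-\<alpha>) or (1 +
    \<epsilon>) powr (-\<alpha>)).\<close>
  have key: "\<forall>\<^sub>F n in sequentially. \<forall>x\<in>\<Lambda> n.
     \<bar>\<P>(\<omega> in M. partial_sum X n \<omega> > x) / (real n * ?F x) - bp\<bar> \<le> 10 * e" if "e > 0" for e
  proof -
    have "((\<lambda>\<epsilon>. bp * (1 - \<epsilon>) powr (-\<alpha>)) \<longlongrightarrow> bp * (1 - 0) powr (-\<alpha>)) (at_right 0)"
      "((\<lambda>\<epsilon>. bp * (1 + \<epsilon>) powr (-\<alpha>)) \<longlongrightarrow> bp * (1 + 0) powr (-\<alpha>)) (at_right 0)"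
      by (intro tendsto_intros; simp)+
    then have "\<forall>\<^sub>F \<epsilon> in at_right 0. \<bar>bp * (1 - \<epsilon>) powr (-\<alpha>) - bp\<bar> < e"
      "\<forall>\<^sub>F \<epsilon> in at_right 0. \<bar>bp * (1 + \<epsilon>) powr (-\<alpha>) - bp\<bar> < e"
      using \<open>e > 0\<close> by (auto simp: tendsto_iff dist_real_def)
    moreover have "\<forall>\<^sub>F \<epsilon> in at_right 0. \<epsilon> \<in> {0<..<1/2::real}"
      by (intro eventually_at_right_real) simp
    ultimately have "\<forall>\<^sub>F \<epsilon> in at_right 0. \<epsilon> \<in> {0<..<1/2::real} \<and> \<bar>bp * (1 - \<epsilon>) powr (-\<alpha>) - bp\<bar> < e
       \<and> \<bar>bp * (1 + \<epsilon>) powr (-\<alpha>) - bp\<bar> < e"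
      by eventually_elim auto
    then obtain \<epsilon> where \<epsilon>: "0 < \<epsilon>" "\<epsilon> < 1/2" "\<bar>bp * (1 - \<epsilon>) powr (-\<alpha>) - bp\<bar> < e"
       "\<bar>bp * (1 + \<epsilon>) powr (-\<alpha>) - bp\<bar> < e"
      by (auto dest!: eventually_happens)
    have ev1: "\<forall>\<^sub>F k in sequentially. \<bar>(?b (Suc k) * ((1 - \<epsilon>) + (-1) * ((real k + 1) * \<delta> k)) powr (-\<alpha>)
            - ?b k * ((1 - \<epsilon>) - (-1) * (real k * \<delta> k)) powr (-\<alpha>)) - bp * (1 - \<epsilon>) powr (-\<alpha>)\<bar> < e"
      using increments_at_shifted_levels[OF bp \<delta>, of "1 - \<epsilon>" "-1" \<alpha>] \<epsilon> \<open>e > 0\<close>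
      by (auto simp: tendsto_iff dist_real_def)
    have ev2: "\<forall>\<^sub>F k in sequentially. \<bar>(?b (Suc k) * ((1 + \<epsilon>) + 1 * ((real k + 1) * \<delta> k)) powr (-\<alpha>)
            - ?b k * ((1 + \<epsilon>) - 1 * (real k * \<delta> k)) powr (-\<alpha>)) - bp * (1 + \<epsilon>) powr (-\<alpha>)\<bar> < e"
      using increments_at_shifted_levels[OF bp \<delta>, of "1 + \<epsilon>" 1 \<alpha>] \<epsilon> \<open>e > 0\<close>
      by (auto simp: tendsto_iff dist_real_def)
    \<comment> \<open>With \<epsilon> < 1/2 and shifts below 1/4 all four shifted levels stay
      positive, as the tail ratios require.\<close>
    have "(\<lambda>k. (real k + 1) * \<delta> k) \<longlonglongrightarrow> 0"
    proof (rule inverse_square_smallo_mult[OF \<delta>, of _ 2])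
      fix k :: nat assume "k \<ge> 1"
      then have k: "1 \<le> real k" by simp
      have "real k * 1 \<le> real k * real k" using k by (intro mult_left_mono) auto
      then show "\<bar>real k + 1\<bar> \<le> 2 * (real k)\<^sup>2" using k unfolding power2_eq_square by linarith
    qed
    then have ev3: "\<forall>\<^sub>F k in sequentially. (real k + 1) * \<delta> k < 1/4"
      by (rule order_tendstoD(2)) simp
    have "(\<lambda>k. limsup (\<lambda>n. SUP x\<in>\<Lambda> n. ereal (\<delta> k powr (-\<alpha>) *
         (\<Sum>j=k..n. cond_prob M (\<lambda>\<omega>. \<bar>X (int j) \<omega>\<bar> > x * \<delta> k) (\<lambda>\<omega>. \<bar>X 0 \<omega>\<bar> > x * \<delta> k)))))
       \<longlonglongrightarrow> 0"
      using ac by (simp add: anti_clustering_def)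
    from order_tendstoD(2)[OF this, of "ereal e"] \<open>e > 0\<close>
    have ev4: "\<forall>\<^sub>F k in sequentially. limsup (\<lambda>n. SUP x\<in>\<Lambda> n. ereal (\<delta> k powr (-\<alpha>) *
         (\<Sum>j=k..n. cond_prob M (\<lambda>\<omega>. \<bar>X (int j) \<omega>\<bar> > x * \<delta> k) (\<lambda>\<omega>. \<bar>X 0 \<omega>\<bar> > x * \<delta> k)))) < ereal e"
      by simp
    from ev1 ev2 ev3 ev4 trunc[OF \<open>e > 0\<close> \<open>\<epsilon> > 0\<close>] eventually_ge_at_top[of "1::nat"]
    have "\<forall>\<^sub>F k in sequentially. k \<ge> 1 \<and> (real k + 1) * \<delta> k < 1/4
       \<and> \<bar>(?b (Suc k) * ((1 - \<epsilon>) - (real k + 1) * \<delta> k) powr (-\<alpha>)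
            - ?b k * ((1 - \<epsilon>) + real k * \<delta> k) powr (-\<alpha>)) - bp * (1 - \<epsilon>) powr (-\<alpha>)\<bar> < e
       \<and> \<bar>(?b (Suc k) * ((1 + \<epsilon>) + (real k + 1) * \<delta> k) powr (-\<alpha>)
            - ?b k * ((1 + \<epsilon>) - real k * \<delta> k) powr (-\<alpha>)) - bp * (1 + \<epsilon>) powr (-\<alpha>)\<bar> < e
       \<and> limsup (\<lambda>n. SUP x\<in>\<Lambda> n. ereal (\<delta> k powr (-\<alpha>) *
         (\<Sum>j=k..n. cond_prob M (\<lambda>\<omega>. \<bar>X (int j) \<omega>\<bar> > x * \<delta> k) (\<lambda>\<omega>. \<bar>X 0 \<omega>\<bar> > x * \<delta> k)))) < ereal e
       \<and> (\<forall>\<^sub>F n in sequentially. \<forall>x\<in>\<Lambda> n.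
       \<P>(\<omega> in M. \<bar>\<Sum>i=1..n. small_part (x * \<delta> k) (X (int i) \<omega>)\<bar> > \<epsilon> * x) \<le> e * (real n * ?F x))"
      by eventually_elim simp
    from eventually_happens'[OF sequentially_bot this] obtain k where k: "k \<ge> 1" "(real k + 1) * \<delta> k < 1/4"
      and U: "\<bar>(?b (Suc k) * ((1 - \<epsilon>) - (real k + 1) * \<delta> k) powr (-\<alpha>)
            - ?b k * ((1 - \<epsilon>) + real k * \<delta> k) powr (-\<alpha>)) - bp * (1 - \<epsilon>) powr (-\<alpha>)\<bar> < e"
      and W: "\<bar>(?b (Suc k) * ((1 + \<epsilon>) + (real k + 1) * \<delta> k) powr (-\<alpha>)
            - ?b k * ((1 + \<epsilon>) - real k * \<delta> k) powr (-\<alpha>)) - bp * (1 + \<epsilon>) powr (-\<alpha>)\<bar> < e"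
      and cl: "limsup (\<lambda>n. SUP x\<in>\<Lambda> n. ereal (\<delta> k powr (-\<alpha>) *
         (\<Sum>j=k..n. cond_prob M (\<lambda>\<omega>. \<bar>X (int j) \<omega>\<bar> > x * \<delta> k) (\<lambda>\<omega>. \<bar>X 0 \<omega>\<bar> > x * \<delta> k)))) < ereal e"
      and tr: "\<forall>\<^sub>F n in sequentially. \<forall>x\<in>\<Lambda> n.
       \<P>(\<omega> in M. \<bar>\<Sum>i=1..n. small_part (x * \<delta> k) (X (int i) \<omega>)\<bar> > \<epsilon> * x) \<le> e * (real n * ?F x)"
      by (elim exE conjE) (rule that)
    define d where "d = \<delta> k"
    have d: "d > 0" "real k * d < 1/4" "(real k + 1) * d < 1/4" "real k * d \<ge> 0" "(real k + 1) * d \<ge> 0"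
      using \<delta>_pos[of k] k(2) by (auto simp: d_def algebra_simps)
    have ratio: "\<forall>\<^sub>F x in at_top. \<bar>\<P>(\<omega> in M. partial_sum X m \<omega> > s * x) / ?F x - s powr (-\<alpha>) * ?b m\<bar> < e"
      if "m \<ge> 1" "s > 0" for m s
      using G[OF that] \<open>e > 0\<close> by (auto simp: tendsto_iff dist_real_def)
    have pos: "(1 - \<epsilon>) - (real k + 1) * d > 0" "(1 - \<epsilon>) + real k * d > 0"
      "(1 + \<epsilon>) + (real k + 1) * d > 0" "(1 + \<epsilon>) - real k * d > 0"
      using d \<epsilon>(1,2) by linarith+
    have "\<forall>\<^sub>F x in at_top. ?F (d * x) / ?F x < 2 * d powr (-\<alpha>)"
      using d by (intro order_tendstoD(2)[OF R.rv]) auto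
    then have "\<forall>\<^sub>F x in at_top.
       \<bar>\<P>(\<omega> in M. partial_sum X (Suc k) \<omega> > ((1 - \<epsilon>) - (real k + 1) * d) * x) / ?F x - ((1 - \<epsilon>) - (real k + 1) * d) powr (-\<alpha>) * ?b (Suc k)\<bar> < e
     \<and> \<bar>\<P>(\<omega> in M. partial_sum X k \<omega> > ((1 - \<epsilon>) + real k * d) * x) / ?F x - ((1 - \<epsilon>) + real k * d) powr (-\<alpha>) * ?b k\<bar> < e
     \<and> \<bar>\<P>(\<omega> in M. partial_sum X (Suc k) \<omega> > ((1 + \<epsilon>) + (real k + 1) * d) * x) / ?F x - ((1 + \<epsilon>) + (real k + 1) * d) powr (-\<alpha>) * ?b (Suc k)\<bar> < e
     \<and> \<bar>\<P>(\<omega> in M. partial_sum X k \<omega> > ((1 + \<epsilon>) - real k * d) * x) / ?F x - ((1 + \<epsilon>) - real k * d) powr (-\<alpha>) * ?b k\<bar> < e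
     \<and> ?F (d * x) / ?F x < 2 * d powr (-\<alpha>) \<and> x > 0"
      using k(1) by (intro eventually_conj ratio pos eventually_gt_at_top) auto
    note evx = eventually_in_regions[OF ac Inf this]
    have "(\<lambda>n. 4 * real k * d powr (-\<alpha>) * inverse (real n)) \<longlonglongrightarrow> 4 * real k * d powr (-\<alpha>) * 0"
      by (intro tendsto_intros tendsto_inverse_0_at_top filterlim_real_sequentially)
    then have evn: "\<forall>\<^sub>F n in sequentially. 4 * real k * d powr (-\<alpha>) * inverse (real n) < e"
      using \<open>e > 0\<close> by (intro order_tendstoD(2)) auto
    from evx evn Limsup_lessD[OF cl] tr eventually_ge_at_top[of k]
    show ?thesis
    proof eventually_elim
      case (elim n)
      show ?case
      proof
        fix x assume x: "x \<in> \<Lambda> n"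
        let ?L = "x * \<delta> k"
        let ?T = "\<lambda>m \<omega>. \<Sum>i=1..m. large_part ?L (X (int i) \<omega>)"
        let ?p = "\<lambda>m y. \<P>(\<omega> in M. ?T m \<omega> > y)"
        let ?S = "\<lambda>m y. \<P>(\<omega> in M. partial_sum X m \<omega> > y)"
        let ?q = "\<Sum>l=k..n. \<P>(\<omega> in M. \<bar>X (int l) \<omega>\<bar> > ?L \<and> \<bar>X 0 \<omega>\<bar> > ?L)"
        let ?N = "real n * ?F x"
        have n: "n \<ge> 1" "real n > 0" using k elim(5) by auto
        have x0: "x > 0" and FL: "?F ?L / ?F x < 2 * d powr (-\<alpha>)"
          using elim(1) x by (auto simp: d_def mult.commute)
        have FL': "?F ?L \<le> 2 * d powr (-\<alpha>) * ?F x"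
          using FL R.F_pos[of x] by (simp add: field_simps)
        have L: "?L > 0" using x0 \<delta>_pos by simp
        have N: "?N > 0" using n R.F_pos[of x] by simp
        \<comment> \<open>k is fixed while n grows, so a bounded multiple of F x is negligible
          against n F x.\<close>
        have e1: "2 * real k * ?F ?L \<le> e * ?N"
        proof -
          have "2 * real k * ?F ?L \<le> 2 * real k * (2 * d powr (-\<alpha>) * ?F x)"
            using FL' by (intro mult_left_mono) auto
          also have "\<dots> = (4 * real k * d powr (-\<alpha>) * inverse (real n)) * ?N" using n by simp
          also have "\<dots> \<le> e * ?N" using elim(2) N by (intro mult_right_mono) auto
          finally show ?thesis .
        qed
        \<comment> \<open>A joint exceedance probability is F at the truncation level times a
          conditional one. Passing from F (x \<delta>_k) to F x costs \<delta>_k powr (-\<alpha>),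
          exactly the factor built into the anti-clustering condition.\<close>
        have e2: "2 * real n * ?q \<le> 4 * e * ?N"
        proof -
          let ?c = "\<Sum>j=k..n. cond_prob M (\<lambda>\<omega>. \<bar>X (int j) \<omega>\<bar> > ?L) (\<lambda>\<omega>. \<bar>X 0 \<omega>\<bar> > ?L)"
          have "?q = ?F ?L * ?c"
            using R.F_pos[of ?L] by (simp add: cond_prob_def sum_distrib_left abs_tail_def)
          also have "\<dots> \<le> 2 * d powr (-\<alpha>) * ?F x * ?c"
            using FL' by (intro mult_right_mono sum_nonneg) (auto simp: cond_prob_def)
          also have "\<dots> = 2 * ?F x * (d powr (-\<alpha>) * ?c)" by simp
          also have "d powr (-\<alpha>) * ?c \<le> e"
          proof -
            have "ereal (d powr (-\<alpha>) * ?c) \<le> (SUP x\<in>\<Lambda> n. ereal (\<delta> k powr (-\<alpha>) *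
              (\<Sum>j=k..n. cond_prob M (\<lambda>\<omega>. \<bar>X (int j) \<omega>\<bar> > x * \<delta> k) (\<lambda>\<omega>. \<bar>X 0 \<omega>\<bar> > x * \<delta> k))))"
              unfolding d_def by (rule SUP_upper[OF x])
            also have "\<dots> < ereal e" by (rule elim(3))
            finally show ?thesis by simp
          qed
          finally have "?q \<le> 2 * ?F x * e" using R.F_pos[of x] by simp
          then have "2 * real n * ?q \<le> 2 * real n * (2 * ?F x * e)" by (intro mult_left_mono) auto
          then show ?thesis by (simp add: mult_ac)
        qed
        have e3: "\<P>(\<omega> in M. \<bar>\<Sum>i=1..n. small_part ?L (X (int i) \<omega>)\<bar> > \<epsilon> * x) \<le> e * ?N" (is "?r \<le> _")
          using elim(4) x by auto
        have S_split: "partial_sum X n \<omega> = ?T n \<omega> + (\<Sum>i=1..n. small_part ?L (X (int i) \<omega>))" for \<omega>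
          by (simp add: partial_sum_def sum.distrib[symmetric] large_plus_small)
        have up0: "?S n x \<le> ?p n ((1 - \<epsilon>) * x) + ?r"
        proof -
          have "?S n x \<le> prob ({\<omega> \<in> space M. ?T n \<omega> > (1 - \<epsilon>) * x} \<union>
              {\<omega> \<in> space M. \<bar>\<Sum>i=1..n. small_part ?L (X (int i) \<omega>)\<bar> > \<epsilon> * x})"
            by (rule finite_measure_mono) (auto simp: S_split algebra_simps)
          also have "\<dots> \<le> ?p n ((1 - \<epsilon>) * x) + ?r" by (rule measure_subadditive) auto
          finally show ?thesis .
        qed
        have lo0: "?p n ((1 + \<epsilon>) * x) \<le> ?S n x + ?r"
        proof -
          have "?p n ((1 + \<epsilon>) * x) \<le> prob ({\<omega> \<in> space M. partial_sum X n \<omega> > x} \<union>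
              {\<omega> \<in> space M. \<bar>\<Sum>i=1..n. small_part ?L (X (int i) \<omega>)\<bar> > \<epsilon> * x})"
            by (rule finite_measure_mono) (auto simp: S_split algebra_simps)
          also have "\<dots> \<le> ?S n x + ?r" by (rule measure_subadditive) auto
          finally show ?thesis .
        qed
        have tel: "\<bar>?p n y - real n * (?p (Suc k) y - ?p k y)\<bar> \<le> 5 * e * ?N" if "y \<ge> 0" for y
          using telescoping_bound[OF that elim(5), of ?L] e1 e2 by linarith
        have sc: "(1 - \<epsilon>) * x - (real k + 1) * ?L = ((1 - \<epsilon>) - (real k + 1) * d) * x"
          "(1 - \<epsilon>) * x + real k * ?L = ((1 - \<epsilon>) + real k * d) * x"
          "(1 + \<epsilon>) * x + (real k + 1) * ?L = ((1 + \<epsilon>) + (real k + 1) * d) * x"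
          "(1 + \<epsilon>) * x - real k * ?L = ((1 + \<epsilon>) - real k * d) * x"
          by (simp_all add: d_def algebra_simps)
        have sk: "real (Suc k) * ?L \<le> (real k + 1) * ?L" by (simp add: add.commute)
        note pS = large_part_sum_bounds[OF sk less_imp_le[OF L]] large_part_sum_bounds[OF order_refl[of "real k * ?L"] less_imp_le[OF L]]
        define u1 u2 u3 u4 where u: "u1 = ?S (Suc k) (((1 - \<epsilon>) - (real k + 1) * d) * x)"
          "u2 = ?S k (((1 - \<epsilon>) + real k * d) * x)"
          "u3 = ?S (Suc k) (((1 + \<epsilon>) + (real k + 1) * d) * x)"
          "u4 = ?S k (((1 + \<epsilon>) - real k * d) * x)"
        \<comment> \<open>To bound the difference from above, the level is lowered for k + 1 terms
          and raised for k terms; the lower bound shifts both the other way.\<close>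
        have up1: "?p (Suc k) ((1 - \<epsilon>) * x) - ?p k ((1 - \<epsilon>) * x) \<le> u1 - u2"
          using pS(1)[of "(1 - \<epsilon>) * x"] pS(4)[of "(1 - \<epsilon>) * x"] unfolding sc u by linarith
        have lo1: "u3 - u4 \<le> ?p (Suc k) ((1 + \<epsilon>) * x) - ?p k ((1 + \<epsilon>) * x)"
          using pS(2)[of "(1 + \<epsilon>) * x"] pS(3)[of "(1 + \<epsilon>) * x"] unfolding sc u by linarith
        have r: "\<bar>u1 / ?F x - ((1 - \<epsilon>) - (real k + 1) * d) powr (-\<alpha>) * ?b (Suc k)\<bar> < e"
          "\<bar>u2 / ?F x - ((1 - \<epsilon>) + real k * d) powr (-\<alpha>) * ?b k\<bar> < e"
          "\<bar>u3 / ?F x - ((1 + \<epsilon>) + (real k + 1) * d) powr (-\<alpha>) * ?b (Suc k)\<bar> < e"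
          "\<bar>u4 / ?F x - ((1 + \<epsilon>) - real k * d) powr (-\<alpha>) * ?b k\<bar> < e"
          using elim(1) x unfolding u by blast+
        have "u1 / ?F x - u2 / ?F x \<le> bp + 4 * e"
          using r(1,2) U \<epsilon>(3) unfolding d_def[symmetric] by (simp only: mult.commute[of "_ powr _"])
        then have up2: "u1 - u2 \<le> (bp + 4 * e) * ?F x"
          using R.F_pos[of x] by (simp add: diff_divide_distrib[symmetric] pos_divide_le_eq)
        have "bp - 4 * e \<le> u3 / ?F x - u4 / ?F x"
          using r(3,4) W \<epsilon>(4) unfolding d_def[symmetric] by (simp only: mult.commute[of "_ powr _"])
        then have lo2: "(bp - 4 * e) * ?F x \<le> u3 - u4"
          using R.F_pos[of x] by (simp add: diff_divide_distrib[symmetric] pos_le_divide_eq)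
        have "real n * (?p (Suc k) ((1 - \<epsilon>) * x) - ?p k ((1 - \<epsilon>) * x)) \<le> real n * ((bp + 4 * e) * ?F x)"
          using up1 up2 by (intro mult_left_mono) auto
        then have "?S n x \<le> (bp + 10 * e) * ?N"
          using up0 e3 tel[of "(1 - \<epsilon>) * x"] \<epsilon> x0 by (simp add: algebra_simps abs_le_iff)
        moreover have "real n * ((bp - 4 * e) * ?F x) \<le> real n * (?p (Suc k) ((1 + \<epsilon>) * x) - ?p k ((1 + \<epsilon>) * x))"
          using lo1 lo2 by (intro mult_left_mono) auto
        then have "(bp - 10 * e) * ?N \<le> ?S n x"
          using lo0 e3 tel[of "(1 + \<epsilon>) * x"] \<epsilon> x0 by (simp add: algebra_simps abs_le_iff)
        ultimately have "?S n x / ?N \<le> bp + 10 * e" "bp - 10 * e \<le> ?S n x / ?N"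
          using N by (auto simp: pos_divide_le_eq pos_le_divide_eq)
        then show "\<bar>?S n x / ?N - bp\<bar> \<le> 10 * e" by linarith
      qed
    qed
  qed
  show ?thesis
  proof (rule order_tendstoI)
    \<comment> \<open>Nonemptiness of \<open>\<Lambda> n\<close> matters here: in
      \<open>ereal\<close> the supremum over the empty set is minus infinity.\<close>
    fix y :: ereal assume "y < 0"
    show "\<forall>\<^sub>F n in sequentially. y < (SUP x\<in>\<Lambda> n. ereal \<bar>\<P>(\<omega> in M. partial_sum X n \<omega> > x) / (real n * ?F x) - bp\<bar>)"
      using eventually_ge_at_top[of "1::nat"]
    proof eventually_elim
      case (elim n)
      then have "\<Lambda> n \<noteq> {}" using ac unfolding anti_clustering_def by simp
      then obtain x where "x \<in> \<Lambda> n" by blast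
      then have "0 \<le> (SUP x\<in>\<Lambda> n. ereal \<bar>\<P>(\<omega> in M. partial_sum X n \<omega> > x) / (real n * ?F x) - bp\<bar>)"
        by (intro SUP_upper2) auto
      then show ?case using \<open>y < 0\<close> by (rule less_le_trans[rotated])
    qed
  next
    fix y :: ereal assume "0 < y"
    then obtain r where r: "0 < ereal r" "ereal r < y" by (metis ereal_dense2)
    from key[of "r / 10"] r(1)
    have "\<forall>\<^sub>F n in sequentially. \<forall>x\<in>\<Lambda> n. \<bar>\<P>(\<omega> in M. partial_sum X n \<omega> > x) / (real n * ?F x) - bp\<bar> \<le> r" by simp
    then show "\<forall>\<^sub>F n in sequentially. (SUP x\<in>\<Lambda> n. ereal \<bar>\<P>(\<omega> in M. partial_sum X n \<omega> > x) / (real n * ?F x) - bp\<bar>) < y"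
      by eventually_elim (rule le_less_trans[OF SUP_least r(2)], auto)
  qed
qed

end

section \<open>Moments of martingale-like sums\<close>

lemma abs_power_mult_le:
  fixes x y :: real
  shows "\<bar>x\<bar> ^ i * \<bar>y\<bar> ^ j \<le> \<bar>x\<bar> ^ (i + j) + \<bar>y\<bar> ^ (i + j)"
proof (cases "\<bar>x\<bar> \<le> \<bar>y\<bar>")
  case True
  have "\<bar>x\<bar> ^ i * \<bar>y\<bar> ^ j \<le> \<bar>y\<bar> ^ i * \<bar>y\<bar> ^ j" using True by (intro mult_right_mono power_mono) auto
  then show ?thesis by (simp add: power_add add_increasing)
next
  case False
  have "\<bar>x\<bar> ^ i * \<bar>y\<bar> ^ j \<le> \<bar>x\<bar> ^ i * \<bar>x\<bar> ^ j" using False by (intro mult_left_mono power_mono) auto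
  then show ?thesis by (simp add: power_add add_increasing2)
qed

text \<open>The terms of order 2, ..., n are dominated by the two extreme ones, according to which
  of |x| and |d| is larger.\<close>

lemma binomial_higher_term_le:
  fixes x d :: real
  assumes "2 \<le> j" "j \<le> n"
  shows "\<bar>d\<bar> ^ j * \<bar>x\<bar> ^ (n - j) \<le> \<bar>x\<bar> ^ (n - 2) * d\<^sup>2 + \<bar>d\<bar> ^ n"
proof (cases "\<bar>d\<bar> \<le> \<bar>x\<bar>")
  case True
  have "\<bar>d\<bar> ^ j = \<bar>d\<bar> ^ 2 * \<bar>d\<bar> ^ (j - 2)"
    using assms(1) by (metis le_add_diff_inverse power_add)
  then have "\<bar>d\<bar> ^ j * \<bar>x\<bar> ^ (n - j) = (\<bar>d\<bar> ^ 2 * \<bar>d\<bar> ^ (j - 2)) * \<bar>x\<bar> ^ (n - j)" by simp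
  also have "\<dots> \<le> (\<bar>d\<bar> ^ 2 * \<bar>x\<bar> ^ (j - 2)) * \<bar>x\<bar> ^ (n - j)"
    using True by (intro mult_right_mono mult_left_mono power_mono) auto
  also have "\<dots> = \<bar>x\<bar> ^ (n - 2) * d\<^sup>2"
    using assms by (simp add: mult.assoc power_add[symmetric])
  finally show ?thesis by (simp add: add_increasing2)
next
  case False
  have "\<bar>d\<bar> ^ j * \<bar>x\<bar> ^ (n - j) \<le> \<bar>d\<bar> ^ j * \<bar>d\<bar> ^ (n - j)"
    using False by (intro mult_left_mono power_mono) auto
  also have "\<dots> = \<bar>d\<bar> ^ n" using assms by (simp add: power_add[symmetric])
  finally show ?thesis by (simp add: add_increasing)
qed

text \<open>The linear term is kept exactly because it will have mean zero. All others are collected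
  into the quadratic and the top term, with 4 ^ m = 2 ^ (2 * m) the sum of the binomial
  coefficients.\<close>

lemma even_power_taylor:
  fixes x d :: real
  assumes "m \<ge> 1"
  shows "(x + d) ^ (2 * m) \<le> x ^ (2 * m) + 2 * m * x ^ (2 * m - 1) * d
     + 4 ^ m * (x ^ (2 * m - 2) * d\<^sup>2 + d ^ (2 * m))"
proof -
  let ?n = "2 * m"
  let ?t = "\<lambda>j. of_nat (?n choose j) * d ^ j * x ^ (?n - j)"
  have ev: "even (?n - 2)" by simp
  have "(x + d) ^ ?n = (\<Sum>j\<le>?n. ?t j)" using binomial_ring[of d x ?n] by (simp add: add.commute)
  also have "{..?n} = insert 0 (insert 1 {2..?n})" using assms by auto
  also have "(\<Sum>j\<in>insert 0 (insert 1 {2..?n}). ?t j) = ?t 0 + (?t 1 + (\<Sum>j=2..?n. ?t j))"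
    by (subst sum.insert; simp)+
  also have "(\<Sum>j=2..?n. ?t j) \<le> (\<Sum>j=2..?n. of_nat (?n choose j) * (x ^ (?n - 2) * d\<^sup>2 + d ^ ?n))"
  proof (rule sum_mono)
    fix j assume j: "j \<in> {2..?n}"
    have "d ^ j * x ^ (?n - j) \<le> \<bar>d\<bar> ^ j * \<bar>x\<bar> ^ (?n - j)" by (metis abs_ge_self abs_mult power_abs)
    also have "\<dots> \<le> x ^ (?n - 2) * d\<^sup>2 + d ^ ?n"
      using binomial_higher_term_le[of j ?n d x] j power_even_abs[OF ev, of x] by (simp add: power_even_abs)
    finally show "?t j \<le> of_nat (?n choose j) * (x ^ (?n - 2) * d\<^sup>2 + d ^ ?n)"
      unfolding mult.assoc by (intro mult_left_mono) auto
  qed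
  also have "\<dots> = of_nat (\<Sum>j=2..?n. ?n choose j) * (x ^ (?n - 2) * d\<^sup>2 + d ^ ?n)"
    by (simp add: sum_distrib_right)
  also have "\<dots> \<le> 4 ^ m * (x ^ (?n - 2) * d\<^sup>2 + d ^ ?n)"
  proof (intro mult_right_mono)
    have "(\<Sum>j=2..?n. ?n choose j) \<le> (\<Sum>j\<le>?n. ?n choose j)" by (intro sum_mono2) auto
    also have "\<dots> = 4 ^ m" by (simp add: choose_row_sum power_mult)
    finally show "real (\<Sum>j=2..?n. ?n choose j) \<le> 4 ^ m" by (metis of_nat_le_iff of_nat_numeral of_nat_power)
    show "0 \<le> x ^ (?n - 2) * d\<^sup>2 + d ^ ?n" using zero_le_even_power[OF ev, of x] by simp
  qed
  finally show ?thesis by (simp add: mult_ac)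
qed

text \<open>The leading factor can be brought as close to 1 as desired. A fixed factor larger than 1
  could destroy the contraction \<beta> < 1 of a quantity weighted by a power of S when S is
  advanced by one step.\<close>

lemma even_power_add_le:
  fixes \<eta> :: real
  assumes "\<eta> > 0"
  obtains C where "C \<ge> 0" "\<And>x d :: real. (x + d) ^ (2 * k) \<le> (1 + \<eta>) * x ^ (2 * k) + C * d ^ (2 * k)"
proof -
  have "((\<lambda>\<theta>. (1 + \<theta>) ^ (2 * k)) \<longlongrightarrow> (1 + 0 :: real) ^ (2 * k)) (at_right 0)"
    by (intro tendsto_intros)
  then have "\<forall>\<^sub>F \<theta> in at_right (0::real). (1 + \<theta>) ^ (2 * k) < 1 + \<eta>"
    using assms by (intro order_tendstoD(2)) auto
  moreover have "\<forall>\<^sub>F \<theta> in at_right (0::real). \<theta> > 0" by (rule eventually_at_right_less)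
  ultimately have "\<forall>\<^sub>F \<theta> in at_right (0::real). (1 + \<theta>) ^ (2 * k) < 1 + \<eta> \<and> \<theta> > 0" by eventually_elim auto
  then obtain \<theta> :: real where \<theta>: "\<theta> > 0" "(1 + \<theta>) ^ (2 * k) < 1 + \<eta>" by (auto dest!: eventually_happens)
  have "(x + d) ^ (2 * k) \<le> (1 + \<eta>) * x ^ (2 * k) + (1 + 1 / \<theta>) ^ (2 * k) * d ^ (2 * k)" for x d :: real
  proof (cases "\<bar>d\<bar> \<le> \<theta> * \<bar>x\<bar>")
    case True
    have "(x + d) ^ (2 * k) = \<bar>x + d\<bar> ^ (2 * k)" by (simp add: power_even_abs)
    also have "\<dots> \<le> ((1 + \<theta>) * \<bar>x\<bar>) ^ (2 * k)" using True by (intro power_mono) (auto simp: algebra_simps)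
    also have "\<dots> = (1 + \<theta>) ^ (2 * k) * x ^ (2 * k)" by (simp add: power_mult_distrib power_even_abs)
    also have "\<dots> \<le> (1 + \<eta>) * x ^ (2 * k)" using \<theta> by (intro mult_right_mono) auto
    finally show ?thesis using \<theta> by (simp add: add_increasing2)
  next
    case False
    then have "\<bar>x\<bar> \<le> \<bar>d\<bar> / \<theta>" using \<theta> by (simp add: field_simps)
    have "(x + d) ^ (2 * k) = \<bar>x + d\<bar> ^ (2 * k)" by (simp add: power_even_abs)
    also have "\<dots> \<le> ((1 + 1 / \<theta>) * \<bar>d\<bar>) ^ (2 * k)" using \<open>\<bar>x\<bar> \<le> \<bar>d\<bar> / \<theta>\<close> by (intro power_mono) (auto simp: algebra_simps)
    also have "\<dots> = (1 + 1 / \<theta>) ^ (2 * k) * d ^ (2 * k)" by (simp add: power_mult_distrib power_even_abs)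
    finally show ?thesis using assms by (simp add: add_increasing)
  qed
  then show ?thesis using \<theta> by (intro that[of "(1 + 1 / \<theta>) ^ (2 * k)"]) auto
qed

text \<open>Split at x^2 = N. With N the time horizon, the lower power costs only the fraction 1 / N
  of the higher one.\<close>

lemma even_power_le_next:
  fixes x N :: real
  assumes "N > 0" "m \<ge> 1"
  shows "x ^ (2 * m - 2) \<le> x ^ (2 * m) / N + N ^ (m - 1)"
proof -
  obtain k where m: "m = Suc k" using assms by (cases m) auto
  have "(x\<^sup>2) ^ k \<le> (x\<^sup>2) ^ Suc k / N + N ^ k"
  proof (cases "x\<^sup>2 \<le> N")
    case True
    then have "(x\<^sup>2) ^ k \<le> N ^ k" by (intro power_mono) auto
    then show ?thesis using assms by (simp add: add_increasing)
  next
    case False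
    have "(x\<^sup>2) ^ k * N \<le> (x\<^sup>2) ^ k * x\<^sup>2" using False by (intro mult_left_mono) auto
    then have "(x\<^sup>2) ^ k \<le> (x\<^sup>2) ^ Suc k / N" using assms by (simp add: field_simps)
    then show ?thesis using assms by (simp add: add_increasing2)
  qed
  then show ?thesis by (simp add: m power_mult power2_eq_square power_mult_distrib)
qed

text \<open>A discrete Gronwall bound: N growth factors 1 + \<kappa> / N multiply to at most exp
  \<kappa>.\<close>

lemma perturbed_linear_recursion:
  fixes Z :: "nat \<Rightarrow> real"
  assumes "Z 0 \<le> 0" "\<And>n. n < N \<Longrightarrow> Z (Suc n) \<le> (1 + \<kappa> / N) * Z n + c" "\<kappa> \<ge> 0" "c \<ge> 0"
  shows "Z N \<le> exp \<kappa> * N * c"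
proof (cases "N = 0")
  case False
  define r where "r = 1 + \<kappa> / N"
  have r: "r \<ge> 1" using assms by (simp add: r_def)
  have "n \<le> N \<Longrightarrow> Z n \<le> r ^ n * (n * c)" for n
  proof (induction n)
    case (Suc n)
    have "Z (Suc n) \<le> r * Z n + c" using Suc.prems unfolding r_def by (intro assms(2)) simp
    also have "\<dots> \<le> r * (r ^ n * (n * c)) + r ^ Suc n * c"
      using Suc r assms(4) one_le_power[OF r, of "Suc n"] by (intro add_mono mult_left_mono) (auto simp: mult_le_cancel_right1)
    finally show ?case by (simp add: algebra_simps)
  qed (use assms in simp)
  from this[of N] have "Z N \<le> r ^ N * (N * c)" by simp
  also have "\<dots> \<le> exp \<kappa> * (N * c)"
  proof (rule mult_right_mono)
    have "r ^ N \<le> (exp (\<kappa> / N)) ^ N" using r assms unfolding r_def by (intro power_mono exp_ge_add_one_self) auto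
    also have "\<dots> = exp \<kappa>" using False by (simp add: exp_of_nat_mult[symmetric])
    finally show "r ^ N \<le> exp \<kappa>" .
  qed (use assms in simp)
  finally show ?thesis by simp
qed (use assms in simp)

section \<open>A Rosenthal-type bound for even moments\<close>

context prob_space
begin

lemma integrable_abs_power_mult:
  fixes f g :: "'a \<Rightarrow> real"
  assumes [measurable]: "f \<in> borel_measurable M" "g \<in> borel_measurable M"
    and "integrable M (\<lambda>\<omega>. \<bar>f \<omega>\<bar> ^ (i + j))" "integrable M (\<lambda>\<omega>. \<bar>g \<omega>\<bar> ^ (i + j))"
  shows "integrable M (\<lambda>\<omega>. f \<omega> ^ i * g \<omega> ^ j)"
proof (rule Bochner_Integration.integrable_bound)
  show "integrable M (\<lambda>\<omega>. \<bar>f \<omega>\<bar> ^ (i + j) + \<bar>g \<omega>\<bar> ^ (i + j))" using assms by simp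
  show "AE \<omega> in M. norm (f \<omega> ^ i * g \<omega> ^ j) \<le> norm (\<bar>f \<omega>\<bar> ^ (i + j) + \<bar>g \<omega>\<bar> ^ (i + j))"
    using abs_power_mult_le by (intro AE_I2) (auto simp: abs_mult power_abs)
qed measurable

lemma integrable_partial_sums_even_power:
  fixes S D :: "nat \<Rightarrow> 'a \<Rightarrow> real"
  assumes [measurable]: "\<And>n. S n \<in> borel_measurable M" "\<And>n. D n \<in> borel_measurable M"
    and S: "\<And>\<omega>. S 0 \<omega> = 0" "\<And>n \<omega>. S (Suc n) \<omega> = S n \<omega> + D n \<omega>"
    and D: "\<And>n. integrable M (\<lambda>\<omega>. D n \<omega> ^ (2 * m))"
  shows "integrable M (\<lambda>\<omega>. S n \<omega> ^ (2 * m))"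
proof (induction n)
  case (Suc n)
  obtain C where C: "C \<ge> 0" "\<And>x d :: real. (x + d) ^ (2 * m) \<le> (1 + 1) * x ^ (2 * m) + C * d ^ (2 * m)"
    using even_power_add_le[of 1 m] by auto
  show ?case
  proof (rule Bochner_Integration.integrable_bound)
    show "integrable M (\<lambda>\<omega>. (1 + 1) * S n \<omega> ^ (2 * m) + C * D n \<omega> ^ (2 * m))"
      using Suc D by simp
    show "AE \<omega> in M. norm (S (Suc n) \<omega> ^ (2 * m)) \<le> norm ((1 + 1) * S n \<omega> ^ (2 * m) + C * D n \<omega> ^ (2 * m))"
      using C(2) by (intro AE_I2) (auto simp: S intro: order_trans[OF _ abs_ge_self])
  qed measurable
qed (simp add: S)

text \<open>The function \<open>v n\<close> plays the role of a bound for the conditional variance of \<open>D n\<close>. That it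
  contracts in mean up to a constant replaces, in the weak form of Rosenthal's inequality below,
  bounds for the moments of the sum of the conditional variances.\<close>

definition contracting_martingale ::
    "nat \<Rightarrow> real \<Rightarrow> real \<Rightarrow> real \<Rightarrow> real \<Rightarrow> (nat \<Rightarrow> 'a \<Rightarrow> real) \<Rightarrow> (nat \<Rightarrow> 'a \<Rightarrow> real) \<Rightarrow> (nat \<Rightarrow> 'a \<Rightarrow> real) \<Rightarrow> bool" where
  "contracting_martingale m C \<beta> b W S D v \<longleftrightarrow>
     (\<forall>n. S n \<in> borel_measurable M \<and> D n \<in> borel_measurable M \<and> v n \<in> borel_measurable M) \<and>
     (\<forall>\<omega>. S 0 \<omega> = 0) \<and> (\<forall>n \<omega>. S (Suc n) \<omega> = S n \<omega> + D n \<omega>) \<and> (\<forall>n \<omega>. v n \<omega> \<ge> 0) \<and>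
     (\<forall>n. integrable M (\<lambda>\<omega>. D n \<omega> ^ (2 * m)) \<and> expectation (\<lambda>\<omega>. D n \<omega> ^ (2 * m)) \<le> W) \<and>
     (\<forall>n. expectation (\<lambda>\<omega>. S n \<omega> ^ (2 * m - 1) * D n \<omega>) = 0) \<and>
     (m \<ge> 2 \<longrightarrow> (\<forall>n. integrable M (\<lambda>\<omega>. v n \<omega> ^ m) \<and> expectation (\<lambda>\<omega>. v n \<omega> ^ m) \<le> W \<and>
        expectation (\<lambda>\<omega>. S n \<omega> ^ (2 * m - 2) * (D n \<omega>)\<^sup>2) \<le> C * expectation (\<lambda>\<omega>. S n \<omega> ^ (2 * m - 2) * v n \<omega>) \<and>
        expectation (\<lambda>\<omega>. S n \<omega> ^ (2 * m - 2) * v (Suc n) \<omega>)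
          \<le> expectation (\<lambda>\<omega>. S n \<omega> ^ (2 * m - 2) * (\<beta> * v n \<omega> + b))))"

text \<open>A Lyapunov argument for e n + H * a n, with e n the moment and a n the mean of S n ^ (2
  * m - 2) * v n. The quadratic Taylor term feeds a into e, and the contraction of v leaves room for
  a to pay for this. Q is chosen before S, D, v, W and N, hence uniform in any truncation level
  hidden in them.\<close>

lemma martingale_even_moment:
  fixes m :: nat and C \<beta> b :: real
  assumes m: "m \<ge> 1" and C: "C \<ge> 0" and \<beta>: "0 \<le> \<beta>" "\<beta> < 1" and b: "b \<ge> 0"
  obtains Q where "Q > 0"
    "\<And>S D v W N. contracting_martingale m C \<beta> b W S D v \<Longrightarrow>
      expectation (\<lambda>\<omega>. S N \<omega> ^ (2 * m)) \<le> Q * (real N ^ m + real N * W)"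
proof -
  \<comment> \<open>Half the gap to 1: (1 + \<eta>) * \<beta> < 1 amounts to 0 < (1 - \<beta>) * (2
    - \<beta>).\<close>
  define \<eta> where "\<eta> = (1 - \<beta>) / 2"
  have \<eta>: "\<eta> > 0" using \<beta> by (simp add: \<eta>_def)
  obtain C\<eta> where C\<eta>: "C\<eta> \<ge> 0" "\<And>x d :: real. (x + d) ^ (2 * (m - 1)) \<le> (1 + \<eta>) * x ^ (2 * (m - 1)) + C\<eta> * d ^ (2 * (m - 1))"
    using even_power_add_le[OF \<eta>, of "m - 1"] by blast
  define \<beta>' where "\<beta>' = (1 + \<eta>) * \<beta>"
  have \<beta>': "0 \<le> \<beta>'" "\<beta>' < 1"
  proof -
    have "2 * \<beta>' = 3 * \<beta> - \<beta> * \<beta>" by (simp add: \<beta>'_def \<eta>_def field_simps)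
    moreover have "0 < (1 - \<beta>) * (2 - \<beta>)" using \<beta> by (intro mult_pos_pos) auto
    ultimately show "\<beta>' < 1" by (simp add: algebra_simps)
    show "0 \<le> \<beta>'" using \<beta> \<eta> by (simp add: \<beta>'_def)
  qed
  define c1 :: real where "c1 = 4 ^ m"
  have c1: "c1 \<ge> 1" by (simp add: c1_def)
  \<comment> \<open>The solution of c1 * C + H * \<beta>' = H: what e draws from a, plus what a
    retains, is again H * a n.\<close>
  define H where "H = c1 * C / (1 - \<beta>')"
  have H: "H \<ge> 0" "c1 * C + H * \<beta>' = H"
    using c1 C \<beta>' by (auto simp: H_def field_simps)
  define b' where "b' = (1 + \<eta>) * b"
  have b': "b' \<ge> 0" using b \<eta> by (simp add: b'_def)
  define \<kappa> where "\<kappa> = H * b'"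
  have \<kappa>: "\<kappa> \<ge> 0" using H b' by (simp add: \<kappa>_def)
  define \<kappa>2 where "\<kappa>2 = \<kappa> + c1 + 2 * H * C\<eta>"
  have \<kappa>2: "\<kappa>2 \<ge> 1" "\<kappa>2 \<ge> \<kappa>" using \<kappa> c1 H C\<eta> by (auto simp: \<kappa>2_def intro: add_increasing2)
  define Q where "Q = exp \<kappa> * \<kappa>2"
  have Q: "Q \<ge> 1"
    using \<kappa> \<kappa>2 mult_mono[of 1 "exp \<kappa>" 1 \<kappa>2] by (auto simp: Q_def)
  show thesis
  proof (rule that[of Q])
    show "Q > 0" using Q by simp
    fix S D v :: "nat \<Rightarrow> 'a \<Rightarrow> real" and W :: real and N :: nat
    assume cm: "contracting_martingale m C \<beta> b W S D v"
    then have [measurable]: "\<And>n. S n \<in> borel_measurable M" "\<And>n. D n \<in> borel_measurable M" "\<And>n. v n \<in> borel_measurable M"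
      and S0: "\<And>\<omega>. S 0 \<omega> = 0" and SS: "\<And>n \<omega>. S (Suc n) \<omega> = S n \<omega> + D n \<omega>" and v: "\<And>n \<omega>. v n \<omega> \<ge> 0"
      and Di: "\<And>n. integrable M (\<lambda>\<omega>. D n \<omega> ^ (2 * m))" and DW: "\<And>n. expectation (\<lambda>\<omega>. D n \<omega> ^ (2 * m)) \<le> W"
      and mart: "\<And>n. expectation (\<lambda>\<omega>. S n \<omega> ^ (2 * m - 1) * D n \<omega>) = 0"
      unfolding contracting_martingale_def by blast+
    have Si: "integrable M (\<lambda>\<omega>. S n \<omega> ^ (2 * m))" for n
      by (rule integrable_partial_sums_even_power[OF _ _ S0 SS Di]) measurable
    have ev: "even (2 * m - 2)" by simp
    have abs2m: "\<bar>x\<bar> ^ (2 * m) = x ^ (2 * m)" for x :: real by (simp add: power_even_abs)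
    have i1: "integrable M (\<lambda>\<omega>. S n \<omega> ^ (2 * m - 1) * D n \<omega>)" for n
      using integrable_abs_power_mult[of "S n" "D n" "2 * m - 1" 1] Si[of n] Di[of n] m by (simp add: abs2m)
    have exp_eq: "2 * m - 2 + 2 = 2 * m" using m by simp
    have i2: "integrable M (\<lambda>\<omega>. S n \<omega> ^ (2 * m - 2) * (D n \<omega>)\<^sup>2)" for n
      by (rule integrable_abs_power_mult[of "S n" "D n" "2 * m - 2" 2, unfolded exp_eq abs2m, OF _ _ Si Di]) measurable
    define e where "e n = expectation (\<lambda>\<omega>. S n \<omega> ^ (2 * m))" for n
    have e0: "e n \<ge> 0" for n by (simp add: e_def)
    have e_0: "e 0 = 0" using m by (simp add: e_def S0)
    have W: "W \<ge> 0" using DW[of 0] by (rule order_trans[rotated]) simp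
    have e_step: "e (Suc n) \<le> e n + c1 * (expectation (\<lambda>\<omega>. S n \<omega> ^ (2 * m - 2) * (D n \<omega>)\<^sup>2) + W)" for n
    proof -
      have "e (Suc n) \<le> expectation (\<lambda>\<omega>. S n \<omega> ^ (2 * m) + 2 * m * (S n \<omega> ^ (2 * m - 1) * D n \<omega>)
        + c1 * (S n \<omega> ^ (2 * m - 2) * (D n \<omega>)\<^sup>2 + D n \<omega> ^ (2 * m)))"
        unfolding e_def using Si[of "Suc n"] Si[of n] i1[of n] i2[of n] Di[of n] even_power_taylor[OF m]
        by (intro integral_mono) (auto simp: SS c1_def mult.assoc)
      also have "\<dots> = e n + 2 * m * expectation (\<lambda>\<omega>. S n \<omega> ^ (2 * m - 1) * D n \<omega>)
         + c1 * (expectation (\<lambda>\<omega>. S n \<omega> ^ (2 * m - 2) * (D n \<omega>)\<^sup>2) + expectation (\<lambda>\<omega>. D n \<omega> ^ (2 * m)))"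
        using Si[of n] i1[of n] i2[of n] Di[of n] by (simp add: e_def)
      also have "\<dots> \<le> e n + c1 * (expectation (\<lambda>\<omega>. S n \<omega> ^ (2 * m - 2) * (D n \<omega>)\<^sup>2) + W)"
        using DW[of n] mart[of n] c1 by simp
      finally show ?thesis .
    qed
    \<comment> \<open>For m = 1 the mixed term has mean zero and the second moment is a plain sum;
      this is why the clauses on v are conditional on m >= 2.\<close>
    show "expectation (\<lambda>\<omega>. S N \<omega> ^ (2 * m)) \<le> Q * (real N ^ m + real N * W)"
    proof (cases "m \<ge> 2")
      case False
      then have m1: "m = 1" using m by simp
      have step: "e (Suc n) \<le> e n + W" for n
      proof -
        have "e (Suc n) = expectation (\<lambda>\<omega>. S n \<omega> ^ 2 + 2 * (S n \<omega> * D n \<omega>) + D n \<omega> ^ 2)"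
          by (simp add: e_def m1 SS power2_eq_square algebra_simps)
        also have "\<dots> = e n + 2 * expectation (\<lambda>\<omega>. S n \<omega> * D n \<omega>) + expectation (\<lambda>\<omega>. D n \<omega> ^ 2)"
          using Si[of n] i1[of n] Di[of n] by (simp add: e_def m1)
        also have "\<dots> \<le> e n + W" using mart[of n] DW[of n] by (simp add: m1)
        finally show ?thesis .
      qed
      have "e N \<le> real N * W"
      proof (induction N)
        case (Suc N)
        then show ?case using step[of N] by (simp add: algebra_simps)
      qed (simp add: e_0)
      also have "\<dots> \<le> 1 * (real N ^ m + real N * W)" by simp
      also have "\<dots> \<le> Q * (real N ^ m + real N * W)" using Q W by (intro mult_right_mono) auto
      finally show ?thesis by (simp add: e_def)
    next
      case True
      from cm True have vi: "\<And>n. integrable M (\<lambda>\<omega>. v n \<omega> ^ m)"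
        and vW: "\<And>n. expectation (\<lambda>\<omega>. v n \<omega> ^ m) \<le> W"
        and var: "\<And>n. expectation (\<lambda>\<omega>. S n \<omega> ^ (2 * m - 2) * (D n \<omega>)\<^sup>2) \<le> C * expectation (\<lambda>\<omega>. S n \<omega> ^ (2 * m - 2) * v n \<omega>)"
        and drift: "\<And>n. expectation (\<lambda>\<omega>. S n \<omega> ^ (2 * m - 2) * v (Suc n) \<omega>)
          \<le> expectation (\<lambda>\<omega>. S n \<omega> ^ (2 * m - 2) * (\<beta> * v n \<omega> + b))"
        unfolding contracting_martingale_def by blast+
      have dm: "2 * (m - 1) = 2 * m - 2" by simp
      have mm: "m - 1 + 1 = m" using m by simp
      have pw: "(x\<^sup>2) ^ (m - 1) = x ^ (2 * m - 2)" "(x\<^sup>2) ^ m = x ^ (2 * m)" for x :: real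
        by (simp_all add: power_mult[symmetric] right_diff_distrib')
      have vabs: "\<bar>v n \<omega>\<bar> = v n \<omega>" for n \<omega> using v by simp
      have i3: "integrable M (\<lambda>\<omega>. T \<omega> ^ (2 * m - 2) * v k \<omega>)"
        if [measurable]: "T \<in> borel_measurable M" and T: "integrable M (\<lambda>\<omega>. T \<omega> ^ (2 * m))" for T k
      proof -
        have "integrable M (\<lambda>\<omega>. ((T \<omega>)\<^sup>2) ^ (m - 1) * v k \<omega> ^ 1)"
        proof (rule integrable_abs_power_mult)
          show "integrable M (\<lambda>\<omega>. \<bar>(T \<omega>)\<^sup>2\<bar> ^ (m - 1 + 1))" using T unfolding mm by (simp add: power_mult)
          show "integrable M (\<lambda>\<omega>. \<bar>v k \<omega>\<bar> ^ (m - 1 + 1))" using vi[of k] unfolding mm by (simp add: vabs)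
        qed measurable
        then show ?thesis by (simp only: pw power_one_right)
      qed
      have i4: "integrable M (\<lambda>\<omega>. S n \<omega> ^ (2 * m - 2))" for n
      proof (rule Bochner_Integration.integrable_bound)
        show "integrable M (\<lambda>\<omega>. S n \<omega> ^ (2 * m) / 1 + 1 ^ (m - 1))" using Si[of n] by simp
        show "AE \<omega> in M. norm (S n \<omega> ^ (2 * m - 2)) \<le> norm (S n \<omega> ^ (2 * m) / 1 + 1 ^ (m - 1))"
        proof (rule AE_I2)
          fix \<omega>
          have "0 \<le> S n \<omega> ^ (2 * m - 2)" by (rule zero_le_even_power[OF ev])
          moreover have "S n \<omega> ^ (2 * m - 2) \<le> S n \<omega> ^ (2 * m) / 1 + 1 ^ (m - 1)"
            by (rule even_power_le_next) (use m in auto)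
          ultimately show "norm (S n \<omega> ^ (2 * m - 2)) \<le> norm (S n \<omega> ^ (2 * m) / 1 + 1 ^ (m - 1))"
            by (simp only: real_norm_def)
        qed
      qed measurable
      define a where "a n = expectation (\<lambda>\<omega>. S n \<omega> ^ (2 * m - 2) * v n \<omega>)" for n
      have a0: "a n \<ge> 0" for n
        unfolding a_def by (intro integral_nonneg_AE AE_I2 mult_nonneg_nonneg v zero_le_even_power[OF ev])
      have a_0: "a 0 = 0" using True by (simp add: a_def S0)
      \<comment> \<open>The horizon N is fixed throughout the recursion. Comparing the power 2m - 2
        with 2m at scale N adds a growth rate \<kappa> / N per step, harmless over N steps, and a
        source N ^ (m - 1), which sums to N ^ m.\<close>
      have "e N + H * a N \<le> exp \<kappa> * N * (\<kappa>2 * (real N ^ (m - 1) + W))"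
      proof (rule perturbed_linear_recursion)
        fix n assume "n < N"
        then have N: "real N > 0" by simp
        have p: "expectation (\<lambda>\<omega>. S n \<omega> ^ (2 * m - 2)) \<le> e n / N + real N ^ (m - 1)"
        proof -
          have "expectation (\<lambda>\<omega>. S n \<omega> ^ (2 * m - 2)) \<le> expectation (\<lambda>\<omega>. S n \<omega> ^ (2 * m) / N + real N ^ (m - 1))"
            using i4[of n] Si[of n] even_power_le_next[OF N m] by (intro integral_mono) auto
          also have "\<dots> = e n / N + real N ^ (m - 1)" using Si[of n] by (simp add: e_def prob_space)
          finally show ?thesis .
        qed
        have dv: "expectation (\<lambda>\<omega>. D n \<omega> ^ (2 * m - 2) * v (Suc n) \<omega>) \<le> 2 * W"
        proof -
          have pt: "D n \<omega> ^ (2 * m - 2) * v (Suc n) \<omega> \<le> D n \<omega> ^ (2 * m) + v (Suc n) \<omega> ^ m" for \<omega>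
            using abs_power_mult_le[of "(D n \<omega>)\<^sup>2" "m - 1" "v (Suc n) \<omega>" 1]
            unfolding mm by (simp only: pw power_one_right abs_power2 vabs)
          have "expectation (\<lambda>\<omega>. D n \<omega> ^ (2 * m - 2) * v (Suc n) \<omega>) \<le> expectation (\<lambda>\<omega>. D n \<omega> ^ (2 * m) + v (Suc n) \<omega> ^ m)"
            using i3[of "D n" "Suc n"] Di vi by (intro integral_mono pt) auto
          also have "\<dots> \<le> 2 * W" using Di[of n] vi[of "Suc n"] DW[of n] vW[of "Suc n"] by simp
          finally show ?thesis .
        qed
        have s1: "a (Suc n) \<le> (1 + \<eta>) * expectation (\<lambda>\<omega>. S n \<omega> ^ (2 * m - 2) * v (Suc n) \<omega>)
            + C\<eta> * expectation (\<lambda>\<omega>. D n \<omega> ^ (2 * m - 2) * v (Suc n) \<omega>)"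
        proof -
          have pt: "S (Suc n) \<omega> ^ (2 * m - 2) * v (Suc n) \<omega>
             \<le> (1 + \<eta>) * (S n \<omega> ^ (2 * m - 2) * v (Suc n) \<omega>) + C\<eta> * (D n \<omega> ^ (2 * m - 2) * v (Suc n) \<omega>)" for \<omega>
            using mult_right_mono[OF C\<eta>(2)[of "S n \<omega>" "D n \<omega>", unfolded dm] v[of "Suc n" \<omega>]]
            by (simp only: SS distrib_right mult.assoc)
          have "a (Suc n) \<le> expectation (\<lambda>\<omega>. (1 + \<eta>) * (S n \<omega> ^ (2 * m - 2) * v (Suc n) \<omega>) + C\<eta> * (D n \<omega> ^ (2 * m - 2) * v (Suc n) \<omega>))"
            unfolding a_def using i3[of "S (Suc n)" "Suc n"] i3[of "S n" "Suc n"] i3[of "D n" "Suc n"] Si Di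
            by (intro integral_mono pt) auto
          also have "\<dots> = (1 + \<eta>) * expectation (\<lambda>\<omega>. S n \<omega> ^ (2 * m - 2) * v (Suc n) \<omega>)
            + C\<eta> * expectation (\<lambda>\<omega>. D n \<omega> ^ (2 * m - 2) * v (Suc n) \<omega>)"
            using i3[of "S n" "Suc n"] i3[of "D n" "Suc n"] Si Di by simp
          finally show ?thesis .
        qed
        have s2: "expectation (\<lambda>\<omega>. S n \<omega> ^ (2 * m - 2) * v (Suc n) \<omega>) \<le> \<beta> * a n + b * (e n / N + real N ^ (m - 1))"
        proof -
          have "expectation (\<lambda>\<omega>. S n \<omega> ^ (2 * m - 2) * v (Suc n) \<omega>)
             \<le> expectation (\<lambda>\<omega>. \<beta> * (S n \<omega> ^ (2 * m - 2) * v n \<omega>) + b * S n \<omega> ^ (2 * m - 2))"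
            using drift[of n] by (simp add: algebra_simps)
          also have "\<dots> = \<beta> * a n + b * expectation (\<lambda>\<omega>. S n \<omega> ^ (2 * m - 2))"
            using i3[of "S n" n] i4[of n] Si by (simp add: a_def)
          also have "\<dots> \<le> \<beta> * a n + b * (e n / N + real N ^ (m - 1))"
            using p b by (intro add_left_mono mult_left_mono)
          finally show ?thesis .
        qed
        have "(1 + \<eta>) * expectation (\<lambda>\<omega>. S n \<omega> ^ (2 * m - 2) * v (Suc n) \<omega>)
           \<le> (1 + \<eta>) * (\<beta> * a n + b * (e n / N + real N ^ (m - 1)))"
          using \<eta> by (intro mult_left_mono s2) auto
        moreover have "C\<eta> * expectation (\<lambda>\<omega>. D n \<omega> ^ (2 * m - 2) * v (Suc n) \<omega>) \<le> C\<eta> * (2 * W)"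
          using C\<eta>(1) by (intro mult_left_mono dv) auto
        ultimately have "a (Suc n) \<le> (1 + \<eta>) * (\<beta> * a n + b * (e n / N + real N ^ (m - 1))) + C\<eta> * (2 * W)"
          using s1 by linarith
        then have a_step: "a (Suc n) \<le> \<beta>' * a n + b' * (e n / N + real N ^ (m - 1)) + C\<eta> * (2 * W)"
          by (simp add: \<beta>'_def b'_def algebra_simps)
        have "e (Suc n) + H * a (Suc n) \<le> (e n + c1 * (C * a n + W)) + H * (\<beta>' * a n + b' * (e n / N + real N ^ (m - 1)) + C\<eta> * (2 * W))"
        proof (intro add_mono mult_left_mono a_step H(1))
          have "c1 * (expectation (\<lambda>\<omega>. S n \<omega> ^ (2 * m - 2) * (D n \<omega>)\<^sup>2) + W) \<le> c1 * (C * a n + W)"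
            using var[of n] c1 unfolding a_def by (intro mult_left_mono add_right_mono) auto
          then show "e (Suc n) \<le> e n + c1 * (C * a n + W)" using e_step[of n] by linarith
        qed
        also have "\<dots> = e n + (c1 * C + H * \<beta>') * a n + \<kappa> / N * e n + \<kappa> * real N ^ (m - 1) + (c1 + 2 * H * C\<eta>) * W"
          by (simp add: \<kappa>_def algebra_simps)
        also have "\<dots> = e n + H * a n + \<kappa> / N * e n + \<kappa> * real N ^ (m - 1) + (c1 + 2 * H * C\<eta>) * W"
          by (simp only: H(2))
        also have "\<dots> \<le> e n + H * a n + \<kappa> / N * (e n + H * a n) + \<kappa>2 * real N ^ (m - 1) + \<kappa>2 * W"
          using \<kappa> \<kappa>2 H a0[of n] W N by (intro add_mono mult_left_mono mult_right_mono order_refl) (auto simp: \<kappa>2_def)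
        finally show "e (Suc n) + H * a (Suc n) \<le> (1 + \<kappa> / N) * (e n + H * a n) + \<kappa>2 * (real N ^ (m - 1) + W)"
          by (simp add: algebra_simps)
      qed (use e_0 a_0 \<kappa> \<kappa>2 W in auto)
      moreover have "e N \<le> e N + H * a N" using H a0 by simp
      moreover have "exp \<kappa> * N * (\<kappa>2 * (real N ^ (m - 1) + W)) = Q * (real N ^ m + real N * W)"
        using m by (cases m) (simp_all add: Q_def algebra_simps)
      ultimately show ?thesis unfolding e_def by linarith
    qed
  qed
qed

end

section \<open>Additive functionals of a chain with an atom\<close>

locale stationary_chain = prob_space M for M :: "'w measure" +
  fixes E :: "'e measure" and K :: "'e \<Rightarrow> 'e measure" and \<Phi> :: "int \<Rightarrow> 'w \<Rightarrow> 'e"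
  assumes chain: "markov_chain M E K \<Phi>" and stat: "stationary M E \<Phi>"
begin

abbreviation "past t \<equiv> past_algebra M E \<Phi> t"

lemma \<Phi>_meas [measurable]: "\<Phi> t \<in> M \<rightarrow>\<^sub>M E"
  using chain by (simp add: markov_chain_def)

lemma \<Phi>_space: "\<omega> \<in> space M \<Longrightarrow> \<Phi> t \<omega> \<in> space E"
  by (rule measurable_space[OF \<Phi>_meas])

lemma K_meas [measurable]: "K \<in> E \<rightarrow>\<^sub>M subprob_algebra E"
  using chain by (auto simp: markov_chain_def intro: measurable_prob_algebraD)

lemma K_prob: "y \<in> space E \<Longrightarrow> prob_space (K y)"
  using chain measurable_space[of K E "prob_algebra E" y] by (simp add: markov_chain_def space_prob_algebra)

lemma sets_K: "y \<in> space E \<Longrightarrow> sets (K y) = sets E"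
  using subprob_measurableD(2)[OF K_meas] .

lemma space_K: "y \<in> space E \<Longrightarrow> space (K y) = space E"
  using sets_eq_imp_space_eq[OF sets_K] .

lemma measurable_K: "y \<in> space E \<Longrightarrow> f \<in> E \<rightarrow>\<^sub>M N \<Longrightarrow> f \<in> K y \<rightarrow>\<^sub>M N"
  using measurable_cong_sets[OF sets_K refl] by blast

lemma kernel_integral_meas [measurable]:
  "u \<in> borel_measurable E \<Longrightarrow> (\<lambda>y. \<integral>\<^sup>+z. u z \<partial>K y) \<in> borel_measurable E"
  using measurable_compose[OF K_meas nn_integral_measurable_subprob_algebra] by simp

lemma path_meas: "(\<lambda>\<omega>. \<lambda>s\<in>{..t}. \<Phi> s \<omega>) \<in> M \<rightarrow>\<^sub>M PiM {..t} (\<lambda>_. E)"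
  by measurable

lemma subalgebra_past: "subalgebra M (past t)"
  unfolding subalgebra_def past_algebra_def
  using sets_image_in_sets[OF refl path_meas] by simp

lemma \<Phi>_past: "s \<le> t \<Longrightarrow> \<Phi> s \<in> past t \<rightarrow>\<^sub>M E"
proof -
  assume "s \<le> t"
  have "(\<lambda>\<omega>. \<lambda>s\<in>{..t}. \<Phi> s \<omega>) \<in> past t \<rightarrow>\<^sub>M PiM {..t} (\<lambda>_. E)"
    unfolding past_algebra_def using measurable_space[OF path_meas] by (intro measurable_vimage_algebra1) auto
  from measurable_compose[OF this measurable_component_singleton[of s "{..t}"]] \<open>s \<le> t\<close>
  show ?thesis by simp
qed

lemma past_meas: "Z \<in> past t \<rightarrow>\<^sub>M N \<Longrightarrow> Z \<in> M \<rightarrow>\<^sub>M N"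
  by (rule measurable_from_subalg[OF subalgebra_past])

lemma sigma_finite_past: "sigma_finite_subalgebra M (past t)"
proof -
  interpret finite_measure_subalgebra M "past t"
    by standard (rule subalgebra_past)
  show ?thesis by standard
qed

text \<open>The chain is specified by real conditional expectations of indicators, while the
  extension to general functions runs through nonnegative integrals. Both notions are determined by
  integrals over sets of the past, where the integrands are bounded by 1.\<close>

lemma kernel_eq_nn_cond_exp:
  assumes [measurable]: "B \<in> sets E"
  shows "AE \<omega> in M. emeasure (K (\<Phi> t \<omega>)) B = nn_cond_exp M (past t) (indicator (\<Phi> (t + 1) -` B \<inter> space M)) \<omega>"
proof -
  interpret sigma_finite_subalgebra M "past t" by (rule sigma_finite_past)
  let ?B = "\<Phi> (t + 1) -` B \<inter> space M"
  have [measurable]: "?B \<in> sets M" by measurable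
  have i: "integrable M (indicat_real ?B)" by (intro integrable_real_indicator) (auto simp: emeasure_eq_measure)
  have c: "AE \<omega> in M. real_cond_exp M (past t) (indicator ?B) \<omega> = measure (K (\<Phi> t \<omega>)) B"
    using chain by (simp add: markov_chain_def)
  have [measurable]: "(\<lambda>\<omega>. emeasure (K (\<Phi> t \<omega>)) B) \<in> borel_measurable (past t)"
    using measurable_compose[OF \<Phi>_past[OF order_refl, of t] measurable_compose[OF K_meas measurable_emeasure_subprob_algebra[OF assms]]] by simp
  show ?thesis
  proof (rule nn_cond_exp_charact)
    fix A assume A: "A \<in> sets (past t)"
    then have [measurable]: "A \<in> sets M" using subalgebra_past by (auto simp: subalgebra_def)
    have "(\<integral>\<omega>\<in>A. indicat_real ?B \<omega> \<partial>M) = (\<integral>\<omega>\<in>A. real_cond_exp M (past t) (indicator ?B) \<omega> \<partial>M)"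
      by (rule real_cond_exp_intA[OF i A])
    also have "\<dots> = (\<integral>\<omega>\<in>A. measure (K (\<Phi> t \<omega>)) B \<partial>M)"
      unfolding set_lebesgue_integral_def
    proof (rule integral_cong_AE)
      have "(\<lambda>\<omega>. measure (K (\<Phi> t \<omega>)) B) \<in> borel_measurable M" unfolding measure_def by measurable
      then show "(\<lambda>x. indicat_real A x *\<^sub>R measure (K (\<Phi> t x)) B) \<in> borel_measurable M" by measurable
    qed (use c in \<open>auto intro: borel_measurable_cond_exp2\<close>)
    finally have eq: "(\<integral>\<omega>\<in>A. indicat_real ?B \<omega> \<partial>M) = (\<integral>\<omega>\<in>A. measure (K (\<Phi> t \<omega>)) B \<partial>M)" .
    have mK: "(\<lambda>\<omega>. measure (K (\<Phi> t \<omega>)) B) \<in> borel_measurable M" unfolding measure_def by measurable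
    have m1: "measure (K (\<Phi> t \<omega>)) B \<le> 1" if "\<omega> \<in> space M" for \<omega>
      using prob_space.prob_le_1[OF K_prob[OF \<Phi>_space[OF that]]] .
    have "(\<integral>\<^sup>+\<omega>\<in>A. indicator ?B \<omega> \<partial>M) = (\<integral>\<^sup>+\<omega>. ennreal (indicator A \<omega> * indicat_real ?B \<omega>) \<partial>M)"
      by (intro nn_integral_cong) (auto split: split_indicator)
    also have "\<dots> = ennreal (\<integral>\<omega>\<in>A. indicat_real ?B \<omega> \<partial>M)"
      unfolding set_lebesgue_integral_def using i
      by (subst nn_integral_eq_integral) (auto intro: integrable_mult_indicator[where 'b = real, simplified])
    also have "\<dots> = (\<integral>\<^sup>+\<omega>. ennreal (indicator A \<omega> * measure (K (\<Phi> t \<omega>)) B) \<partial>M)"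
      unfolding eq unfolding set_lebesgue_integral_def
    proof (subst nn_integral_eq_integral)
      show "integrable M (\<lambda>\<omega>. indicat_real A \<omega> * measure (K (\<Phi> t \<omega>)) B)"
        by (rule integrable_const_bound[of _ 1]) (use m1 mK in \<open>auto intro!: AE_I2 split: split_indicator\<close>)
    qed auto
    also have "\<dots> = (\<integral>\<^sup>+\<omega>\<in>A. emeasure (K (\<Phi> t \<omega>)) B \<partial>M)"
    proof (rule nn_integral_cong)
      fix \<omega> assume "\<omega> \<in> space M"
      then interpret P: prob_space "K (\<Phi> t \<omega>)" by (intro K_prob \<Phi>_space)
      show "ennreal (indicator A \<omega> * measure (K (\<Phi> t \<omega>)) B) = emeasure (K (\<Phi> t \<omega>)) B * indicator A \<omega>"
        by (simp add: P.emeasure_eq_measure split: split_indicator)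
    qed
    finally show "(\<integral>\<^sup>+\<omega>\<in>A. indicator ?B \<omega> \<partial>M) = (\<integral>\<^sup>+\<omega>\<in>A. emeasure (K (\<Phi> t \<omega>)) B \<partial>M)" .
  qed measurable
qed

text \<open>Monotone class induction on u. Carrying a weight Z from the past replaces conditioning
  and asks for no integrability.\<close>

lemma markov_nn_integral:
  assumes u: "u \<in> borel_measurable E" and Z: "Z \<in> borel_measurable (past t)"
  shows "(\<integral>\<^sup>+\<omega>. Z \<omega> * u (\<Phi> (t + 1) \<omega>) \<partial>M) = (\<integral>\<^sup>+\<omega>. Z \<omega> * (\<integral>\<^sup>+z. u z \<partial>K (\<Phi> t \<omega>)) \<partial>M)"
proof -
  interpret sigma_finite_subalgebra M "past t" by (rule sigma_finite_past)
  have Z'[measurable]: "Z \<in> borel_measurable M" by (rule past_meas[OF Z])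
  from u show ?thesis
  proof (induct rule: borel_measurable_induct)
    case (cong f g)
    have "(\<integral>\<^sup>+\<omega>. Z \<omega> * f (\<Phi> (t + 1) \<omega>) \<partial>M) = (\<integral>\<^sup>+\<omega>. Z \<omega> * g (\<Phi> (t + 1) \<omega>) \<partial>M)"
      using cong(3) \<Phi>_space by (intro nn_integral_cong) auto
    moreover have "(\<integral>\<^sup>+\<omega>. Z \<omega> * (\<integral>\<^sup>+z. f z \<partial>K (\<Phi> t \<omega>)) \<partial>M) = (\<integral>\<^sup>+\<omega>. Z \<omega> * (\<integral>\<^sup>+z. g z \<partial>K (\<Phi> t \<omega>)) \<partial>M)"
      using cong(3) \<Phi>_space space_K by (intro nn_integral_cong arg_cong2[where f = "(*)"] refl) auto
    ultimately show ?case using cong by simp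
  next
    case (set B)
    let ?B = "\<Phi> (t + 1) -` B \<inter> space M"
    have [measurable]: "B \<in> sets E" "?B \<in> sets M" using set by measurable
    have "(\<integral>\<^sup>+\<omega>. Z \<omega> * indicator B (\<Phi> (t + 1) \<omega>) \<partial>M) = (\<integral>\<^sup>+\<omega>. Z \<omega> * indicator ?B \<omega> \<partial>M)"
      by (intro nn_integral_cong) (auto split: split_indicator)
    also have "\<dots> = (\<integral>\<^sup>+\<omega>. Z \<omega> * nn_cond_exp M (past t) (indicator ?B) \<omega> \<partial>M)"
      by (rule nn_cond_exp_intg[OF Z, symmetric]) measurable
    also have "\<dots> = (\<integral>\<^sup>+\<omega>. Z \<omega> * emeasure (K (\<Phi> t \<omega>)) B \<partial>M)"
      using kernel_eq_nn_cond_exp[OF set, of t] by (intro nn_integral_cong_AE) auto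
    also have "\<dots> = (\<integral>\<^sup>+\<omega>. Z \<omega> * (\<integral>\<^sup>+z. indicator B z \<partial>K (\<Phi> t \<omega>)) \<partial>M)"
      using set sets_K \<Phi>_space by (intro nn_integral_cong) (auto intro!: arg_cong2[where f = "(*)"])
    finally show ?case .
  next
    case (mult v c)
    note [measurable] = mult(2)
    have "(\<integral>\<^sup>+\<omega>. Z \<omega> * (c * v (\<Phi> (t + 1) \<omega>)) \<partial>M) = c * (\<integral>\<^sup>+\<omega>. Z \<omega> * v (\<Phi> (t + 1) \<omega>) \<partial>M)"
      by (subst nn_integral_cmult[symmetric]) (auto simp: mult_ac)
    also have "\<dots> = c * (\<integral>\<^sup>+\<omega>. Z \<omega> * (\<integral>\<^sup>+z. v z \<partial>K (\<Phi> t \<omega>)) \<partial>M)" by (simp only: mult)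
    also have "\<dots> = (\<integral>\<^sup>+\<omega>. Z \<omega> * (c * (\<integral>\<^sup>+z. v z \<partial>K (\<Phi> t \<omega>))) \<partial>M)"
      by (subst nn_integral_cmult[symmetric]) (auto simp: mult_ac)
    also have "\<dots> = (\<integral>\<^sup>+\<omega>. Z \<omega> * (\<integral>\<^sup>+z. c * v z \<partial>K (\<Phi> t \<omega>)) \<partial>M)"
      by (intro nn_integral_cong) (simp add: nn_integral_cmult measurable_K[OF \<Phi>_space mult(2)])
    finally show ?case .
  next
    case (add v w)
    note [measurable] = add(1,4)
    have "(\<integral>\<^sup>+\<omega>. Z \<omega> * (w (\<Phi> (t + 1) \<omega>) + v (\<Phi> (t + 1) \<omega>)) \<partial>M)
        = (\<integral>\<^sup>+\<omega>. Z \<omega> * w (\<Phi> (t + 1) \<omega>) \<partial>M) + (\<integral>\<^sup>+\<omega>. Z \<omega> * v (\<Phi> (t + 1) \<omega>) \<partial>M)"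
      by (subst nn_integral_add[symmetric]) (auto simp: distrib_left)
    also have "\<dots> = (\<integral>\<^sup>+\<omega>. Z \<omega> * (\<integral>\<^sup>+z. w z \<partial>K (\<Phi> t \<omega>)) \<partial>M) + (\<integral>\<^sup>+\<omega>. Z \<omega> * (\<integral>\<^sup>+z. v z \<partial>K (\<Phi> t \<omega>)) \<partial>M)"
      by (simp only: add)
    also have "\<dots> = (\<integral>\<^sup>+\<omega>. Z \<omega> * ((\<integral>\<^sup>+z. w z \<partial>K (\<Phi> t \<omega>)) + (\<integral>\<^sup>+z. v z \<partial>K (\<Phi> t \<omega>))) \<partial>M)"
      by (subst nn_integral_add[symmetric]) (auto simp: distrib_left)
    also have "\<dots> = (\<integral>\<^sup>+\<omega>. Z \<omega> * (\<integral>\<^sup>+z. w z + v z \<partial>K (\<Phi> t \<omega>)) \<partial>M)"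
      by (intro nn_integral_cong) (simp add: nn_integral_add measurable_K[OF \<Phi>_space add(1)] measurable_K[OF \<Phi>_space add(4)])
    finally show ?case by (simp add: add.commute)
  next
    case (seq U)
    note [measurable] = seq(1)
    have inc: "incseq (\<lambda>i \<omega>. Z \<omega> * U i (\<Phi> (t + 1) \<omega>))" "incseq (\<lambda>i \<omega>. Z \<omega> * (\<integral>\<^sup>+z. U i z \<partial>K (\<Phi> t \<omega>)))"
      using seq(4) by (auto simp: incseq_def le_fun_def intro!: mult_left_mono nn_integral_mono)
    have "(\<integral>\<^sup>+\<omega>. Z \<omega> * (SUP i. U i) (\<Phi> (t + 1) \<omega>) \<partial>M) = (\<integral>\<^sup>+\<omega>. (SUP i. Z \<omega> * U i (\<Phi> (t + 1) \<omega>)) \<partial>M)"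
      by (intro nn_integral_cong) (simp add: SUP_mult_left_ennreal image_comp)
    also have "\<dots> = (SUP i. \<integral>\<^sup>+\<omega>. Z \<omega> * U i (\<Phi> (t + 1) \<omega>) \<partial>M)"
      using inc(1) by (intro nn_integral_monotone_convergence_SUP) auto
    also have "\<dots> = (SUP i. \<integral>\<^sup>+\<omega>. Z \<omega> * (\<integral>\<^sup>+z. U i z \<partial>K (\<Phi> t \<omega>)) \<partial>M)"
      by (simp only: seq)
    also have "\<dots> = (\<integral>\<^sup>+\<omega>. (SUP i. Z \<omega> * (\<integral>\<^sup>+z. U i z \<partial>K (\<Phi> t \<omega>))) \<partial>M)"
      using inc(2) by (intro nn_integral_monotone_convergence_SUP[symmetric]) auto
    also have "\<dots> = (\<integral>\<^sup>+\<omega>. Z \<omega> * (\<integral>\<^sup>+z. (SUP i. U i) z \<partial>K (\<Phi> t \<omega>)) \<partial>M)"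
    proof (intro nn_integral_cong)
      fix \<omega> assume \<omega>: "\<omega> \<in> space M"
      have "(\<integral>\<^sup>+z. (SUP i. U i z) \<partial>K (\<Phi> t \<omega>)) = (SUP i. \<integral>\<^sup>+z. U i z \<partial>K (\<Phi> t \<omega>))"
        using seq(4) measurable_K[OF \<Phi>_space[OF \<omega>] seq(1)] by (intro nn_integral_monotone_convergence_SUP) auto
      then show "(SUP i. Z \<omega> * (\<integral>\<^sup>+z. U i z \<partial>K (\<Phi> t \<omega>))) = Z \<omega> * (\<integral>\<^sup>+z. (SUP i. U i) z \<partial>K (\<Phi> t \<omega>))"
        by (simp add: SUP_mult_left_ennreal image_comp)
    qed
    finally show ?case .
  qed
qed

text \<open>The inequality asks for integrability on the right because a divergent Bochner integral
  has the value 0. In the equality both sides come from the same nonnegative integral, so the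
  convention is consistent.\<close>

lemma markov_integral_nonneg:
  fixes Z :: "'w \<Rightarrow> real" and u g :: "'e \<Rightarrow> real"
  assumes Z: "Z \<in> borel_measurable (past t)" "\<And>\<omega>. Z \<omega> \<ge> 0"
    and u[measurable]: "u \<in> borel_measurable E" and u0: "\<And>y. u y \<ge> 0"
    and g[measurable]: "g \<in> borel_measurable E" and g0: "\<And>y. g y \<ge> 0"
  shows "(\<And>y. y \<in> space E \<Longrightarrow> (\<integral>\<^sup>+z. ennreal (u z) \<partial>K y) \<le> ennreal (g y)) \<Longrightarrow> integrable M (\<lambda>\<omega>. Z \<omega> * g (\<Phi> t \<omega>))
     \<Longrightarrow> (\<integral>\<omega>. Z \<omega> * u (\<Phi> (t + 1) \<omega>) \<partial>M) \<le> (\<integral>\<omega>. Z \<omega> * g (\<Phi> t \<omega>) \<partial>M)"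
    and "(\<And>y. y \<in> space E \<Longrightarrow> (\<integral>\<^sup>+z. ennreal (u z) \<partial>K y) = ennreal (g y))
     \<Longrightarrow> (\<integral>\<omega>. Z \<omega> * u (\<Phi> (t + 1) \<omega>) \<partial>M) = (\<integral>\<omega>. Z \<omega> * g (\<Phi> t \<omega>) \<partial>M)"
proof -
  have Z'[measurable]: "Z \<in> borel_measurable M" by (rule past_meas[OF Z(1)])
  have "(\<integral>\<^sup>+\<omega>. ennreal (Z \<omega> * u (\<Phi> (t + 1) \<omega>)) \<partial>M) = (\<integral>\<^sup>+\<omega>. ennreal (Z \<omega>) * ennreal (u (\<Phi> (t + 1) \<omega>)) \<partial>M)"
    using Z(2) u0 by (simp add: ennreal_mult)
  also have "\<dots> = (\<integral>\<^sup>+\<omega>. ennreal (Z \<omega>) * (\<integral>\<^sup>+z. ennreal (u z) \<partial>K (\<Phi> t \<omega>)) \<partial>M)"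
    by (rule markov_nn_integral[OF _ measurable_compose[OF Z(1) measurable_ennreal]]) measurable
  finally have *: "(\<integral>\<^sup>+\<omega>. ennreal (Z \<omega> * u (\<Phi> (t + 1) \<omega>)) \<partial>M) = (\<integral>\<^sup>+\<omega>. ennreal (Z \<omega>) * (\<integral>\<^sup>+z. ennreal (u z) \<partial>K (\<Phi> t \<omega>)) \<partial>M)" .
  have int_u: "(\<integral>\<omega>. Z \<omega> * u (\<Phi> (t + 1) \<omega>) \<partial>M) = enn2real (\<integral>\<^sup>+\<omega>. ennreal (Z \<omega> * u (\<Phi> (t + 1) \<omega>)) \<partial>M)"
    using Z(2) u0 by (intro integral_eq_nn_integral) auto
  have int_g: "(\<integral>\<omega>. Z \<omega> * g (\<Phi> t \<omega>) \<partial>M) = enn2real (\<integral>\<^sup>+\<omega>. ennreal (Z \<omega> * g (\<Phi> t \<omega>)) \<partial>M)"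
    using Z(2) g0 by (intro integral_eq_nn_integral) auto
  {
    assume le: "\<And>y. y \<in> space E \<Longrightarrow> (\<integral>\<^sup>+z. ennreal (u z) \<partial>K y) \<le> ennreal (g y)" and i: "integrable M (\<lambda>\<omega>. Z \<omega> * g (\<Phi> t \<omega>))"
    have "(\<integral>\<^sup>+\<omega>. ennreal (Z \<omega> * u (\<Phi> (t + 1) \<omega>)) \<partial>M) \<le> (\<integral>\<^sup>+\<omega>. ennreal (Z \<omega> * g (\<Phi> t \<omega>)) \<partial>M)"
      unfolding * using Z(2) g0 le \<Phi>_space by (intro nn_integral_mono) (auto simp: ennreal_mult intro!: mult_left_mono)
    moreover have "(\<integral>\<^sup>+\<omega>. ennreal (Z \<omega> * g (\<Phi> t \<omega>)) \<partial>M) < top"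
      using nn_integral_eq_integral[OF i] Z(2) g0 by simp
    ultimately show "(\<integral>\<omega>. Z \<omega> * u (\<Phi> (t + 1) \<omega>) \<partial>M) \<le> (\<integral>\<omega>. Z \<omega> * g (\<Phi> t \<omega>) \<partial>M)"
      unfolding int_u int_g by (intro enn2real_mono)
  next
    assume eq: "\<And>y. y \<in> space E \<Longrightarrow> (\<integral>\<^sup>+z. ennreal (u z) \<partial>K y) = ennreal (g y)"
    have "(\<integral>\<^sup>+\<omega>. ennreal (Z \<omega> * u (\<Phi> (t + 1) \<omega>)) \<partial>M) = (\<integral>\<^sup>+\<omega>. ennreal (Z \<omega> * g (\<Phi> t \<omega>)) \<partial>M)"
      unfolding * using Z(2) g0 eq \<Phi>_space by (intro nn_integral_cong) (auto simp: ennreal_mult)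
    then show "(\<integral>\<omega>. Z \<omega> * u (\<Phi> (t + 1) \<omega>) \<partial>M) = (\<integral>\<omega>. Z \<omega> * g (\<Phi> t \<omega>) \<partial>M)"
      unfolding int_u int_g by simp
  }
qed

text \<open>Here Z may change sign, as the odd power of the martingale does; its positive and
  negative parts are treated separately.\<close>

lemma markov_integral:
  fixes Z :: "'w \<Rightarrow> real" and u g :: "'e \<Rightarrow> real"
  assumes Z: "Z \<in> borel_measurable (past t)"
    and u[measurable]: "u \<in> borel_measurable E" and u0: "\<And>y. u y \<ge> 0"
    and g[measurable]: "g \<in> borel_measurable E" and g0: "\<And>y. g y \<ge> 0"
    and eq: "\<And>y. y \<in> space E \<Longrightarrow> (\<integral>\<^sup>+z. ennreal (u z) \<partial>K y) = ennreal (g y)"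
    and iu: "integrable M (\<lambda>\<omega>. Z \<omega> * u (\<Phi> (t + 1) \<omega>))" and ig: "integrable M (\<lambda>\<omega>. Z \<omega> * g (\<Phi> t \<omega>))"
  shows "(\<integral>\<omega>. Z \<omega> * u (\<Phi> (t + 1) \<omega>) \<partial>M) = (\<integral>\<omega>. Z \<omega> * g (\<Phi> t \<omega>) \<partial>M)"
proof -
  have Z'[measurable]: "Z \<in> borel_measurable M" by (rule past_meas[OF Z])
  have dec: "(\<integral>\<omega>. Z \<omega> * Y \<omega> \<partial>M) = (\<integral>\<omega>. max 0 (Z \<omega>) * Y \<omega> \<partial>M) - (\<integral>\<omega>. max 0 (- Z \<omega>) * Y \<omega> \<partial>M)"
    if i: "integrable M (\<lambda>\<omega>. Z \<omega> * Y \<omega>)" and [measurable]: "Y \<in> borel_measurable M" for Y :: "'w \<Rightarrow> real"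
  proof -
    have "integrable M (\<lambda>\<omega>. max 0 (Z \<omega>) * Y \<omega>)" "integrable M (\<lambda>\<omega>. max 0 (- Z \<omega>) * Y \<omega>)"
      by (rule Bochner_Integration.integrable_bound[OF i]; auto simp: max_def)+
    then have "(\<integral>\<omega>. max 0 (Z \<omega>) * Y \<omega> \<partial>M) - (\<integral>\<omega>. max 0 (- Z \<omega>) * Y \<omega> \<partial>M)
      = (\<integral>\<omega>. max 0 (Z \<omega>) * Y \<omega> - max 0 (- Z \<omega>) * Y \<omega> \<partial>M)" by simp
    also have "\<dots> = (\<integral>\<omega>. Z \<omega> * Y \<omega> \<partial>M)" by (intro Bochner_Integration.integral_cong) (auto simp: max_def)
    finally show ?thesis by simp
  qed
  have "(\<integral>\<omega>. max 0 (Z \<omega>) * u (\<Phi> (t + 1) \<omega>) \<partial>M) = (\<integral>\<omega>. max 0 (Z \<omega>) * g (\<Phi> t \<omega>) \<partial>M)"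
    "(\<integral>\<omega>. max 0 (- Z \<omega>) * u (\<Phi> (t + 1) \<omega>) \<partial>M) = (\<integral>\<omega>. max 0 (- Z \<omega>) * g (\<Phi> t \<omega>) \<partial>M)"
    using Z by (intro markov_integral_nonneg(2)[OF _ _ u u0 g g0 eq]; simp)+
  then show ?thesis using dec[OF iu] dec[OF ig] by simp
qed

lemma integral_stationary:
  fixes u :: "'e \<Rightarrow> real"
  assumes [measurable]: "u \<in> borel_measurable E"
  shows "(\<integral>\<omega>. u (\<Phi> t \<omega>) \<partial>M) = (\<integral>\<omega>. u (\<Phi> 0 \<omega>) \<partial>M)"
    and "integrable M (\<lambda>\<omega>. u (\<Phi> t \<omega>)) \<longleftrightarrow> integrable M (\<lambda>\<omega>. u (\<Phi> 0 \<omega>))"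
proof -
  have "distr M E (\<Phi> t) = distr M E (\<Phi> 0)"
  proof (rule measure_eqI)
    fix B assume "B \<in> sets (distr M E (\<Phi> t))"
    then have [measurable]: "B \<in> sets E" by simp
    have "\<P>(\<omega> in M. \<Phi> (0 + t) \<omega> \<in> B) = \<P>(\<omega> in M. \<Phi> 0 \<omega> \<in> B)"
      by (rule stationary_prob[OF stat \<Phi>_meas, where P = "\<lambda>f. f 0 \<in> B"]) measurable
    moreover have "\<Phi> s -` B \<inter> space M = {\<omega> \<in> space M. \<Phi> s \<omega> \<in> B}" for s by auto
    ultimately show "emeasure (distr M E (\<Phi> t)) B = emeasure (distr M E (\<Phi> 0)) B"
      by (simp add: emeasure_distr emeasure_eq_measure)
  qed simp
  then show "(\<integral>\<omega>. u (\<Phi> t \<omega>) \<partial>M) = (\<integral>\<omega>. u (\<Phi> 0 \<omega>) \<partial>M)"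
    "integrable M (\<lambda>\<omega>. u (\<Phi> t \<omega>)) \<longleftrightarrow> integrable M (\<lambda>\<omega>. u (\<Phi> 0 \<omega>))"
    using integral_distr[OF \<Phi>_meas, of u t] integral_distr[OF \<Phi>_meas, of u 0]
      integrable_distr_eq[OF \<Phi>_meas, of u t] integrable_distr_eq[OF \<Phi>_meas, of u 0] by simp_all
qed

text \<open>The solution of the Poisson equation killed at the atom is the expected sum of \<open>f\<close> up to the
  next visit to \<open>A\<close>, written as a series of powers of the killed kernel.\<close>

lemma poisson_solution:
  fixes f w :: "'e \<Rightarrow> real"
  assumes A[measurable]: "A \<in> sets E" and [measurable]: "f \<in> borel_measurable E" "w \<in> borel_measurable E"
    and f0: "\<And>y. 0 \<le> f y" and fw: "\<And>y. f y \<le> w y"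
    and \<beta>: "0 \<le> \<beta>" "\<beta> < 1" and B: "B \<ge> 0"
    and drift: "\<And>y. y \<in> space E \<Longrightarrow> (\<integral>\<^sup>+z. ennreal (w z) \<partial>K y) \<le> ennreal (\<beta> * w y + B * indicator A y)"
  obtains G where "G \<in> borel_measurable E" "\<And>y. 0 \<le> G y"
    "\<And>y. y \<in> space E \<Longrightarrow> G y \<le> (\<beta> * w y + B * indicator A y) / (1 - \<beta>)"
    "\<And>y. y \<in> space E \<Longrightarrow> (\<integral>\<^sup>+z. ennreal (f z + indicator (- A) z * G z) \<partial>K y) = ennreal (G y)"
proof -
  have "(\<lambda>z. if z \<in> A then 0 else 1 :: ennreal) \<in> borel_measurable E" by measurable
  also have "(\<lambda>z. if z \<in> A then 0 else 1 :: ennreal) = indicator (- A)" by (auto simp: indicator_def)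
  finally have [measurable]: "(indicator (- A) :: 'e \<Rightarrow> ennreal) \<in> borel_measurable E" .
  have w0: "0 \<le> w y" for y using f0[of y] fw[of y] by linarith
  define l where "l y = \<beta> * w y + B * indicator A y" for y
  have l0: "0 \<le> l y" for y using w0 \<beta> B by (simp add: l_def)
  have [measurable]: "l \<in> borel_measurable E" unfolding l_def by measurable
  \<comment> \<open>R n y is the mean of f at time n + 1, started from y, on the event that A is
    avoided at times 1, ..., n.\<close>
  define R where "R = rec_nat (\<lambda>y. \<integral>\<^sup>+z. ennreal (f z) \<partial>K y) (\<lambda>_ v y. \<integral>\<^sup>+z. v z * indicator (- A) z \<partial>K y)"
  have R: "R 0 = (\<lambda>y. \<integral>\<^sup>+z. ennreal (f z) \<partial>K y)" "R (Suc n) = (\<lambda>y. \<integral>\<^sup>+z. R n z * indicator (- A) z \<partial>K y)" for n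
    by (simp_all add: R_def)
  have Rm[measurable]: "R n \<in> borel_measurable E" for n
    by (induction n) (simp_all add: R)
  have Rb: "y \<in> space E \<Longrightarrow> R n y \<le> ennreal (\<beta> ^ n * l y)" for n y
  proof (induction n arbitrary: y)
    case 0
    have "R 0 y \<le> (\<integral>\<^sup>+z. ennreal (w z) \<partial>K y)" unfolding R using fw by (intro nn_integral_mono ennreal_leI)
    also have "\<dots> \<le> ennreal (l y)" using drift[OF 0] by (simp add: l_def)
    finally show ?case by simp
  next
    case (Suc n)
    have "R (Suc n) y \<le> (\<integral>\<^sup>+z. ennreal (\<beta> ^ Suc n) * ennreal (w z) \<partial>K y)"
      unfolding R
    proof (rule nn_integral_mono)
      fix z assume "z \<in> space (K y)"
      then have z: "z \<in> space E" using space_K Suc by auto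
      \<comment> \<open>Killing pays off here: off A the term with B in l z vanishes, so each
        further step gains a full factor \<beta>.\<close>
      show "R n z * indicator (- A) z \<le> ennreal (\<beta> ^ Suc n) * ennreal (w z)"
        using Suc.IH[OF z] \<beta> w0[of z] by (auto simp: l_def ennreal_mult[symmetric] mult_ac split: split_indicator)
    qed
    also have "\<dots> = ennreal (\<beta> ^ Suc n) * (\<integral>\<^sup>+z. ennreal (w z) \<partial>K y)"
      using Suc.prems by (intro nn_integral_cmult measurable_K) auto
    also have "\<dots> \<le> ennreal (\<beta> ^ Suc n) * ennreal (l y)"
      using drift[OF Suc.prems] by (intro mult_left_mono) (auto simp: l_def)
    also have "\<dots> = ennreal (\<beta> ^ Suc n * l y)" using \<beta> l0 by (simp add: ennreal_mult)
    finally show ?case .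
  qed
  define H where "H y = (\<Sum>n. R n y)" for y
  have [measurable]: "H \<in> borel_measurable E" unfolding H_def by measurable
  have Hb: "H y \<le> ennreal (l y / (1 - \<beta>))" if "y \<in> space E" for y
  proof -
    have "H y \<le> (\<Sum>n. ennreal (\<beta> ^ n * l y))"
      unfolding H_def using Rb[OF that] by (intro suminf_le summableI) auto
    also have "\<dots> = ennreal (\<Sum>n. \<beta> ^ n * l y)"
      using \<beta> l0[of y] by (intro suminf_ennreal2 summable_mult2 summable_geometric) auto
    also have "(\<Sum>n. \<beta> ^ n * l y) = l y / (1 - \<beta>)"
      using \<beta> by (subst suminf_mult2[symmetric]) (auto simp: suminf_geometric intro!: summable_geometric)
    finally show ?thesis .
  qed
  \<comment> \<open>The kernel moves through the series and shifts the index by one; f supplies the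
    missing term n = 0.\<close>
  have Heq: "(\<integral>\<^sup>+z. ennreal (f z) + H z * indicator (- A) z \<partial>K y) = H y" if y: "y \<in> space E" for y
  proof -
    have "(\<integral>\<^sup>+z. ennreal (f z) + H z * indicator (- A) z \<partial>K y) = (\<integral>\<^sup>+z. ennreal (f z) \<partial>K y) + (\<integral>\<^sup>+z. H z * indicator (- A) z \<partial>K y)"
    proof (rule nn_integral_add)
      have "(\<lambda>z. H z * indicator (- A) z) \<in> borel_measurable E" by measurable
      then show "(\<lambda>z. H z * indicator (- A) z) \<in> borel_measurable (K y)" by (rule measurable_K[OF y])
    qed (auto intro!: measurable_K[OF y])
    also have "(\<integral>\<^sup>+z. H z * indicator (- A) z \<partial>K y) = (\<integral>\<^sup>+z. (\<Sum>n. R n z * indicator (- A) z) \<partial>K y)"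
      unfolding H_def by simp
    also have "\<dots> = (\<Sum>n. \<integral>\<^sup>+z. R n z * indicator (- A) z \<partial>K y)"
    proof (rule nn_integral_suminf)
      fix n
      have "(\<lambda>z. R n z * indicator (- A) z) \<in> borel_measurable E" by measurable
      then show "(\<lambda>z. R n z * indicator (- A) z) \<in> borel_measurable (K y)" by (rule measurable_K[OF y])
    qed
    also have "\<dots> = (\<Sum>n. R (Suc n) y)" by (simp add: R)
    also have "(\<integral>\<^sup>+z. ennreal (f z) \<partial>K y) + (\<Sum>n. R (Suc n) y) = (\<Sum>n. R n y)"
      using suminf_offset[of "\<lambda>n. R n y" 1] by (simp add: R(1) add.commute)
    finally show ?thesis by (simp add: H_def)
  qed
  define G where "G y = (if y \<in> space E then enn2real (H y) else 0)" for y
  have HG: "H y = ennreal (G y)" if "y \<in> space E" for y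
    using le_less_trans[OF Hb[OF that] ennreal_less_top] that by (simp add: G_def)
  have G0: "0 \<le> G y" for y by (simp add: G_def)
  show thesis
  proof (rule that[of G])
    show "G \<in> borel_measurable E" unfolding G_def by measurable
    show "0 \<le> G y" for y by (rule G0)
    show "G y \<le> (\<beta> * w y + B * indicator A y) / (1 - \<beta>)" if "y \<in> space E" for y
    proof -
      have "0 \<le> l y / (1 - \<beta>)" using l0[of y] \<beta> by simp
      then show ?thesis using Hb[OF that] unfolding HG[OF that] l_def by simp
    qed
    show "(\<integral>\<^sup>+z. ennreal (f z + indicator (- A) z * G z) \<partial>K y) = ennreal (G y)" if y: "y \<in> space E" for y
    proof -
      have "(\<integral>\<^sup>+z. ennreal (f z + indicator (- A) z * G z) \<partial>K y) = (\<integral>\<^sup>+z. ennreal (f z) + H z * indicator (- A) z \<partial>K y)"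
      proof (rule nn_integral_cong)
        fix z assume "z \<in> space (K y)"
        then have z: "z \<in> space E" using space_K[OF y] by simp
        show "ennreal (f z + indicator (- A) z * G z) = ennreal (f z) + H z * indicator (- A) z"
          using f0[of z] G0[of z] unfolding HG[OF z] by (simp split: split_indicator)
      qed
      then show ?thesis using Heq[OF y] HG[OF y] by simp
    qed
  qed
qed

end

section \<open>Martingale decomposition along the atom\<close>

context stationary_chain
begin

text \<open>The drift of w carries the indicator of A because it is iterated along excursions, where
  the constant has to disappear. The drift of w^2 only has to contract up to a constant, and is
  asked for when m >= 2, the case in which conditional variances enter.\<close>

definition dominated_functional ::
    "nat \<Rightarrow> real \<Rightarrow> real \<Rightarrow> 'e set \<Rightarrow> ('e \<Rightarrow> real) \<Rightarrow> ('e \<Rightarrow> real) \<Rightarrow> bool" where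
  "dominated_functional m \<beta> B A f w \<longleftrightarrow>
     atom E K A \<and> f \<in> borel_measurable E \<and> w \<in> borel_measurable E \<and> (\<forall>y. \<bar>f y\<bar> \<le> w y) \<and>
     (\<forall>y\<in>space E. (\<integral>\<^sup>+z. ennreal (w z) \<partial>K y) \<le> ennreal (\<beta> * w y + B * indicator A y)) \<and>
     (m \<ge> 2 \<longrightarrow> (\<forall>y\<in>space E. (\<integral>\<^sup>+z. ennreal ((w z)\<^sup>2) \<partial>K y) \<le> ennreal (\<beta> * (w y)\<^sup>2 + B))) \<and>
     integrable M (\<lambda>\<omega>. w (\<Phi> 0 \<omega>) ^ (2 * m))"

text \<open>Here c is the expected sum of f over an excursion from the atom, and its relation to the
  mean of f is Kac's formula. Q depends on m, \<beta> and B alone; the truncation level acts only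
  through the moment of w.\<close>

lemma additive_functional_moment:
  fixes m :: nat and \<beta> B :: real
  assumes m: "m \<ge> 1" and \<beta>: "0 \<le> \<beta>" "\<beta> < 1" and B: "B \<ge> 0"
  obtains Q where "Q > 0"
    "\<And>A f w n. dominated_functional m \<beta> B A f w \<Longrightarrow> n \<ge> 1 \<Longrightarrow>
     \<exists>c. c * prob {\<omega> \<in> space M. \<Phi> 0 \<omega> \<in> A} = expectation (\<lambda>\<omega>. f (\<Phi> 0 \<omega>)) \<and>
       integrable M (\<lambda>\<omega>. ((\<Sum>i=1..n. f (\<Phi> (int i) \<omega>)) - c * (\<Sum>i<n. indicator A (\<Phi> (int i) \<omega>))) ^ (2 * m)) \<and>
       expectation (\<lambda>\<omega>. ((\<Sum>i=1..n. f (\<Phi> (int i) \<omega>)) - c * (\<Sum>i<n. indicator A (\<Phi> (int i) \<omega>))) ^ (2 * m))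
         \<le> Q * (real n ^ m + real n * expectation (\<lambda>\<omega>. w (\<Phi> 0 \<omega>) ^ (2 * m)))"
proof -
  have norm_le: "norm x \<le> norm y" if "x \<le> y" "0 \<le> x" for x y :: real using that by simp
  \<comment> \<open>C0 bounds the Poisson solutions in terms of w, and C1 adds the contribution of
    f. All later constants are built from m, \<beta> and B only, before f and w are fixed.\<close>
  define C0 where "C0 = (1 + B) / (1 - \<beta>)"
  have C0: "C0 \<ge> 1" using \<beta> B by (simp add: C0_def field_simps)
  define C1 where "C1 = 1 + C0"
  have C1: "C1 \<ge> 2" using C0 by (simp add: C1_def)
  define Cv where "Cv = 3 * C1\<^sup>2 * (2 + B)"
  have Cv: "Cv \<ge> 0" using B by (simp add: Cv_def)
  have b: "1 + B \<ge> 0" using B by simp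
  obtain Q0 where Q0: "Q0 > 0" and mm:
    "\<And>S D v W N. contracting_martingale m Cv \<beta> (1 + B) W S D v \<Longrightarrow>
      expectation (\<lambda>\<omega>. S N \<omega> ^ (2 * m)) \<le> Q0 * (real N ^ m + real N * W)"
    using martingale_even_moment[OF m Cv \<beta> b] by blast
  define Kc where "Kc = 2 * 9 ^ m * C1 ^ (2 * m)"
  have Kc: "Kc \<ge> 2 ^ m"
  proof -
    have "(2::real) ^ m \<le> 9 ^ m" by (intro power_mono) auto
    also have "\<dots> \<le> 9 ^ m * C1 ^ (2 * m)" using C1 one_le_power[of C1 "2 * m"] by simp
    also have "\<dots> \<le> Kc" using C1 by (simp add: Kc_def)
    finally show ?thesis .
  qed
  then have Kc0: "Kc \<ge> 0" by (rule order_trans[rotated]) simp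
  define Q where "Q = 9 ^ m * (Q0 * (1 + Kc) + 2 * C0 ^ (2 * m))"
  have three: "(a + b + c) ^ (2 * m) \<le> 9 ^ m * (a ^ (2 * m) + b ^ (2 * m) + c ^ (2 * m))" for a b c :: real
  proof -
    define x where "x = max \<bar>a\<bar> (max \<bar>b\<bar> \<bar>c\<bar>)"
    have "x = \<bar>a\<bar> \<or> x = \<bar>b\<bar> \<or> x = \<bar>c\<bar>" unfolding x_def by linarith
    then have xp: "x ^ (2 * m) \<le> a ^ (2 * m) + b ^ (2 * m) + c ^ (2 * m)"
      by (auto simp: power_even_abs)
    have "(a + b + c) ^ (2 * m) = \<bar>a + b + c\<bar> ^ (2 * m)" by (simp add: power_even_abs)
    also have "\<dots> \<le> (3 * x) ^ (2 * m)" unfolding x_def by (intro power_mono) linarith+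
    also have "\<dots> = 9 ^ m * x ^ (2 * m)" by (simp add: power_mult_distrib power_mult)
    also have "\<dots> \<le> 9 ^ m * (a ^ (2 * m) + b ^ (2 * m) + c ^ (2 * m))" using xp by (intro mult_left_mono) auto
    finally show ?thesis .
  qed
  show thesis
  proof (rule that[of Q])
    show "Q > 0" using Q0 Kc0 C0 by (auto simp: Q_def intro!: mult_pos_pos add_pos_nonneg)
    fix A :: "'e set" and f w :: "'e \<Rightarrow> real" and n :: nat
    assume H: "dominated_functional m \<beta> B A f w" and n: "n \<ge> 1"
    then have A[measurable]: "A \<in> sets E" and atom: "\<And>y z. y \<in> A \<Longrightarrow> z \<in> A \<Longrightarrow> K y = K z"
      and fm[measurable]: "f \<in> borel_measurable E" and wm[measurable]: "w \<in> borel_measurable E"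
      and fw: "\<And>y. \<bar>f y\<bar> \<le> w y"
      and drift: "\<And>y. y \<in> space E \<Longrightarrow> (\<integral>\<^sup>+z. ennreal (w z) \<partial>K y) \<le> ennreal (\<beta> * w y + B * indicator A y)"
      and drift2: "\<And>y. m \<ge> 2 \<Longrightarrow> y \<in> space E \<Longrightarrow> (\<integral>\<^sup>+z. ennreal ((w z)\<^sup>2) \<partial>K y) \<le> ennreal (\<beta> * (w y)\<^sup>2 + B)"
      and wi: "integrable M (\<lambda>\<omega>. w (\<Phi> 0 \<omega>) ^ (2 * m))"
      unfolding dominated_functional_def atom_def by blast+
    let ?W = "expectation (\<lambda>\<omega>. w (\<Phi> 0 \<omega>) ^ (2 * m))"
    have w0: "0 \<le> w y" for y using fw[of y] by linarith
    have "(\<lambda>z. if z \<in> A then 0 else 1 :: real) \<in> borel_measurable E" by measurable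
    also have "(\<lambda>z. if z \<in> A then 0 else 1 :: real) = indicator (- A)" by (auto simp: indicator_def)
    finally have iA[measurable]: "(indicator (- A) :: 'e \<Rightarrow> real) \<in> borel_measurable E" .
    have wit: "integrable M (\<lambda>\<omega>. w (\<Phi> t \<omega>) ^ (2 * m))" and Wt: "expectation (\<lambda>\<omega>. w (\<Phi> t \<omega>) ^ (2 * m)) = ?W" for t
      using integral_stationary[of "\<lambda>y. w y ^ (2 * m)" t] wi by auto
    have W0: "?W \<ge> 0" using w0 by simp
    have rint: "integrable M (\<lambda>\<omega>. \<bar>r (\<Phi> t \<omega>)\<bar> ^ (2 * m))"
      if [measurable]: "r \<in> borel_measurable E" and r: "\<And>y. y \<in> space E \<Longrightarrow> \<bar>r y\<bar> \<le> C1 * (1 + w y)" for r :: "'e \<Rightarrow> real" and t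
    proof (rule Bochner_Integration.integrable_bound)
      show "integrable M (\<lambda>\<omega>. C1 ^ (2 * m) * (9 ^ m * (1 + w (\<Phi> t \<omega>) ^ (2 * m))))" using wit[of t] by simp
      show "AE \<omega> in M. norm (\<bar>r (\<Phi> t \<omega>)\<bar> ^ (2 * m)) \<le> norm (C1 ^ (2 * m) * (9 ^ m * (1 + w (\<Phi> t \<omega>) ^ (2 * m))))"
      proof (rule AE_I2)
        fix \<omega> assume "\<omega> \<in> space M"
        let ?y = "\<Phi> t \<omega>"
        have "\<bar>r ?y\<bar> ^ (2 * m) \<le> (C1 * (1 + w ?y)) ^ (2 * m)" using r[OF \<Phi>_space[OF \<open>\<omega> \<in> space M\<close>]] by (intro power_mono) auto
        also have "\<dots> = C1 ^ (2 * m) * (1 + w ?y + 0) ^ (2 * m)" by (simp add: power_mult_distrib)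
        also have "\<dots> \<le> C1 ^ (2 * m) * (9 ^ m * (1 ^ (2 * m) + w ?y ^ (2 * m) + 0 ^ (2 * m)))"
          using C1 by (intro mult_left_mono three) auto
        finally have "\<bar>r ?y\<bar> ^ (2 * m) \<le> C1 ^ (2 * m) * (9 ^ m * (1 + w ?y ^ (2 * m)))" using m by (simp add: power_0_left)
        then show "norm (\<bar>r ?y\<bar> ^ (2 * m)) \<le> norm (C1 ^ (2 * m) * (9 ^ m * (1 + w ?y ^ (2 * m))))"
          by (rule norm_le) simp
      qed
    qed measurable
    \<comment> \<open>The series needs a nonnegative integrand, so the positive and the negative
      part of f are solved separately under the same w.\<close>
    have poisson: "\<exists>G. G \<in> borel_measurable E \<and> (\<forall>y. 0 \<le> G y) \<and>
        (\<forall>y\<in>space E. G y \<le> (\<beta> * w y + B * indicator A y) / (1 - \<beta>)) \<and>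
        (\<forall>y\<in>space E. (\<integral>\<^sup>+z. ennreal (r z + indicator (- A) z * G z) \<partial>K y) = ennreal (G y))"
      if "r \<in> borel_measurable E" "\<And>y. 0 \<le> r y" "\<And>y. r y \<le> w y" for r
      by (rule poisson_solution[OF A that(1) wm that(2,3) \<beta> B drift]) blast+
    have "\<exists>G. G \<in> borel_measurable E \<and> (\<forall>y. 0 \<le> G y) \<and>
        (\<forall>y\<in>space E. G y \<le> (\<beta> * w y + B * indicator A y) / (1 - \<beta>)) \<and>
        (\<forall>y\<in>space E. (\<integral>\<^sup>+z. ennreal (max 0 (f z) + indicator (- A) z * G z) \<partial>K y) = ennreal (G y))"
      by (rule poisson) (use fw w0 in \<open>auto simp: abs_le_iff\<close>)
    then obtain G1 where G1[measurable]: "G1 \<in> borel_measurable E" and G1_0: "\<And>y. 0 \<le> G1 y"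
      and G1_le: "\<And>y. y \<in> space E \<Longrightarrow> G1 y \<le> (\<beta> * w y + B * indicator A y) / (1 - \<beta>)"
      and G1_eq: "\<And>y. y \<in> space E \<Longrightarrow> (\<integral>\<^sup>+z. ennreal (max 0 (f z) + indicator (- A) z * G1 z) \<partial>K y) = ennreal (G1 y)"
      by blast
    have "\<exists>G. G \<in> borel_measurable E \<and> (\<forall>y. 0 \<le> G y) \<and>
        (\<forall>y\<in>space E. G y \<le> (\<beta> * w y + B * indicator A y) / (1 - \<beta>)) \<and>
        (\<forall>y\<in>space E. (\<integral>\<^sup>+z. ennreal (max 0 (- f z) + indicator (- A) z * G z) \<partial>K y) = ennreal (G y))"
      by (rule poisson) (use fw w0 in \<open>auto simp: abs_le_iff\<close>)
    then obtain G2 where G2[measurable]: "G2 \<in> borel_measurable E" and G2_0: "\<And>y. 0 \<le> G2 y"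
      and G2_le: "\<And>y. y \<in> space E \<Longrightarrow> G2 y \<le> (\<beta> * w y + B * indicator A y) / (1 - \<beta>)"
      and G2_eq: "\<And>y. y \<in> space E \<Longrightarrow> (\<integral>\<^sup>+z. ennreal (max 0 (- f z) + indicator (- A) z * G2 z) \<partial>K y) = ennreal (G2 y)"
      by blast
    define u1 where "u1 y = max 0 (f y) + indicator (- A) y * G1 y" for y
    define u2 where "u2 y = max 0 (- f y) + indicator (- A) y * G2 y" for y
    have um[measurable]: "u1 \<in> borel_measurable E" "u2 \<in> borel_measurable E" unfolding u1_def u2_def by measurable
    have u0: "0 \<le> u1 y" "0 \<le> u2 y" for y using G1_0 G2_0 by (simp_all add: u1_def u2_def)
    have Ku: "(\<integral>\<^sup>+z. ennreal (u1 z) \<partial>K y) = ennreal (G1 y)" "(\<integral>\<^sup>+z. ennreal (u2 z) \<partial>K y) = ennreal (G2 y)"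
      if "y \<in> space E" for y
      using G1_eq[OF that] G2_eq[OF that] by (simp_all add: u1_def u2_def)
    define g where "g y = G1 y - G2 y" for y
    \<comment> \<open>The solution set to zero on A. Off A the constant B drops out of the bound, so
      \<open>gt\<close> is controlled by w alone, and the function whose one-step mean is g becomes
      f + gt.\<close>
    define gt where "gt y = indicator (- A) y * g y" for y
    have [measurable]: "g \<in> borel_measurable E" "gt \<in> borel_measurable E" unfolding g_def gt_def by measurable
    have lim: "(\<beta> * w y + B * indicator A y) / (1 - \<beta>) \<le> C0 * (1 + w y)"
      "y \<notin> A \<Longrightarrow> (\<beta> * w y + B * indicator A y) / (1 - \<beta>) \<le> C0 * w y" for y
    proof -
      have "0 \<le> B * w y" using B w0[of y] by (rule mult_nonneg_nonneg)
      moreover have "\<beta> * w y \<le> 1 * w y" using \<beta> w0[of y] by (intro mult_right_mono) auto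
      moreover have "B * indicator A y \<le> B" using B by (simp split: split_indicator)
      moreover have "(1 + B) * (1 + w y) = 1 + B + w y + B * w y" by (simp add: algebra_simps)
      ultimately have "\<beta> * w y + B * indicator A y \<le> (1 + B) * (1 + w y)" by linarith
      then show "(\<beta> * w y + B * indicator A y) / (1 - \<beta>) \<le> C0 * (1 + w y)"
        using \<beta> by (simp add: C0_def divide_right_mono)
      assume "y \<notin> A"
      have "\<beta> * w y \<le> (1 + B) * w y" using \<beta> w0[of y] B by (intro mult_right_mono) auto
      then show "(\<beta> * w y + B * indicator A y) / (1 - \<beta>) \<le> C0 * w y"
        using \<beta> \<open>y \<notin> A\<close> by (simp add: C0_def divide_right_mono)
    qed
    have gtb: "\<bar>gt y\<bar> \<le> C0 * w y" if "y \<in> space E" for y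
    proof (cases "y \<in> A")
      case True
      then show ?thesis using C0 w0[of y] by (simp add: gt_def)
    next
      case False
      then show ?thesis using G1_le[OF that] G2_le[OF that] G1_0[of y] G2_0[of y] lim(2)[OF False]
        unfolding gt_def g_def by simp
    qed
    have Gb: "\<bar>G1 y\<bar> \<le> C1 * (1 + w y)" "\<bar>G2 y\<bar> \<le> C1 * (1 + w y)" "\<bar>g y\<bar> \<le> C1 * (1 + w y)" if "y \<in> space E" for y
    proof -
      have "C0 * (1 + w y) \<le> C1 * (1 + w y)" using w0[of y] by (intro mult_right_mono) (auto simp: C1_def)
      then show "\<bar>G1 y\<bar> \<le> C1 * (1 + w y)" "\<bar>G2 y\<bar> \<le> C1 * (1 + w y)" "\<bar>g y\<bar> \<le> C1 * (1 + w y)"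
        using G1_le[OF that] G2_le[OF that] G1_0[of y] G2_0[of y] lim(1)[of y] unfolding g_def by linarith+
    qed
    have u_diff: "u1 y - u2 y = f y + gt y" for y
      by (auto simp: u1_def u2_def gt_def g_def algebra_simps max_def)
    have ub: "\<bar>u1 y - u2 y\<bar> \<le> C1 * w y" if "y \<in> space E" for y
      unfolding u_diff using gtb[OF that] fw[of y] by (simp add: C1_def algebra_simps abs_le_iff)
    have ub': "\<bar>u1 y\<bar> \<le> C1 * (1 + w y)" "\<bar>u2 y\<bar> \<le> C1 * (1 + w y)" if "y \<in> space E" for y
    proof -
      have "indicator (- A) y * G1 y \<le> C0 * w y" "indicator (- A) y * G2 y \<le> C0 * w y"
        using G1_le[OF that] G2_le[OF that] lim(2)[of y] C0 w0[of y]
        by (auto split: split_indicator)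
      moreover have "C0 * w y + w y \<le> C1 * (1 + w y)" using C0 by (simp add: C1_def algebra_simps)
      ultimately show "\<bar>u1 y\<bar> \<le> C1 * (1 + w y)" "\<bar>u2 y\<bar> \<le> C1 * (1 + w y)"
        using u0[of y] fw[of y] unfolding u1_def u2_def by linarith+
    qed
    \<comment> \<open>The kernel is the same from every point of A, hence so are its integrals G1
      and G2; any point of A gives the same value.\<close>
    define c where "c = (if A = {} then 0 else g (SOME y. y \<in> A))"
    have A_space: "A \<subseteq> space E" using sets.sets_into_space[OF A] .
    have gc: "g y = c" if "y \<in> A" for y
    proof -
      have s: "(SOME y. y \<in> A) \<in> A" using that by (metis someI)
      have "ennreal (G1 y) = ennreal (G1 (SOME y. y \<in> A))" "ennreal (G2 y) = ennreal (G2 (SOME y. y \<in> A))"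
        using Ku[OF subsetD[OF A_space that]] Ku[OF subsetD[OF A_space s]] atom[OF that s] by simp_all
      then have "g y = g (SOME y. y \<in> A)" using G1_0 G2_0 by (simp add: g_def)
      then show ?thesis using that by (auto simp: c_def)
    qed
    have g_dec: "g y = gt y + c * indicator A y" for y
      using gc[of y] by (auto simp: gt_def split: split_indicator)
    \<comment> \<open>A martingale difference: g at time i is the one-step mean of u1 - u2 at time i
      + 1.\<close>
    define D where "D i \<omega> = (u1 (\<Phi> (int i + 1) \<omega>) - u2 (\<Phi> (int i + 1) \<omega>)) - g (\<Phi> (int i) \<omega>)" for i \<omega>
    define S where "S k \<omega> = (\<Sum>i<k. D i \<omega>)" for k \<omega>
    \<comment> \<open>Up to the factor Cv this majorises the second moment of D k given the past.
      The summand 1 accounts for g on the atom, where w alone does not bound it.\<close>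
    define v where "v k \<omega> = 1 + (w (\<Phi> (int k) \<omega>))\<^sup>2" for k \<omega>
    have Dm[measurable]: "D k \<in> borel_measurable M" for k unfolding D_def by measurable
    have Sm[measurable]: "S k \<in> borel_measurable M" for k unfolding S_def by measurable
    have vm[measurable]: "v k \<in> borel_measurable M" for k unfolding v_def by measurable
    have S0: "S 0 \<omega> = 0" for \<omega> by (simp add: S_def)
    have SS: "S (Suc k) \<omega> = S k \<omega> + D k \<omega>" for k \<omega> by (simp add: S_def)
    have Sp: "S k \<in> borel_measurable (past (int k))" for k
    proof -
      have "D i \<in> borel_measurable (past (int k))" if "i < k" for i
        using that unfolding D_def
        by (intro borel_measurable_diff measurable_compose[OF \<Phi>_past um(1)] measurable_compose[OF \<Phi>_past um(2)]
            measurable_compose[OF \<Phi>_past, of _ _ g]) auto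
      then show ?thesis unfolding S_def by (intro borel_measurable_sum) auto
    qed
    have Db: "\<bar>D k \<omega>\<bar> \<le> C1 * (1 + w (\<Phi> (int k + 1) \<omega>) + w (\<Phi> (int k) \<omega>))" if "\<omega> \<in> space M" for k \<omega>
      using ub[OF \<Phi>_space[OF that, of "int k + 1"]] Gb(3)[OF \<Phi>_space[OF that, of "int k"]]
      unfolding D_def by (simp add: algebra_simps)
    have Dpow: "D k \<omega> ^ (2 * m) \<le> C1 ^ (2 * m) * (9 ^ m * (1 + w (\<Phi> (int k + 1) \<omega>) ^ (2 * m) + w (\<Phi> (int k) \<omega>) ^ (2 * m)))"
      if "\<omega> \<in> space M" for k \<omega>
    proof -
      have "D k \<omega> ^ (2 * m) = \<bar>D k \<omega>\<bar> ^ (2 * m)" by (simp add: power_even_abs)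
      also have "\<dots> \<le> (C1 * (1 + w (\<Phi> (int k + 1) \<omega>) + w (\<Phi> (int k) \<omega>))) ^ (2 * m)"
        using Db[OF that] by (intro power_mono) auto
      also have "\<dots> = C1 ^ (2 * m) * (1 + w (\<Phi> (int k + 1) \<omega>) + w (\<Phi> (int k) \<omega>)) ^ (2 * m)" by (simp add: power_mult_distrib)
      also have "\<dots> \<le> C1 ^ (2 * m) * (9 ^ m * (1 ^ (2 * m) + w (\<Phi> (int k + 1) \<omega>) ^ (2 * m) + w (\<Phi> (int k) \<omega>) ^ (2 * m)))"
        using C1 by (intro mult_left_mono three) auto
      finally show ?thesis by simp
    qed
    have iDb: "integrable M (\<lambda>\<omega>. C1 ^ (2 * m) * (9 ^ m * (1 + w (\<Phi> (int k + 1) \<omega>) ^ (2 * m) + w (\<Phi> (int k) \<omega>) ^ (2 * m))))" for k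
      using wit by simp
    have Di: "integrable M (\<lambda>\<omega>. D k \<omega> ^ (2 * m))" for k
    proof (rule Bochner_Integration.integrable_bound[OF iDb[of k]])
      show "AE \<omega> in M. norm (D k \<omega> ^ (2 * m)) \<le> norm (C1 ^ (2 * m) * (9 ^ m * (1 + w (\<Phi> (int k + 1) \<omega>) ^ (2 * m) + w (\<Phi> (int k) \<omega>) ^ (2 * m))))"
      proof (rule AE_I2)
        fix \<omega> assume "\<omega> \<in> space M"
        show "norm (D k \<omega> ^ (2 * m)) \<le> norm (C1 ^ (2 * m) * (9 ^ m * (1 + w (\<Phi> (int k + 1) \<omega>) ^ (2 * m) + w (\<Phi> (int k) \<omega>) ^ (2 * m))))"
          using Dpow[OF \<open>\<omega> \<in> space M\<close>, of k] by (rule norm_le) simp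
      qed
    qed measurable
    have DW: "expectation (\<lambda>\<omega>. D k \<omega> ^ (2 * m)) \<le> Kc * (1 + ?W)" for k
    proof -
      have "expectation (\<lambda>\<omega>. D k \<omega> ^ (2 * m))
        \<le> expectation (\<lambda>\<omega>. C1 ^ (2 * m) * (9 ^ m * (1 + w (\<Phi> (int k + 1) \<omega>) ^ (2 * m) + w (\<Phi> (int k) \<omega>) ^ (2 * m))))"
        by (intro integral_mono Di iDb Dpow)
      also have "\<dots> = C1 ^ (2 * m) * (9 ^ m * (1 + ?W + ?W))"
        using wit Wt[of "int k + 1"] Wt[of "int k"] by (simp add: prob_space)
      also have "\<dots> \<le> C1 ^ (2 * m) * (9 ^ m * (2 + ?W + ?W))" using C1 by (intro mult_left_mono) auto
      also have "\<dots> = Kc * (1 + ?W)" by (simp add: Kc_def algebra_simps)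
      finally show ?thesis .
    qed
    have Si: "integrable M (\<lambda>\<omega>. S k \<omega> ^ (2 * m))" for k
      by (rule integrable_partial_sums_even_power[OF Sm Dm S0 SS Di])
    have abs2m: "\<bar>x\<bar> ^ (2 * m) = x ^ (2 * m)" for x :: real by (simp add: power_even_abs)
    have e1: "2 * m - 1 + 1 = 2 * m" using m by simp
    have iSr: "integrable M (\<lambda>\<omega>. S k \<omega> ^ (2 * m - 1) * r (\<Phi> t \<omega>))"
      if [measurable]: "r \<in> borel_measurable E" and r: "\<And>y. y \<in> space E \<Longrightarrow> \<bar>r y\<bar> \<le> C1 * (1 + w y)" for r :: "'e \<Rightarrow> real" and t k
      using integrable_abs_power_mult[of "S k" "\<lambda>\<omega>. r (\<Phi> t \<omega>)" "2 * m - 1" 1, unfolded e1 power_one_right, OF _ _ _ rint[OF that]] Si[of k]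
      by (simp add: abs2m)
    have mart: "expectation (\<lambda>\<omega>. S k \<omega> ^ (2 * m - 1) * D k \<omega>) = 0" for k
    proof -
      let ?Z = "\<lambda>\<omega>. S k \<omega> ^ (2 * m - 1)"
      have Zp: "?Z \<in> borel_measurable (past (int k))" using Sp[of k] by (rule borel_measurable_power)
      have "expectation (\<lambda>\<omega>. ?Z \<omega> * D k \<omega>) = expectation (\<lambda>\<omega>. ?Z \<omega> * u1 (\<Phi> (int k + 1) \<omega>) - ?Z \<omega> * u2 (\<Phi> (int k + 1) \<omega>)
           - (?Z \<omega> * G1 (\<Phi> (int k) \<omega>) - ?Z \<omega> * G2 (\<Phi> (int k) \<omega>)))"
        by (simp add: D_def g_def algebra_simps)
      also have "\<dots> = expectation (\<lambda>\<omega>. ?Z \<omega> * u1 (\<Phi> (int k + 1) \<omega>)) - expectation (\<lambda>\<omega>. ?Z \<omega> * u2 (\<Phi> (int k + 1) \<omega>))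
           - (expectation (\<lambda>\<omega>. ?Z \<omega> * G1 (\<Phi> (int k) \<omega>)) - expectation (\<lambda>\<omega>. ?Z \<omega> * G2 (\<Phi> (int k) \<omega>)))"
        using iSr[OF um(1) ub'(1)] iSr[OF um(2) ub'(2)] iSr[OF G1 Gb(1)] iSr[OF G2 Gb(2)] by simp
      also have "\<dots> = 0"
        using markov_integral[OF Zp um(1) u0(1) G1 G1_0 Ku(1) iSr[OF um(1) ub'(1)] iSr[OF G1 Gb(1)]]
          markov_integral[OF Zp um(2) u0(2) G2 G2_0 Ku(2) iSr[OF um(2) ub'(2)] iSr[OF G2 Gb(2)]] by simp
      finally show ?thesis .
    qed
    have v0: "v k \<omega> \<ge> 0" for k \<omega> by (simp add: v_def)
    have vpow: "v k \<omega> ^ m \<le> 2 ^ m * (1 + w (\<Phi> (int k) \<omega>) ^ (2 * m))" for k \<omega>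
    proof -
      let ?x = "(w (\<Phi> (int k) \<omega>))\<^sup>2"
      have "max 1 ?x ^ m \<le> 1 + ?x ^ m" by (auto simp: max_def)
      moreover have "v k \<omega> ^ m \<le> (2 * max 1 ?x) ^ m" unfolding v_def by (intro power_mono) (auto simp: max_def)
      ultimately have "v k \<omega> ^ m \<le> 2 ^ m * (1 + ?x ^ m)"
        by (simp add: power_mult_distrib) (meson mult_left_mono order_trans zero_le_numeral zero_le_power)
      then show ?thesis by (simp add: power_mult)
    qed
    have ivb: "integrable M (\<lambda>\<omega>. 2 ^ m * (1 + w (\<Phi> (int k) \<omega>) ^ (2 * m)))" for k using wit by simp
    have vi: "integrable M (\<lambda>\<omega>. v k \<omega> ^ m)" for k
    proof (rule Bochner_Integration.integrable_bound[OF ivb[of k]])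
      show "AE \<omega> in M. norm (v k \<omega> ^ m) \<le> norm (2 ^ m * (1 + w (\<Phi> (int k) \<omega>) ^ (2 * m)))"
        using vpow[of k] v0[of k] w0 by (intro AE_I2) (simp add: abs_mult)
    qed measurable
    have vW: "expectation (\<lambda>\<omega>. v k \<omega> ^ m) \<le> Kc * (1 + ?W)" for k
    proof -
      have "expectation (\<lambda>\<omega>. v k \<omega> ^ m) \<le> expectation (\<lambda>\<omega>. 2 ^ m * (1 + w (\<Phi> (int k) \<omega>) ^ (2 * m)))"
        by (intro integral_mono vi ivb vpow)
      also have "\<dots> = 2 ^ m * (1 + ?W)" using wit Wt[of "int k"] by (simp add: prob_space)
      also have "\<dots> \<le> Kc * (1 + ?W)" using Kc W0 by (intro mult_right_mono) auto
      finally show ?thesis .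
    qed
    have ev: "even (2 * m - 2)" by simp
    have iSw: "integrable M (\<lambda>\<omega>. S k \<omega> ^ (2 * m - 2) * (w (\<Phi> t \<omega>))\<^sup>2)" for k t
    proof -
      have e2: "2 * m - 2 + 2 = 2 * m" using m by simp
      show ?thesis
        by (rule integrable_abs_power_mult[of "S k" "\<lambda>\<omega>. w (\<Phi> t \<omega>)" "2 * m - 2" 2, unfolded e2 abs2m, OF _ _ Si wit]) measurable
    qed
    have iS2: "integrable M (\<lambda>\<omega>. S k \<omega> ^ (2 * m - 2))" for k
    proof (rule Bochner_Integration.integrable_bound)
      show "integrable M (\<lambda>\<omega>. S k \<omega> ^ (2 * m) / 1 + 1 ^ (m - 1))" using Si[of k] by simp
      show "AE \<omega> in M. norm (S k \<omega> ^ (2 * m - 2)) \<le> norm (S k \<omega> ^ (2 * m) / 1 + 1 ^ (m - 1))"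
      proof (rule AE_I2)
        fix \<omega>
        have "S k \<omega> ^ (2 * m - 2) \<le> S k \<omega> ^ (2 * m) / 1 + 1 ^ (m - 1)"
          by (rule even_power_le_next) (use m in auto)
        then show "norm (S k \<omega> ^ (2 * m - 2)) \<le> norm (S k \<omega> ^ (2 * m) / 1 + 1 ^ (m - 1))"
          by (rule norm_le) (rule zero_le_even_power[OF ev])
      qed
    qed measurable
    have drift_w: "expectation (\<lambda>\<omega>. S k \<omega> ^ (2 * m - 2) * (w (\<Phi> (int k + 1) \<omega>))\<^sup>2)
        \<le> \<beta> * expectation (\<lambda>\<omega>. S k \<omega> ^ (2 * m - 2) * (w (\<Phi> (int k) \<omega>))\<^sup>2) + B * expectation (\<lambda>\<omega>. S k \<omega> ^ (2 * m - 2))"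
      if m2: "m \<ge> 2" for k
    proof -
      have "expectation (\<lambda>\<omega>. S k \<omega> ^ (2 * m - 2) * (w (\<Phi> (int k + 1) \<omega>))\<^sup>2)
        \<le> expectation (\<lambda>\<omega>. S k \<omega> ^ (2 * m - 2) * (\<beta> * (w (\<Phi> (int k) \<omega>))\<^sup>2 + B))"
      proof (rule markov_integral_nonneg(1)[where u = "\<lambda>y. (w y)\<^sup>2" and g = "\<lambda>y. \<beta> * (w y)\<^sup>2 + B"])
        show "(\<lambda>\<omega>. S k \<omega> ^ (2 * m - 2)) \<in> borel_measurable (past (int k))" using Sp[of k] by (rule borel_measurable_power)
        show "integrable M (\<lambda>\<omega>. S k \<omega> ^ (2 * m - 2) * (\<beta> * (w (\<Phi> (int k) \<omega>))\<^sup>2 + B))"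
          using iSw[of k "int k"] iS2[of k] by (simp add: distrib_left mult.left_commute[of _ \<beta>])
        show "0 \<le> S k \<omega> ^ (2 * m - 2)" for \<omega> by (rule zero_le_even_power[OF ev])
      qed (use drift2[OF m2] \<beta> B in auto)
      also have "\<dots> = \<beta> * expectation (\<lambda>\<omega>. S k \<omega> ^ (2 * m - 2) * (w (\<Phi> (int k) \<omega>))\<^sup>2) + B * expectation (\<lambda>\<omega>. S k \<omega> ^ (2 * m - 2))"
        using iSw[of k "int k"] iS2[of k] by (simp add: distrib_left mult.left_commute[of _ \<beta>] mult.commute[of _ B])
      finally show ?thesis .
    qed
    have ES0: "0 \<le> expectation (\<lambda>\<omega>. S k \<omega> ^ (2 * m - 2))" "0 \<le> expectation (\<lambda>\<omega>. S k \<omega> ^ (2 * m - 2) * (w (\<Phi> t \<omega>))\<^sup>2)" for k t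
      by (intro integral_nonneg_AE AE_I2 mult_nonneg_nonneg zero_le_even_power[OF ev] zero_le_power2)+
    have Ev: "expectation (\<lambda>\<omega>. S k \<omega> ^ (2 * m - 2) * v j \<omega>) = expectation (\<lambda>\<omega>. S k \<omega> ^ (2 * m - 2))
       + expectation (\<lambda>\<omega>. S k \<omega> ^ (2 * m - 2) * (w (\<Phi> (int j) \<omega>))\<^sup>2)" for k j
      using iSw[of k "int j"] iS2[of k] by (simp add: v_def distrib_left)
    have var: "expectation (\<lambda>\<omega>. S k \<omega> ^ (2 * m - 2) * (D k \<omega>)\<^sup>2) \<le> Cv * expectation (\<lambda>\<omega>. S k \<omega> ^ (2 * m - 2) * v k \<omega>)"
      if m2: "m \<ge> 2" for k
    proof -
      let ?Z = "\<lambda>\<omega>. S k \<omega> ^ (2 * m - 2)"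
      let ?a = "\<lambda>\<omega>. w (\<Phi> (int k + 1) \<omega>)" and ?b = "\<lambda>\<omega>. w (\<Phi> (int k) \<omega>)"
      have e2: "2 * m - 2 + 2 = 2 * m" using m by simp
      have iSD: "integrable M (\<lambda>\<omega>. ?Z \<omega> * (D k \<omega>)\<^sup>2)"
        by (rule integrable_abs_power_mult[of "S k" "D k" "2 * m - 2" 2, unfolded e2 abs2m, OF _ _ Si Di]) measurable
      have "expectation (\<lambda>\<omega>. ?Z \<omega> * (D k \<omega>)\<^sup>2) \<le> expectation (\<lambda>\<omega>. (3 * C1\<^sup>2) * (?Z \<omega> + ?Z \<omega> * (?a \<omega>)\<^sup>2 + ?Z \<omega> * (?b \<omega>)\<^sup>2))"
      proof (rule integral_mono[OF iSD])
        show "integrable M (\<lambda>\<omega>. (3 * C1\<^sup>2) * (?Z \<omega> + ?Z \<omega> * (?a \<omega>)\<^sup>2 + ?Z \<omega> * (?b \<omega>)\<^sup>2))"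
          using iS2[of k] iSw[of k] by (intro integrable_mult_right Bochner_Integration.integrable_add)
        fix \<omega> assume "\<omega> \<in> space M"
        have "(D k \<omega>)\<^sup>2 \<le> (C1 * (1 + ?a \<omega> + ?b \<omega>))\<^sup>2"
          using Db[OF \<open>\<omega> \<in> space M\<close>, of k] by (metis abs_ge_zero power2_abs power_mono)
        also have "\<dots> = C1\<^sup>2 * (1 + ?a \<omega> + ?b \<omega>)\<^sup>2" by (simp add: power_mult_distrib)
        also have "\<dots> \<le> C1\<^sup>2 * (3 * (1 + (?a \<omega>)\<^sup>2 + (?b \<omega>)\<^sup>2))"
        proof (rule mult_left_mono)
          have "0 \<le> (1 - ?a \<omega>)\<^sup>2 + (1 - ?b \<omega>)\<^sup>2 + (?a \<omega> - ?b \<omega>)\<^sup>2" by simp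
          then show "(1 + ?a \<omega> + ?b \<omega>)\<^sup>2 \<le> 3 * (1 + (?a \<omega>)\<^sup>2 + (?b \<omega>)\<^sup>2)"
            by (simp add: power2_eq_square algebra_simps)
        qed simp
        finally have "?Z \<omega> * (D k \<omega>)\<^sup>2 \<le> ?Z \<omega> * (C1\<^sup>2 * (3 * (1 + (?a \<omega>)\<^sup>2 + (?b \<omega>)\<^sup>2)))"
          by (rule mult_left_mono) (rule zero_le_even_power[OF ev])
        then show "?Z \<omega> * (D k \<omega>)\<^sup>2 \<le> (3 * C1\<^sup>2) * (?Z \<omega> + ?Z \<omega> * (?a \<omega>)\<^sup>2 + ?Z \<omega> * (?b \<omega>)\<^sup>2)"
          by (simp add: algebra_simps)
      qed
      also have "\<dots> = (3 * C1\<^sup>2) * (expectation ?Z + expectation (\<lambda>\<omega>. ?Z \<omega> * (?a \<omega>)\<^sup>2) + expectation (\<lambda>\<omega>. ?Z \<omega> * (?b \<omega>)\<^sup>2))"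
        using iS2[of k] iSw[of k] by simp
      \<comment> \<open>The drift of w^2 brings the term at time k + 1 back to time k, so that only
        v k is left.\<close>
      also have "\<dots> \<le> (3 * C1\<^sup>2) * ((2 + B) * (expectation ?Z + expectation (\<lambda>\<omega>. ?Z \<omega> * (?b \<omega>)\<^sup>2)))"
      proof (rule mult_left_mono)
        have "\<beta> * expectation (\<lambda>\<omega>. ?Z \<omega> * (?b \<omega>)\<^sup>2) \<le> 1 * expectation (\<lambda>\<omega>. ?Z \<omega> * (?b \<omega>)\<^sup>2)"
          using \<beta> ES0(2) by (intro mult_right_mono) auto
        moreover have "0 \<le> B * expectation (\<lambda>\<omega>. ?Z \<omega> * (?b \<omega>)\<^sup>2)" using B ES0(2) by simp
        ultimately show "expectation ?Z + expectation (\<lambda>\<omega>. ?Z \<omega> * (?a \<omega>)\<^sup>2) + expectation (\<lambda>\<omega>. ?Z \<omega> * (?b \<omega>)\<^sup>2)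
           \<le> (2 + B) * (expectation ?Z + expectation (\<lambda>\<omega>. ?Z \<omega> * (?b \<omega>)\<^sup>2))"
          using drift_w[OF m2, of k] ES0(1)[of k] unfolding distrib_left distrib_right by linarith
      qed simp
      also have "\<dots> = Cv * expectation (\<lambda>\<omega>. ?Z \<omega> * v k \<omega>)" unfolding Ev by (simp add: Cv_def)
      finally show ?thesis .
    qed
    have vdrift: "expectation (\<lambda>\<omega>. S k \<omega> ^ (2 * m - 2) * v (Suc k) \<omega>)
          \<le> expectation (\<lambda>\<omega>. S k \<omega> ^ (2 * m - 2) * (\<beta> * v k \<omega> + (1 + B)))" if m2: "m \<ge> 2" for k
    proof -
      let ?Z = "\<lambda>\<omega>. S k \<omega> ^ (2 * m - 2)"
      have "expectation (\<lambda>\<omega>. ?Z \<omega> * (\<beta> * v k \<omega> + (1 + B)))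
         = expectation (\<lambda>\<omega>. (\<beta> + 1 + B) * ?Z \<omega> + \<beta> * (?Z \<omega> * (w (\<Phi> (int k) \<omega>))\<^sup>2))"
        by (simp add: v_def algebra_simps)
      also have "\<dots> = (\<beta> + 1 + B) * expectation ?Z + \<beta> * expectation (\<lambda>\<omega>. ?Z \<omega> * (w (\<Phi> (int k) \<omega>))\<^sup>2)"
        using iS2[of k] iSw[of k] by simp
      finally have eq: "expectation (\<lambda>\<omega>. ?Z \<omega> * (\<beta> * v k \<omega> + (1 + B)))
         = (\<beta> + 1 + B) * expectation ?Z + \<beta> * expectation (\<lambda>\<omega>. ?Z \<omega> * (w (\<Phi> (int k) \<omega>))\<^sup>2)" .
      have "0 \<le> \<beta> * expectation ?Z" using \<beta> ES0(1) by simp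
      moreover have "int (Suc k) = int k + 1" by simp
      ultimately show ?thesis unfolding Ev eq using drift_w[OF m2, of k] by (simp add: algebra_simps)
    qed
    \<comment> \<open>The increments and the powers of v share the bound Kc * (1 + E w^(2m)). The
      additive 1 contributes n, which n ^ m absorbs.\<close>
    have M_bound: "expectation (\<lambda>\<omega>. S n \<omega> ^ (2 * m)) \<le> Q0 * (real n ^ m + real n * (Kc * (1 + ?W)))"
    proof (rule mm)
      show "contracting_martingale m Cv \<beta> (1 + B) (Kc * (1 + ?W)) S D v"
        unfolding contracting_martingale_def
        by (intro conjI allI impI Sm Dm vm S0 SS v0 Di DW mart vi vW var vdrift)
    qed
    \<comment> \<open>Note the offset: f is summed over times 1, ..., k but the visits are counted
      over 0, ..., k - 1, because D i pairs f at time i + 1 with g at time i. The g-terms cancel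
      between neighbours up to c on the atom.\<close>
    have tele: "(\<Sum>i=1..k. f (\<Phi> (int i) \<omega>)) - c * (\<Sum>i<k. indicator A (\<Phi> (int i) \<omega>)) = S k \<omega> + gt (\<Phi> 0 \<omega>) - gt (\<Phi> (int k) \<omega>)" for k \<omega>
    proof (induction k)
      case (Suc k)
      have "D k \<omega> = f (\<Phi> (int (Suc k)) \<omega>) + gt (\<Phi> (int (Suc k)) \<omega>) - (gt (\<Phi> (int k) \<omega>) + c * indicator A (\<Phi> (int k) \<omega>))"
        unfolding D_def u_diff g_dec by (simp add: add.commute)
      then show ?case using Suc by (simp add: SS algebra_simps)
    qed (simp add: S0)
    let ?R = "\<lambda>\<omega>. (\<Sum>i=1..n. f (\<Phi> (int i) \<omega>)) - c * (\<Sum>i<n. indicator A (\<Phi> (int i) \<omega>))"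
    let ?U = "\<lambda>\<omega>. 9 ^ m * (S n \<omega> ^ (2 * m) + C0 ^ (2 * m) * w (\<Phi> 0 \<omega>) ^ (2 * m) + C0 ^ (2 * m) * w (\<Phi> (int n) \<omega>) ^ (2 * m))"
    have iU: "integrable M ?U" using Si[of n] wit by simp
    have RU: "?R \<omega> ^ (2 * m) \<le> ?U \<omega>" if "\<omega> \<in> space M" for \<omega>
    proof -
      have gtp: "gt y ^ (2 * m) \<le> C0 ^ (2 * m) * w y ^ (2 * m)" if "y \<in> space E" for y
        using power_mono[OF gtb[OF that], of "2 * m"] by (simp add: abs2m power_mult_distrib)
      have "?R \<omega> ^ (2 * m) = (S n \<omega> + gt (\<Phi> 0 \<omega>) + (- gt (\<Phi> (int n) \<omega>))) ^ (2 * m)"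
        unfolding tele by simp
      also have "\<dots> \<le> 9 ^ m * (S n \<omega> ^ (2 * m) + gt (\<Phi> 0 \<omega>) ^ (2 * m) + (- gt (\<Phi> (int n) \<omega>)) ^ (2 * m))" by (rule three)
      also have "\<dots> \<le> ?U \<omega>"
        using gtp[OF \<Phi>_space[OF that, of 0]] gtp[OF \<Phi>_space[OF that, of "int n"]] by (intro mult_left_mono add_mono) auto
      finally show ?thesis .
    qed
    have iR: "integrable M (\<lambda>\<omega>. ?R \<omega> ^ (2 * m))"
    proof (rule Bochner_Integration.integrable_bound[OF iU])
      show "AE \<omega> in M. norm (?R \<omega> ^ (2 * m)) \<le> norm (?U \<omega>)"
      proof (rule AE_I2)
        fix \<omega> assume "\<omega> \<in> space M"
        show "norm (?R \<omega> ^ (2 * m)) \<le> norm (?U \<omega>)"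
          using RU[OF \<open>\<omega> \<in> space M\<close>] by (rule norm_le) simp
      qed
    qed measurable
    have "expectation (\<lambda>\<omega>. ?R \<omega> ^ (2 * m)) \<le> expectation ?U" by (intro integral_mono iR iU RU)
    also have "\<dots> = 9 ^ m * (expectation (\<lambda>\<omega>. S n \<omega> ^ (2 * m)) + C0 ^ (2 * m) * ?W + C0 ^ (2 * m) * ?W)"
      using Si[of n] wit Wt[of "int n"] by simp
    also have "\<dots> \<le> 9 ^ m * ((Q0 * (1 + Kc) + 2 * C0 ^ (2 * m)) * (real n ^ m + real n * ?W))"
    proof (rule mult_left_mono)
      have n1: "1 \<le> real n" "real n \<le> real n ^ m" using n m by (auto intro: self_le_power)
      have "real n ^ m + real n * (Kc * (1 + ?W)) \<le> (1 + Kc) * (real n ^ m + real n * ?W)"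
      proof -
        have "0 \<le> real n * ?W" using W0 by (intro mult_nonneg_nonneg) auto
        moreover have "(1 + Kc) * (real n ^ m + real n * ?W) - (real n ^ m + real n * (Kc * (1 + ?W)))
           = real n * ?W + (Kc * real n ^ m - Kc * real n)" by (simp add: algebra_simps)
        ultimately show ?thesis using mult_left_mono[OF n1(2) Kc0] by linarith
      qed
      then have "Q0 * (real n ^ m + real n * (Kc * (1 + ?W))) \<le> Q0 * ((1 + Kc) * (real n ^ m + real n * ?W))"
        using Q0 by (intro mult_left_mono) auto
      moreover have "C0 ^ (2 * m) * ?W \<le> C0 ^ (2 * m) * (real n ^ m + real n * ?W)"
      proof (rule mult_left_mono)
        show "?W \<le> real n ^ m + real n * ?W" using n1 mult_right_mono[OF n1(1) W0] by linarith
      qed (use C0 in auto)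
      ultimately show "expectation (\<lambda>\<omega>. S n \<omega> ^ (2 * m)) + C0 ^ (2 * m) * ?W + C0 ^ (2 * m) * ?W
         \<le> (Q0 * (1 + Kc) + 2 * C0 ^ (2 * m)) * (real n ^ m + real n * ?W)"
        using M_bound by (simp add: distrib_right mult.assoc)
    qed simp
    also have "\<dots> = Q * (real n ^ m + real n * ?W)" by (simp add: Q_def)
    finally have bound: "expectation (\<lambda>\<omega>. ?R \<omega> ^ (2 * m)) \<le> Q * (real n ^ m + real n * ?W)" .
    have i1: "integrable M (\<lambda>\<omega>. r (\<Phi> t \<omega>))"
      if [measurable]: "r \<in> borel_measurable E" and r: "\<And>y. y \<in> space E \<Longrightarrow> \<bar>r y\<bar> \<le> C1 * (1 + w y)" for r :: "'e \<Rightarrow> real" and t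
    proof (rule Bochner_Integration.integrable_bound)
      show "integrable M (\<lambda>\<omega>. 1 + \<bar>r (\<Phi> t \<omega>)\<bar> ^ (2 * m))" using rint[OF that, of t] by simp
      have "\<bar>x\<bar> \<le> 1 + \<bar>x\<bar> ^ (2 * m)" for x :: real
      proof (cases "\<bar>x\<bar> \<le> 1")
        case False
        then have "\<bar>x\<bar> \<le> \<bar>x\<bar> ^ (2 * m)" using m by (intro self_le_power) auto
        then show ?thesis by simp
      qed (simp add: add_increasing2)
      then show "AE \<omega> in M. norm (r (\<Phi> t \<omega>)) \<le> norm (1 + \<bar>r (\<Phi> t \<omega>)\<bar> ^ (2 * m))" by (intro AE_I2) simp
    qed measurable
    \<comment> \<open>The Poisson equation relates times 1 and 0; stationarity puts both means at
      time 0.\<close>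
    have mv: "expectation (\<lambda>\<omega>. u1 (\<Phi> 0 \<omega>)) = expectation (\<lambda>\<omega>. G1 (\<Phi> 0 \<omega>))"
      "expectation (\<lambda>\<omega>. u2 (\<Phi> 0 \<omega>)) = expectation (\<lambda>\<omega>. G2 (\<Phi> 0 \<omega>))"
      using markov_integral[of "\<lambda>_. 1" 0, OF _ um(1) u0(1) G1 G1_0 Ku(1)] markov_integral[of "\<lambda>_. 1" 0, OF _ um(2) u0(2) G2 G2_0 Ku(2)]
        i1[OF um(1) ub'(1)] i1[OF um(2) ub'(2)] i1[OF G1 Gb(1)] i1[OF G2 Gb(2)]
        integral_stationary(1)[OF um(1), of 1] integral_stationary(1)[OF um(2), of 1] by simp_all
    have C1w: "x \<le> C1 * (1 + w y)" if "x \<le> C0 * w y" for x y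
      using that C0 w0[of y] by (simp add: C1_def algebra_simps)
    have if0: "integrable M (\<lambda>\<omega>. f (\<Phi> 0 \<omega>))"
    proof (rule i1[OF fm])
      fix y
      have "1 * w y \<le> C0 * w y" using C0 w0[of y] by (intro mult_right_mono) auto
      then show "\<bar>f y\<bar> \<le> C1 * (1 + w y)" using fw[of y] by (intro C1w) linarith
    qed
    have igt: "integrable M (\<lambda>\<omega>. gt (\<Phi> 0 \<omega>))" by (intro i1 C1w gtb) measurable
    have "expectation (\<lambda>\<omega>. f (\<Phi> 0 \<omega>)) + expectation (\<lambda>\<omega>. gt (\<Phi> 0 \<omega>)) = expectation (\<lambda>\<omega>. u1 (\<Phi> 0 \<omega>) - u2 (\<Phi> 0 \<omega>))"
      using if0 igt by (simp add: u_diff)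
    also have "\<dots> = expectation (\<lambda>\<omega>. G1 (\<Phi> 0 \<omega>) - G2 (\<Phi> 0 \<omega>))"
      using mv i1[OF um(1) ub'(1)] i1[OF um(2) ub'(2)] i1[OF G1 Gb(1)] i1[OF G2 Gb(2)] by simp
    \<comment> \<open>Since g equals gt off A and c on A, the mean of gt cancels and Kac's formula
      remains.\<close>
    also have "\<dots> = expectation (\<lambda>\<omega>. gt (\<Phi> 0 \<omega>) + c * indicator {\<omega> \<in> space M. \<Phi> 0 \<omega> \<in> A} \<omega>)"
      using g_dec by (intro Bochner_Integration.integral_cong) (auto simp: g_def split: split_indicator)
    also have "\<dots> = expectation (\<lambda>\<omega>. gt (\<Phi> 0 \<omega>)) + c * prob {\<omega> \<in> space M. \<Phi> 0 \<omega> \<in> A}"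
      using igt by (subst Bochner_Integration.integral_add) (auto simp: emeasure_eq_measure)
    finally have "c * prob {\<omega> \<in> space M. \<Phi> 0 \<omega> \<in> A} = expectation (\<lambda>\<omega>. f (\<Phi> 0 \<omega>))" by simp
    then show "\<exists>c. c * prob {\<omega> \<in> space M. \<Phi> 0 \<omega> \<in> A} = expectation (\<lambda>\<omega>. f (\<Phi> 0 \<omega>)) \<and>
       integrable M (\<lambda>\<omega>. ((\<Sum>i=1..n. f (\<Phi> (int i) \<omega>)) - c * (\<Sum>i<n. indicator A (\<Phi> (int i) \<omega>))) ^ (2 * m)) \<and>
       expectation (\<lambda>\<omega>. ((\<Sum>i=1..n. f (\<Phi> (int i) \<omega>)) - c * (\<Sum>i<n. indicator A (\<Phi> (int i) \<omega>))) ^ (2 * m))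
         \<le> Q * (real n ^ m + real n * ?W)"
      using iR bound by blast
  qed
qed

end

section \<open>Truncated sums of the chain\<close>

lemma powr_tangent:
  fixes t r :: real
  assumes "0 \<le> t" "0 < r" "r \<le> 1"
  shows "t powr r \<le> 1 - r + r * t"
proof (cases "t = 0")
  case False
  then have t: "t > 0" using assms by simp
  define y where "y = 1 - r + r * t"
  have y: "y > 0" using assms t by (auto simp: y_def intro: add_nonneg_pos)
  \<comment> \<open>Weighted arithmetic-geometric mean of t and 1: ln z <= z - 1 at t / y and at 1 /
    y, where y is chosen so that the right sides average to zero.\<close>
  have "r * ln (t / y) + (1 - r) * ln (1 / y) \<le> r * (t / y - 1) + (1 - r) * (1 / y - 1)"
    using assms t y by (intro add_mono mult_left_mono ln_le_minus_one) auto
  also have "\<dots> = (r * t + (1 - r)) / y - 1" using y by (simp add: field_simps)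
  also have "\<dots> = 0" using y by (simp add: y_def add.commute)
  finally have "r * ln t \<le> ln y" using t y by (simp add: ln_div algebra_simps)
  then have "exp (r * ln t) \<le> y" using y by (metis exp_le_cancel_iff exp_ln)
  then show ?thesis using t by (simp add: powr_def y_def)
qed (use assms in simp)

text \<open>Jensen's inequality through the tangent line c + d V of V powr r at a. The slope is
  nonnegative, so an upper bound a for the mean suffices in place of the mean itself.\<close>

lemma (in prob_space) nn_integral_powr_le:
  fixes V :: "'a \<Rightarrow> real"
  assumes [measurable]: "V \<in> borel_measurable M" and V: "\<And>x. 0 \<le> V x" and a: "0 \<le> a" and r: "0 < r" "r \<le> 1"
    and le: "(\<integral>\<^sup>+x. ennreal (V x) \<partial>M) \<le> ennreal a"
  shows "(\<integral>\<^sup>+x. ennreal (V x powr r) \<partial>M) \<le> ennreal (a powr r)"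
proof (cases "a = 0")
  case True
  then have "(\<integral>\<^sup>+x. ennreal (V x) \<partial>M) = 0" using le by simp
  then have "AE x in M. V x = 0" using V by (subst (asm) nn_integral_0_iff_AE) (auto simp: antisym)
  then have "(\<integral>\<^sup>+x. ennreal (V x powr r) \<partial>M) = (\<integral>\<^sup>+x. 0 \<partial>M)" by (intro nn_integral_cong_AE) auto
  then show ?thesis by simp
next
  case False
  then have a: "a > 0" using a by simp
  define c where "c = a powr r * (1 - r)"
  define d where "d = a powr r * r / a"
  have cd: "0 \<le> c" "0 \<le> d" using a r by (auto simp: c_def d_def)
  have "(\<integral>\<^sup>+x. ennreal (V x powr r) \<partial>M) \<le> (\<integral>\<^sup>+x. ennreal c + ennreal d * ennreal (V x) \<partial>M)"
  proof (rule nn_integral_mono)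
    fix x
    have "V x powr r = a powr r * (V x / a) powr r" using a V[of x] by (simp add: powr_divide)
    also have "\<dots> \<le> a powr r * (1 - r + r * (V x / a))"
      using V[of x] a r by (intro mult_left_mono powr_tangent) auto
    also have "\<dots> = c + d * V x" by (simp add: c_def d_def algebra_simps)
    finally have "ennreal (V x powr r) \<le> ennreal (c + d * V x)" by (rule ennreal_leI)
    then show "ennreal (V x powr r) \<le> ennreal c + ennreal d * ennreal (V x)"
      using V[of x] cd by (simp add: ennreal_mult)
  qed
  also have "\<dots> = ennreal c + ennreal d * (\<integral>\<^sup>+x. ennreal (V x) \<partial>M)"
    by (subst nn_integral_add) (auto simp: nn_integral_cmult emeasure_space_1)
  also have "\<dots> \<le> ennreal c + ennreal d * ennreal a" by (intro add_left_mono mult_left_mono le) auto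
  also have "\<dots> = ennreal (c + d * a)" using a cd by (simp add: ennreal_mult)
  also have "c + d * a = a powr r" using a by (simp add: c_def d_def algebra_simps)
  finally show ?thesis .
qed

lemma (in prob_space) prob_gt_le:
  assumes i: "integrable M u" and u: "\<And>\<omega>. \<omega> \<in> space M \<Longrightarrow> 0 \<le> u \<omega>" and "c > (0::real)"
  shows "\<P>(\<omega> in M. u \<omega> > c) \<le> expectation u / c"
proof -
  have [measurable]: "u \<in> borel_measurable M" using i by simp
  let ?A = "{\<omega> \<in> space M. u \<omega> > c}"
  have A: "?A \<in> sets M" by measurable
  have "prob ?A = expectation (indicat_real ?A)" using A by simp
  also have "\<dots> \<le> expectation (\<lambda>\<omega>. u \<omega> / c)"
  proof (rule integral_mono)
    show "integrable M (indicat_real ?A)" using A by (intro integrable_real_indicator) (auto simp: emeasure_eq_measure)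
    show "integrable M (\<lambda>\<omega>. u \<omega> / c)" using i by simp
    show "indicat_real ?A \<omega> \<le> u \<omega> / c" if "\<omega> \<in> space M" for \<omega>
      using u[OF that] \<open>c > 0\<close> by (auto simp: field_simps split: split_indicator)
  qed
  finally show ?thesis by simp
qed

context stationary_chain
begin

text \<open>On the atom the kernel does not depend on the point, so the bound at one chosen point
  serves for all of A and removes the dependence on h y there. Off A the indicator vanishes.\<close>

lemma drift_off_atom:
  assumes at: "atom E K A" and dr: "drift_condition E K h A p"
  obtains \<beta> B where "0 < \<beta>" "\<beta> < 1" "0 \<le> B"
    "\<And>y. y \<in> space E \<Longrightarrow> (\<integral>\<^sup>+z. ennreal (\<bar>h z\<bar> powr p) \<partial>K y) \<le> ennreal (if y \<in> A then B else \<beta> * \<bar>h y\<bar> powr p)"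
proof -
  from dr obtain \<beta> b where \<beta>: "0 < \<beta>" "\<beta> < 1" and b: "0 < b"
    and d: "\<And>y. y \<in> space E \<Longrightarrow> (\<integral>\<^sup>+z. ennreal (\<bar>h z\<bar> powr p) \<partial>K y) \<le> ennreal (\<beta> * \<bar>h y\<bar> powr p + b * indicator A y)"
    unfolding drift_condition_def by blast
  define B where "B = (if A = {} then 0 else \<beta> * \<bar>h (SOME y. y \<in> A)\<bar> powr p + b)"
  have "A \<subseteq> space E" using at sets.sets_into_space by (auto simp: atom_def)
  have on: "(\<integral>\<^sup>+z. ennreal (\<bar>h z\<bar> powr p) \<partial>K y) \<le> ennreal B" if "y \<in> A" for y
  proof -
    have s: "(SOME y. y \<in> A) \<in> A" using that by (metis someI)
    then have "K y = K (SOME y. y \<in> A)" using at that unfolding atom_def by blast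
    moreover have "B = \<beta> * \<bar>h (SOME y. y \<in> A)\<bar> powr p + b" using that by (auto simp: B_def)
    ultimately show ?thesis using d[OF subsetD[OF \<open>A \<subseteq> space E\<close> s]] s by simp
  qed
  show ?thesis
  proof (rule that[OF \<beta>])
    show "0 \<le> B" using \<beta> b by (simp add: B_def)
    show "(\<integral>\<^sup>+z. ennreal (\<bar>h z\<bar> powr p) \<partial>K y) \<le> ennreal (if y \<in> A then B else \<beta> * \<bar>h y\<bar> powr p)"
      if "y \<in> space E" for y
      using on[of y] d[OF that] by (cases "y \<in> A") auto
  qed
qed

text \<open>Off A both branches contract with the same factor: V because \<beta> <= \<beta> powr r,
  and c V powr r by Jensen. On A the minimum is at most V. Neither constant involves c, the only
  place where the truncation level enters.\<close>

lemma drift_truncated: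
  fixes V :: "'e \<Rightarrow> real"
  assumes V[measurable]: "V \<in> borel_measurable E" and V0: "\<And>y. 0 \<le> V y" and \<beta>: "0 < \<beta>" "\<beta> < 1" and B: "0 \<le> B"
    and d: "\<And>y. y \<in> space E \<Longrightarrow> (\<integral>\<^sup>+z. ennreal (V z) \<partial>K y) \<le> ennreal (if y \<in> A then B else \<beta> * V y)"
    and r: "0 < r" "r \<le> 1" and c: "0 \<le> c" and y: "y \<in> space E"
  shows "(\<integral>\<^sup>+z. ennreal (min (V z) (c * V z powr r)) \<partial>K y)
    \<le> ennreal (\<beta> powr r * min (V y) (c * V y powr r) + B * indicator A y)"
proof -
  interpret P: prob_space "K y" by (rule K_prob[OF y])
  have Vm[measurable]: "V \<in> borel_measurable (K y)" by (rule measurable_K[OF y V])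
  have le1: "(\<integral>\<^sup>+z. ennreal (min (V z) (c * V z powr r)) \<partial>K y) \<le> (\<integral>\<^sup>+z. ennreal (V z) \<partial>K y)"
    by (intro nn_integral_mono ennreal_leI) auto
  show ?thesis
  proof (cases "y \<in> A")
    case True
    have "(\<integral>\<^sup>+z. ennreal (min (V z) (c * V z powr r)) \<partial>K y) \<le> ennreal B" using le1 d[OF y] True by auto
    also have "\<dots> \<le> ennreal (\<beta> powr r * min (V y) (c * V y powr r) + B * indicator A y)"
      using True V0[of y] c by (intro ennreal_leI) auto
    finally show ?thesis .
  next
    case False
    have a: "(\<integral>\<^sup>+z. ennreal (V z) \<partial>K y) \<le> ennreal (\<beta> * V y)" using d[OF y] False by simp
    have "\<beta> powr 1 \<le> \<beta> powr r" using \<beta> r by (intro powr_mono') auto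
    then have "\<beta> * V y \<le> \<beta> powr r * V y" using \<beta> V0[of y] by (intro mult_right_mono) auto
    then have b1: "(\<integral>\<^sup>+z. ennreal (min (V z) (c * V z powr r)) \<partial>K y) \<le> ennreal (\<beta> powr r * V y)"
      using le1 a by (meson ennreal_leI order_trans)
    have "(\<integral>\<^sup>+z. ennreal (min (V z) (c * V z powr r)) \<partial>K y) \<le> (\<integral>\<^sup>+z. ennreal c * ennreal (V z powr r) \<partial>K y)"
      using c by (intro nn_integral_mono) (auto simp: ennreal_mult[symmetric] intro!: ennreal_leI)
    also have "\<dots> = ennreal c * (\<integral>\<^sup>+z. ennreal (V z powr r) \<partial>K y)" by (intro nn_integral_cmult) measurable
    also have "\<dots> \<le> ennreal c * ennreal ((\<beta> * V y) powr r)"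
      using V0 \<beta> r a by (intro mult_left_mono P.nn_integral_powr_le) auto
    also have "\<dots> = ennreal (\<beta> powr r * (c * V y powr r))"
      using c \<beta> V0[of y] by (simp add: ennreal_mult[symmetric] powr_mult mult_ac)
    finally have b2: "(\<integral>\<^sup>+z. ennreal (min (V z) (c * V z powr r)) \<partial>K y) \<le> ennreal (\<beta> powr r * (c * V y powr r))" .
    show ?thesis using b1 b2 False by (cases "V y \<le> c * V y powr r") (auto simp: min_def)
  qed
qed

text \<open>Drift of order two implies drift of order one, by Jensen with exponent 1/2; this lets a
  single atom serve both orders.\<close>

lemma drift_root:
  fixes h :: "'e \<Rightarrow> real"
  assumes [measurable]: "h \<in> borel_measurable E" and \<beta>: "0 < \<beta>" "\<beta> < 1" and B: "0 \<le> B"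
    and d: "\<And>y. y \<in> space E \<Longrightarrow> (\<integral>\<^sup>+z. ennreal ((h z)\<^sup>2) \<partial>K y) \<le> ennreal (if y \<in> A then B else \<beta> * (h y)\<^sup>2)"
    and y: "y \<in> space E"
  shows "(\<integral>\<^sup>+z. ennreal \<bar>h z\<bar> \<partial>K y) \<le> ennreal (if y \<in> A then sqrt B else sqrt \<beta> * \<bar>h y\<bar>)"
proof -
  interpret P: prob_space "K y" by (rule K_prob[OF y])
  have hm: "h \<in> borel_measurable (K y)" by (rule measurable_K[OF y]) measurable
  then have [measurable]: "(\<lambda>z. (h z)\<^sup>2) \<in> borel_measurable (K y)" by measurable
  let ?a = "if y \<in> A then B else \<beta> * (h y)\<^sup>2"
  have "(\<integral>\<^sup>+z. ennreal ((h z)\<^sup>2 powr (1/2)) \<partial>K y) \<le> ennreal (?a powr (1/2))"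
    using \<beta> B d[OF y] by (intro P.nn_integral_powr_le) auto
  then show ?thesis using \<beta> B by (simp add: powr_half_sqrt real_sqrt_mult split: if_splits)
qed

end

section \<open>Negligibility of the small parts\<close>

locale chain_functional = stationary_chain M E K \<Phi> + rv_tail "abs_tail M (\<lambda>t \<omega>. h (\<Phi> t \<omega>))" \<alpha>
  for M :: "'w measure" and E :: "'e measure" and K :: "'e \<Rightarrow> 'e measure" and \<Phi> :: "int \<Rightarrow> 'w \<Rightarrow> 'e"
    and h :: "'e \<Rightarrow> real" and \<alpha> :: real +
  assumes h_meas [measurable]: "h \<in> borel_measurable E"
begin

abbreviation X :: "int \<Rightarrow> 'w \<Rightarrow> real" where "X \<equiv> \<lambda>t \<omega>. h (\<Phi> t \<omega>)"
abbreviation F :: "real \<Rightarrow> real" where "F \<equiv> abs_tail M X"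

sublocale X: stationary_sequence M X
  by standard (auto intro: stationary_image[OF stat \<Phi>_meas h_meas])

lemma F_eq: "F x = measure M {\<omega> \<in> space M. \<bar>X 0 \<omega>\<bar> > x}"
  by (simp add: abs_tail_def)

lemmas moment_lower = truncated_moment_lower[OF prob_space_axioms _ F_eq, simplified]
lemmas moment_upper = truncated_moment_upper[OF prob_space_axioms _ F_eq, simplified]

lemma eventually_tail_ratio:
  assumes "d > 0"
  shows "\<forall>\<^sub>F x in at_top. F (x * d) \<le> 2 * d powr (-\<alpha>) * F x"
proof -
  have "\<forall>\<^sub>F x in at_top. F (d * x) / F x < 2 * d powr (-\<alpha>)"
    using assms by (intro order_tendstoD(2)[OF rv]) auto
  then show ?thesis
    by eventually_elim (use F_pos in \<open>auto simp: field_simps less_imp_le\<close>)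
qed

text \<open>At level L = x \<delta>_k the truncated mean is O(L F L), and F L is at most 2
  \<delta>_k powr (-\<alpha>) F x for large x. The net factor \<delta>_k powr (1 - \<alpha>)
  vanishes as k grows because \<alpha> < 1.\<close>

lemma truncation_negligible_small_index:
  fixes \<delta> :: "nat \<Rightarrow> real" and \<Lambda> :: "nat \<Rightarrow> real set"
  assumes "\<alpha> < 1" and ac: "anti_clustering M X \<alpha> \<delta> \<Lambda>"
    and Inf: "filterlim (\<lambda>n. Inf (\<Lambda> n)) at_top sequentially" and "e > 0" "\<epsilon> > 0"
  shows "\<forall>\<^sub>F k in sequentially. \<forall>\<^sub>F n in sequentially. \<forall>x\<in>\<Lambda> n.
       \<P>(\<omega> in M. \<bar>\<Sum>i=1..n. small_part (x * \<delta> k) (X (int i) \<omega>)\<bar> > \<epsilon> * x) \<le> e * (real n * F x)"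
proof -
  have \<delta>: "\<And>k. \<delta> k > 0" "\<delta> \<longlonglongrightarrow> 0" using ac by (auto simp: anti_clustering_def)
  have "1 > \<alpha>" using assms by simp
  then obtain C x0 where C: "C > 0" "x0 > 0"
    "\<And>L. x0 \<le> L \<Longrightarrow> (\<integral>\<^sup>+\<omega>. ennreal (\<bar>X 0 \<omega>\<bar> powr 1) * indicator {0<..L} \<bar>X 0 \<omega>\<bar> \<partial>M) \<le> ennreal (C * L powr 1 * F L)"
    using moment_lower by blast
  have mean: "expectation (\<lambda>\<omega>. \<bar>small_part L (X t \<omega>)\<bar>) \<le> C * L * F L" if "x0 \<le> L" for L t
  proof -
    have L: "L > 0" using that C by simp
    have "expectation (\<lambda>\<omega>. \<bar>small_part L (X t \<omega>)\<bar>) = expectation (\<lambda>\<omega>. \<bar>small_part L (X 0 \<omega>)\<bar>)"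
      by (rule integral_stationary(1)) measurable
    also have "\<dots> = enn2real (\<integral>\<^sup>+\<omega>. ennreal \<bar>small_part L (X 0 \<omega>)\<bar> \<partial>M)"
      by (intro integral_eq_nn_integral) auto
    also have "(\<integral>\<^sup>+\<omega>. ennreal \<bar>small_part L (X 0 \<omega>)\<bar> \<partial>M) = (\<integral>\<^sup>+\<omega>. ennreal (\<bar>X 0 \<omega>\<bar> powr 1) * indicator {0<..L} \<bar>X 0 \<omega>\<bar> \<partial>M)"
      by (intro nn_integral_cong) (auto simp: small_part_def split: split_indicator)
    also have "enn2real \<dots> \<le> enn2real (ennreal (C * L powr 1 * F L))"
      using C(3)[OF that] by (intro enn2real_mono) auto
    also have "\<dots> = C * L * F L" using C L F_pos[of L] by simp
    finally show ?thesis .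
  qed
  have "(\<lambda>k. 2 * C / \<epsilon> * \<delta> k powr (1 - \<alpha>)) \<longlonglongrightarrow> 2 * C / \<epsilon> * 0"
    using \<delta> \<open>\<alpha> < 1\<close> by (intro tendsto_mult tendsto_const tendsto_zero_powrI) (auto simp: less_imp_le)
  then have "\<forall>\<^sub>F k in sequentially. 2 * C / \<epsilon> * \<delta> k powr (1 - \<alpha>) < e"
    using \<open>e > 0\<close> by (intro order_tendstoD(2)) auto
  then show ?thesis
  proof eventually_elim
    case (elim k)
    let ?d = "\<delta> k"
    have d: "?d > 0" by (rule \<delta>)
    have "\<forall>\<^sub>F x in at_top. x \<ge> x0 / ?d \<and> x > 0 \<and> F (x * ?d) \<le> 2 * ?d powr (-\<alpha>) * F x"
      by (intro eventually_conj eventually_ge_at_top eventually_gt_at_top eventually_tail_ratio d)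
    from X.eventually_in_regions[OF ac Inf this] show ?case
    proof eventually_elim
      case (elim n)
      show ?case
      proof
        fix x assume "x \<in> \<Lambda> n"
        then have x: "x \<ge> x0 / ?d" "x > 0" "F (x * ?d) \<le> 2 * ?d powr (-\<alpha>) * F x" using elim by auto
        let ?L = "x * ?d"
        have L: "x0 \<le> ?L" using x(1) d by (simp add: field_simps)
        have L0: "?L > 0" using x d by simp
        have i: "integrable M (\<lambda>\<omega>. \<bar>small_part ?L (X t \<omega>)\<bar>)" for t
          using abs_small_part_le[of ?L] L0 by (intro integrable_const_bound[of _ ?L]) auto
        have "\<P>(\<omega> in M. \<bar>\<Sum>i=1..n. small_part ?L (X (int i) \<omega>)\<bar> > \<epsilon> * x)
           \<le> \<P>(\<omega> in M. (\<Sum>i=1..n. \<bar>small_part ?L (X (int i) \<omega>)\<bar>) > \<epsilon> * x)"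
          by (intro finite_measure_mono) (auto intro: less_le_trans[OF _ sum_abs])
        also have "\<dots> \<le> expectation (\<lambda>\<omega>. \<Sum>i=1..n. \<bar>small_part ?L (X (int i) \<omega>)\<bar>) / (\<epsilon> * x)"
          using i x \<open>\<epsilon> > 0\<close> by (intro prob_gt_le) (auto intro!: sum_nonneg)
        also have "\<dots> = (\<Sum>i=1..n. expectation (\<lambda>\<omega>. \<bar>small_part ?L (X (int i) \<omega>)\<bar>)) / (\<epsilon> * x)"
          using i by simp
        also have "\<dots> \<le> (\<Sum>i=1..n. C * ?L * F ?L) / (\<epsilon> * x)"
          using mean[OF L] x \<open>\<epsilon> > 0\<close> by (intro divide_right_mono sum_mono) auto
        also have "\<dots> = C / \<epsilon> * ?d * real n * F ?L" using x \<open>\<epsilon> > 0\<close> by (simp add: field_simps)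
        also have "\<dots> \<le> C / \<epsilon> * ?d * real n * (2 * ?d powr (-\<alpha>) * F x)"
          using x C d \<open>\<epsilon> > 0\<close> by (intro mult_left_mono) auto
        also have "\<dots> = (2 * C / \<epsilon> * ?d powr (1 - \<alpha>)) * (real n * F x)"
          using d by (simp add: powr_diff powr_minus field_simps)
        also have "\<dots> \<le> e * (real n * F x)"
          using \<open>2 * C / \<epsilon> * \<delta> k powr (1 - \<alpha>) < e\<close> F_pos[of x] by (intro mult_right_mono) auto
        finally show "\<P>(\<omega> in M. \<bar>\<Sum>i=1..n. small_part ?L (X (int i) \<omega>)\<bar> > \<epsilon> * x) \<le> e * (real n * F x)" .
      qed
    qed
  qed
qed

text \<open>The dominating function w. Its branches cross at |h| = L, which makes it dominate the
  small part, and the slow growth |h| powr r beyond L controls its high moments.\<close>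

definition damped :: "real \<Rightarrow> real \<Rightarrow> 'e \<Rightarrow> real" where
  "damped r L y = min \<bar>h y\<bar> (L powr (1 - r) * \<bar>h y\<bar> powr r)"

lemma damped_meas [measurable]: "damped r L \<in> borel_measurable E"
  unfolding damped_def by measurable

lemma damped_nonneg: "0 \<le> damped r L y"
  by (simp add: damped_def)

lemma small_part_le_damped:
  assumes "0 < L" "0 < r" "r \<le> 1"
  shows "\<bar>small_part L (h y)\<bar> \<le> damped r L y"
proof (cases "\<bar>h y\<bar> \<le> L \<and> h y \<noteq> 0")
  case True
  have "\<bar>h y\<bar> = \<bar>h y\<bar> powr (1 - r) * \<bar>h y\<bar> powr r" using True by (simp add: powr_add[symmetric])
  also have "\<dots> \<le> L powr (1 - r) * \<bar>h y\<bar> powr r"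
    using True assms by (intro mult_right_mono powr_mono2) auto
  finally show ?thesis using True by (simp add: small_part_def damped_def)
qed (auto simp: small_part_def damped_nonneg)

text \<open>Split at |h| = L: below, 2m > \<alpha> gives the lower Karamata bound; above, 2mr <
  \<alpha> gives the upper one, and the prefactor L powr ((1 - r) * 2m) restores the common order
  L^(2m) F L.\<close>

lemma damped_moment:
  assumes m: "real (2 * m) > \<alpha>" and r: "0 < r" "r < 1" "2 * m * r < \<alpha>"
  obtains C x0 where "C > 0" "x0 > 0"
    "\<And>L. x0 \<le> L \<Longrightarrow> integrable M (\<lambda>\<omega>. damped r L (\<Phi> 0 \<omega>) ^ (2 * m))"
    "\<And>L. x0 \<le> L \<Longrightarrow> expectation (\<lambda>\<omega>. damped r L (\<Phi> 0 \<omega>) ^ (2 * m)) \<le> C * L ^ (2 * m) * F L"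
proof -
  have m0: "m > 0" using m \<alpha>_pos by (cases m) auto
  have "real (2 * m) * r > 0" using m0 r by simp
  obtain C1 x1 where C1: "C1 > 0" "x1 > 0"
    "\<And>L. x1 \<le> L \<Longrightarrow> (\<integral>\<^sup>+\<omega>. ennreal (\<bar>X 0 \<omega>\<bar> powr real (2 * m)) * indicator {0<..L} \<bar>X 0 \<omega>\<bar> \<partial>M) \<le> ennreal (C1 * L powr real (2 * m) * F L)"
    using moment_lower[OF m] by blast
  obtain C2 x2 where C2: "C2 > 0" "x2 > 0"
    "\<And>L. x2 \<le> L \<Longrightarrow> (\<integral>\<^sup>+\<omega>. ennreal (\<bar>X 0 \<omega>\<bar> powr (real (2 * m) * r)) * indicator {L<..} \<bar>X 0 \<omega>\<bar> \<partial>M) \<le> ennreal (C2 * L powr (real (2 * m) * r) * F L)"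
    using moment_upper[OF \<open>real (2 * m) * r > 0\<close>] r(3) by auto
  have nn: "(\<integral>\<^sup>+\<omega>. ennreal (damped r L (\<Phi> 0 \<omega>) ^ (2 * m)) \<partial>M) \<le> ennreal ((C1 + C2) * L ^ (2 * m) * F L)"
    if L: "max x1 x2 \<le> L" for L
  proof -
    have L0: "L > 0" using L C1 by simp
    let ?c = "L powr ((1 - r) * real (2 * m))"
    have "(\<integral>\<^sup>+\<omega>. ennreal (damped r L (\<Phi> 0 \<omega>) ^ (2 * m)) \<partial>M) \<le>
      (\<integral>\<^sup>+\<omega>. ennreal (\<bar>X 0 \<omega>\<bar> powr real (2 * m)) * indicator {0<..L} \<bar>X 0 \<omega>\<bar>
        + ennreal ?c * (ennreal (\<bar>X 0 \<omega>\<bar> powr (real (2 * m) * r)) * indicator {L<..} \<bar>X 0 \<omega>\<bar>) \<partial>M)"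
    proof (rule nn_integral_mono)
      fix \<omega>
      let ?y = "\<Phi> 0 \<omega>"
      consider "h ?y = 0" | "0 < \<bar>h ?y\<bar>" "\<bar>h ?y\<bar> \<le> L" | "\<bar>h ?y\<bar> > L" by linarith
      then show "ennreal (damped r L ?y ^ (2 * m)) \<le> ennreal (\<bar>h ?y\<bar> powr real (2 * m)) * indicator {0<..L} \<bar>h ?y\<bar>
        + ennreal ?c * (ennreal (\<bar>h ?y\<bar> powr (real (2 * m) * r)) * indicator {L<..} \<bar>h ?y\<bar>)"
      proof cases
        case 1
        then show ?thesis using m0 by (simp add: damped_def power_0_left)
      next
        case 2
        have "damped r L ?y ^ (2 * m) \<le> \<bar>h ?y\<bar> ^ (2 * m)"
          by (intro power_mono damped_nonneg) (simp add: damped_def)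
        also have "\<dots> = \<bar>h ?y\<bar> powr real (2 * m)" using 2 by (simp add: powr_realpow del: of_nat_mult)
        finally show ?thesis using 2 by (simp add: ennreal_leI del: of_nat_mult)
      next
        case 3
        have "damped r L ?y ^ (2 * m) \<le> (L powr (1 - r) * \<bar>h ?y\<bar> powr r) ^ (2 * m)"
          by (intro power_mono damped_nonneg) (simp add: damped_def)
        also have "\<dots> = (L powr (1 - r) * \<bar>h ?y\<bar> powr r) powr real (2 * m)"
          using 3 L0 by (intro powr_realpow[symmetric]) auto
        also have "\<dots> = ?c * \<bar>h ?y\<bar> powr (real (2 * m) * r)"
          by (simp add: powr_mult powr_powr mult_ac)
        finally show ?thesis using 3 by (simp add: ennreal_leI ennreal_mult[symmetric] del: of_nat_mult)
      qed
    qed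
    also have "\<dots> = (\<integral>\<^sup>+\<omega>. ennreal (\<bar>X 0 \<omega>\<bar> powr real (2 * m)) * indicator {0<..L} \<bar>X 0 \<omega>\<bar> \<partial>M)
        + ennreal ?c * (\<integral>\<^sup>+\<omega>. ennreal (\<bar>X 0 \<omega>\<bar> powr (real (2 * m) * r)) * indicator {L<..} \<bar>X 0 \<omega>\<bar> \<partial>M)"
      by (subst nn_integral_add) (auto simp: nn_integral_cmult)
    also have "\<dots> \<le> ennreal (C1 * L powr real (2 * m) * F L) + ennreal ?c * ennreal (C2 * L powr (real (2 * m) * r) * F L)"
      using C1(3)[of L] C2(3)[of L] L by (intro add_mono mult_left_mono) auto
    also have "\<dots> = ennreal (C1 * L powr real (2 * m) * F L + ?c * (C2 * L powr (real (2 * m) * r) * F L))"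
      using C1(1) C2(1) F_pos[of L] by (simp add: ennreal_mult[symmetric] ennreal_plus[symmetric] del: ennreal_plus of_nat_mult)
    also have "?c * (C2 * L powr (real (2 * m) * r) * F L) = C2 * L powr real (2 * m) * F L"
      by (simp add: powr_add[symmetric] algebra_simps)
    also have "C1 * L powr real (2 * m) * F L + C2 * L powr real (2 * m) * F L = (C1 + C2) * L ^ (2 * m) * F L"
      using L0 by (simp add: powr_realpow algebra_simps del: of_nat_mult)
    finally show ?thesis .
  qed
  have int: "integrable M (\<lambda>\<omega>. damped r L (\<Phi> 0 \<omega>) ^ (2 * m))" if "max x1 x2 \<le> L" for L
    using le_less_trans[OF nn[OF that] ennreal_less_top] damped_nonneg by (intro integrableI_bounded) auto
  show ?thesis
  proof (rule that[of "C1 + C2" "max x1 x2"])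
    fix L assume L: "max x1 x2 \<le> L"
    show "integrable M (\<lambda>\<omega>. damped r L (\<Phi> 0 \<omega>) ^ (2 * m))" by (rule int[OF L])
    have "L > 0" using L C1 by simp
    then have "0 \<le> (C1 + C2) * L ^ (2 * m) * F L" using C1 C2 F_pos[of L] by simp
    moreover have "ennreal (expectation (\<lambda>\<omega>. damped r L (\<Phi> 0 \<omega>) ^ (2 * m))) \<le> ennreal ((C1 + C2) * L ^ (2 * m) * F L)"
      using nn[OF L] nn_integral_eq_integral[OF int[OF L]] damped_nonneg by simp
    ultimately show "expectation (\<lambda>\<omega>. damped r L (\<Phi> 0 \<omega>) ^ (2 * m)) \<le> (C1 + C2) * L ^ (2 * m) * F L" by simp
  qed (use C1 C2 in auto)
qed

text \<open>The difference of the two means is the mean of the large part, which the upper Karamata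
  bound controls with exponent 1 < \<alpha>. For centred X this bounds the truncated mean
  itself.\<close>

lemma integrable_and_truncated_mean:
  assumes "\<alpha> > 1"
  obtains C x0 where "integrable M (X 0)" "C > 0" "x0 > 0"
    "\<And>L. x0 \<le> L \<Longrightarrow> \<bar>expectation (X 0) - expectation (\<lambda>\<omega>. small_part L (X 0 \<omega>))\<bar> \<le> C * L * F L"
proof -
  obtain C x0 where C: "C > 0" "x0 > 0"
    "\<And>L. x0 \<le> L \<Longrightarrow> (\<integral>\<^sup>+\<omega>. ennreal (\<bar>X 0 \<omega>\<bar> powr 1) * indicator {L<..} \<bar>X 0 \<omega>\<bar> \<partial>M) \<le> ennreal (C * L powr 1 * F L)"
    using moment_upper[of 1] assms by auto
  have nn: "(\<integral>\<^sup>+\<omega>. ennreal \<bar>large_part L (X 0 \<omega>)\<bar> \<partial>M) \<le> ennreal (C * L * F L)" if "x0 \<le> L" for L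
  proof -
    have L: "L > 0" using that C by simp
    have "(\<integral>\<^sup>+\<omega>. ennreal \<bar>large_part L (X 0 \<omega>)\<bar> \<partial>M) = (\<integral>\<^sup>+\<omega>. ennreal (\<bar>X 0 \<omega>\<bar> powr 1) * indicator {L<..} \<bar>X 0 \<omega>\<bar> \<partial>M)"
      using L by (intro nn_integral_cong) (auto simp: large_part_def split: split_indicator)
    also have "\<dots> \<le> ennreal (C * L * F L)" using C(3)[OF that] L by simp
    finally show ?thesis .
  qed
  have il: "integrable M (\<lambda>\<omega>. large_part L (X 0 \<omega>))" if "x0 \<le> L" for L
    using le_less_trans[OF nn[OF that] ennreal_less_top] by (intro integrableI_bounded) auto
  have ism: "integrable M (\<lambda>\<omega>. small_part L (X 0 \<omega>))" if "x0 \<le> L" for L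
    using abs_small_part_le[of L] that C(2) by (intro integrable_const_bound[of _ L]) auto
  have split: "X 0 = (\<lambda>\<omega>. large_part L (X 0 \<omega>) + small_part L (X 0 \<omega>))" for L
    by (simp add: large_plus_small)
  have iX: "integrable M (X 0)"
    by (subst split[of x0]) (intro Bochner_Integration.integrable_add il ism order_refl)
  show ?thesis
  proof (rule that[OF iX C(1,2)])
    fix L assume L: "x0 \<le> L"
    have L0: "L > 0" using L C by simp
    have "expectation (X 0) = expectation (\<lambda>\<omega>. large_part L (X 0 \<omega>)) + expectation (\<lambda>\<omega>. small_part L (X 0 \<omega>))"
      by (subst split[of L]) (intro Bochner_Integration.integral_add il ism L)
    then have "\<bar>expectation (X 0) - expectation (\<lambda>\<omega>. small_part L (X 0 \<omega>))\<bar> = \<bar>expectation (\<lambda>\<omega>. large_part L (X 0 \<omega>))\<bar>" by simp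
    also have "\<dots> \<le> expectation (\<lambda>\<omega>. \<bar>large_part L (X 0 \<omega>)\<bar>)" by (rule integral_abs_bound)
    also have "\<dots> = enn2real (\<integral>\<^sup>+\<omega>. ennreal \<bar>large_part L (X 0 \<omega>)\<bar> \<partial>M)" by (intro integral_eq_nn_integral) auto
    also have "\<dots> \<le> enn2real (ennreal (C * L * F L))" using nn[OF L] by (intro enn2real_mono) auto
    also have "\<dots> = C * L * F L" using C L0 F_pos[of L] by simp
    finally show "\<bar>expectation (X 0) - expectation (\<lambda>\<omega>. small_part L (X 0 \<omega>))\<bar> \<le> C * L * F L" .
  qed
qed

text \<open>If the stationary law gave A no mass, the drift would yield E|X| <= \<beta> E|X|, hence
  X = 0 almost surely, against F 0 > 0. Positivity is what allows division in Kac's formula.\<close>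

lemma atom_charged:
  assumes A[measurable]: "A \<in> sets E" and iX: "integrable M (X 0)" and \<beta>: "0 < \<beta>" "\<beta> < 1" and B: "0 \<le> B"
    and d: "\<And>y. y \<in> space E \<Longrightarrow> (\<integral>\<^sup>+z. ennreal \<bar>h z\<bar> \<partial>K y) \<le> ennreal (if y \<in> A then B else \<beta> * \<bar>h y\<bar>)"
  shows "\<P>(\<omega> in M. \<Phi> 0 \<omega> \<in> A) > 0"
proof (rule ccontr)
  assume "\<not> ?thesis"
  then have p0: "\<P>(\<omega> in M. \<Phi> 0 \<omega> \<in> A) = 0" using measure_nonneg[of M "{\<omega> \<in> space M. \<Phi> 0 \<omega> \<in> A}"] by linarith
  have iA: "integrable M (\<lambda>\<omega>. indicat_real A (\<Phi> 0 \<omega>))"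
    by (intro integrable_const_bound[of _ 1]) auto
  have EA: "expectation (\<lambda>\<omega>. indicat_real A (\<Phi> 0 \<omega>)) = 0"
  proof -
    have "expectation (\<lambda>\<omega>. indicat_real A (\<Phi> 0 \<omega>)) = expectation (indicat_real {\<omega> \<in> space M. \<Phi> 0 \<omega> \<in> A})"
      by (intro Bochner_Integration.integral_cong) (auto split: split_indicator)
    then show ?thesis using p0 by simp
  qed
  have "expectation (\<lambda>\<omega>. \<bar>h (\<Phi> 0 \<omega>)\<bar>) = expectation (\<lambda>\<omega>. 1 * \<bar>h (\<Phi> (0 + 1) \<omega>)\<bar>)"
    using integral_stationary(1)[of "\<lambda>y. \<bar>h y\<bar>" 1] by simp
  also have "\<dots> \<le> expectation (\<lambda>\<omega>. 1 * (\<beta> * \<bar>h (\<Phi> 0 \<omega>)\<bar> + B * indicator A (\<Phi> 0 \<omega>)))"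
  proof (rule markov_integral_nonneg(1)[where u = "\<lambda>y. \<bar>h y\<bar>" and g = "\<lambda>y. \<beta> * \<bar>h y\<bar> + B * indicator A y"])
    show "(\<integral>\<^sup>+z. ennreal \<bar>h z\<bar> \<partial>K y) \<le> ennreal (\<beta> * \<bar>h y\<bar> + B * indicator A y)" if "y \<in> space E" for y
    proof (cases "y \<in> A")
      case True
      have "ennreal B \<le> ennreal (\<beta> * \<bar>h y\<bar> + B)" using \<beta> by (intro ennreal_leI) simp
      then show ?thesis using d[OF that] True by simp
    qed (use d[OF that] in simp)
    show "integrable M (\<lambda>\<omega>. 1 * (\<beta> * \<bar>h (\<Phi> 0 \<omega>)\<bar> + B * indicator A (\<Phi> 0 \<omega>)))"
      using iX iA by simp
  qed (use \<beta> B in auto)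
  also have "\<dots> = \<beta> * expectation (\<lambda>\<omega>. \<bar>h (\<Phi> 0 \<omega>)\<bar>)" using iX iA EA by simp
  finally have "(1 - \<beta>) * expectation (\<lambda>\<omega>. \<bar>X 0 \<omega>\<bar>) \<le> 0" by (simp add: algebra_simps)
  then have "expectation (\<lambda>\<omega>. \<bar>X 0 \<omega>\<bar>) \<le> 0" using \<beta> by (simp add: mult_le_0_iff)
  then have "expectation (\<lambda>\<omega>. \<bar>X 0 \<omega>\<bar>) = 0" by (intro antisym integral_nonneg_AE) auto
  then have "AE \<omega> in M. X 0 \<omega> = 0"
    using iX by (subst (asm) integral_nonneg_eq_0_iff_AE) auto
  then have "F 0 = 0" unfolding F_eq by (subst prob_eq_0) auto
  then show False using F_pos[of 0] by simp
qed

text \<open>Half of \<epsilon> x is reserved for the visits to the atom, the rest for the moment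
  bound. That bound leaves n^m / x^(2m), which \<open>growth\<close> handles, and n E w^(2m) /
  x^(2m), of order \<delta>_k powr (2m - \<alpha>) times n F x and so small for large k.\<close>

lemma truncation_negligible_large_index:
  fixes \<delta> :: "nat \<Rightarrow> real" and \<Lambda> :: "nat \<Rightarrow> real set"
  assumes "\<alpha> > 1" and ac: "anti_clustering M X \<alpha> \<delta> \<Lambda>"
    and Inf: "filterlim (\<lambda>n. Inf (\<Lambda> n)) at_top sequentially"
    and centred: "expectation (X 0) = 0"
    and m: "m \<ge> 1" "real (2 * m) > \<alpha>"
    and growth: "\<And>e. e > 0 \<Longrightarrow> \<forall>\<^sub>F n in sequentially. \<forall>x\<in>\<Lambda> n. real n ^ m / x ^ (2 * m) \<le> e * (real n * F x)"
    and at: "atom E K A" and \<beta>: "0 < \<beta>" "\<beta> < 1" and B: "0 \<le> B"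
    and d1: "\<And>y. y \<in> space E \<Longrightarrow> (\<integral>\<^sup>+z. ennreal \<bar>h z\<bar> \<partial>K y) \<le> ennreal (if y \<in> A then B else \<beta> * \<bar>h y\<bar>)"
    and d2: "\<And>y. m \<ge> 2 \<Longrightarrow> y \<in> space E \<Longrightarrow> (\<integral>\<^sup>+z. ennreal ((h z)\<^sup>2) \<partial>K y) \<le> ennreal (if y \<in> A then B else \<beta> * (h y)\<^sup>2)"
    and "e > 0" "\<epsilon> > 0"
  shows "\<forall>\<^sub>F k in sequentially. \<forall>\<^sub>F n in sequentially. \<forall>x\<in>\<Lambda> n.
       \<P>(\<omega> in M. \<bar>\<Sum>i=1..n. small_part (x * \<delta> k) (X (int i) \<omega>)\<bar> > \<epsilon> * x) \<le> e * (real n * F x)"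
proof -
  have \<delta>: "\<And>k. \<delta> k > 0" "\<delta> \<longlonglongrightarrow> 0" using ac by (auto simp: anti_clustering_def)
  have A[measurable]: "A \<in> sets E" using at by (simp add: atom_def)
  \<comment> \<open>Then 2mr = \<alpha> / 2 < \<alpha>, and r < 1/2 because \<alpha> < 2m.\<close>
  define r where "r = \<alpha> / (4 * real m)"
  have r: "0 < r" "r < 1" "2 * real m * r < \<alpha>" "r \<le> 1"
    using m \<alpha>_pos by (auto simp: r_def field_simps)
  obtain C3 x3 where C3: "C3 > 0" "x3 > 0"
    "\<And>L. x3 \<le> L \<Longrightarrow> integrable M (\<lambda>\<omega>. damped r L (\<Phi> 0 \<omega>) ^ (2 * m))"
    "\<And>L. x3 \<le> L \<Longrightarrow> expectation (\<lambda>\<omega>. damped r L (\<Phi> 0 \<omega>) ^ (2 * m)) \<le> C3 * L ^ (2 * m) * F L"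
    using damped_moment[OF m(2) r(1,2)] r(3) by metis
  obtain C4 x4 where iX: "integrable M (X 0)" and C4: "C4 > 0" "x4 > 0"
    "\<And>L. x4 \<le> L \<Longrightarrow> \<bar>expectation (\<lambda>\<omega>. small_part L (X 0 \<omega>))\<bar> \<le> C4 * L * F L"
    using integrable_and_truncated_mean[OF \<open>\<alpha> > 1\<close>] centred by auto
  define \<pi> where "\<pi> = \<P>(\<omega> in M. \<Phi> 0 \<omega> \<in> A)"
  have \<pi>: "\<pi> > 0" unfolding \<pi>_def using d1 by (intro atom_charged[OF A iX \<beta> B])
  \<comment> \<open>The contraction factor shared by w and w^2, free of L.\<close>
  define \<gamma> where "\<gamma> = \<beta> powr r"
  have \<gamma>: "0 \<le> \<gamma>" "\<gamma> < 1" using \<beta> r powr_less_mono2[of r \<beta> 1] by (auto simp: \<gamma>_def)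
  obtain Q where Q: "Q > 0" and mom:
    "\<And>A f w n. dominated_functional m \<gamma> B A f w \<Longrightarrow> n \<ge> 1 \<Longrightarrow>
     \<exists>c. c * prob {\<omega> \<in> space M. \<Phi> 0 \<omega> \<in> A} = expectation (\<lambda>\<omega>. f (\<Phi> 0 \<omega>)) \<and>
       integrable M (\<lambda>\<omega>. ((\<Sum>i=1..n. f (\<Phi> (int i) \<omega>)) - c * (\<Sum>i<n. indicator A (\<Phi> (int i) \<omega>))) ^ (2 * m)) \<and>
       expectation (\<lambda>\<omega>. ((\<Sum>i=1..n. f (\<Phi> (int i) \<omega>)) - c * (\<Sum>i<n. indicator A (\<Phi> (int i) \<omega>))) ^ (2 * m))
         \<le> Q * (real n ^ m + real n * expectation (\<lambda>\<omega>. w (\<Phi> 0 \<omega>) ^ (2 * m)))"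
    using additive_functional_moment[OF m(1) \<gamma> B] by blast
  have dom: "dominated_functional m \<gamma> B A (\<lambda>y. small_part L (h y)) (damped r L)" if "x3 \<le> L" for L
  proof -
    have L: "L > 0" using that C3 by simp
    have "(\<integral>\<^sup>+z. ennreal (damped r L z) \<partial>K y) \<le> ennreal (\<gamma> * damped r L y + B * indicator A y)" if "y \<in> space E" for y
      unfolding damped_def \<gamma>_def using d1 r by (intro drift_truncated[OF _ _ \<beta> B _ _ _ _ that]) auto
    moreover have "(\<integral>\<^sup>+z. ennreal ((damped r L z)\<^sup>2) \<partial>K y) \<le> ennreal (\<gamma> * (damped r L y)\<^sup>2 + B)" if "m \<ge> 2" and y: "y \<in> space E" for y
    proof -
      \<comment> \<open>The square of w has the shape of w with h^2 in place of |h|, so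
        \<open>drift_truncated\<close> applies to it with the same exponent r.\<close>
      have sq: "(damped r L z)\<^sup>2 = min ((h z)\<^sup>2) ((L powr (1 - r))\<^sup>2 * (h z)\<^sup>2 powr r)" for z
      proof -
        have "(min a b)\<^sup>2 = min (a\<^sup>2) (b\<^sup>2)" if "0 \<le> a" "0 \<le> b" for a b :: real
          using that by (auto simp: min_def power2_le_iff_abs_le abs_le_square_iff[symmetric])
        moreover have "(\<bar>h z\<bar> powr r)\<^sup>2 = (h z)\<^sup>2 powr r"
        proof -
          have "(h z)\<^sup>2 powr r = (\<bar>h z\<bar> * \<bar>h z\<bar>) powr r" by (simp add: power2_eq_square)
          also have "\<dots> = (\<bar>h z\<bar> powr r)\<^sup>2" by (simp only: powr_mult abs_ge_zero power2_eq_square)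
          finally show ?thesis by simp
        qed
        ultimately show ?thesis unfolding damped_def by (simp add: power_mult_distrib)
      qed
      have "(\<integral>\<^sup>+z. ennreal ((damped r L z)\<^sup>2) \<partial>K y) \<le> ennreal (\<gamma> * (damped r L y)\<^sup>2 + B * indicator A y)"
        unfolding sq \<gamma>_def using d2[OF \<open>m \<ge> 2\<close>] r by (intro drift_truncated[OF _ _ \<beta> B _ _ _ _ y]) auto
      also have "\<dots> \<le> ennreal (\<gamma> * (damped r L y)\<^sup>2 + B)" using B by (intro ennreal_leI) (auto split: split_indicator)
      finally show ?thesis .
    qed
    ultimately show ?thesis
      unfolding dominated_functional_def using at C3(3)[OF that] small_part_le_damped[OF L r(1,4)] by auto
  qed
  \<comment> \<open>From Markov's inequality at the threshold (\<epsilon> x / 2) ^ (2 * m).\<close>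
  define \<kappa> where "\<kappa> = (2 / \<epsilon>) ^ (2 * m) * Q"
  have \<kappa>: "\<kappa> > 0" using Q \<open>\<epsilon> > 0\<close> by (simp add: \<kappa>_def)
  have "(\<lambda>k. \<kappa> * C3 * 2 * \<delta> k powr (real (2 * m) - \<alpha>)) \<longlonglongrightarrow> \<kappa> * C3 * 2 * 0"
    using \<delta> m(2) by (intro tendsto_mult tendsto_const tendsto_zero_powrI) (auto simp: less_imp_le)
  then have "\<forall>\<^sub>F k in sequentially. \<kappa> * C3 * 2 * \<delta> k powr (real (2 * m) - \<alpha>) < e / 2"
    using \<open>e > 0\<close> by (intro order_tendstoD(2)) auto
  then show ?thesis
  proof eventually_elim
    case (elim k)
    note ek = elim
    let ?d = "\<delta> k"
    have d: "?d > 0" by (rule \<delta>)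
    \<comment> \<open>Chosen so that |c| <= \<theta> * x * F x at the level x * \<delta>_k: the
      bound for the truncated mean, the tail ratio, and division by the mass of the atom.\<close>
    define \<theta> where "\<theta> = C4 * 2 * ?d powr (1 - \<alpha>) / \<pi>"
    have \<theta>: "\<theta> > 0" using C4 d \<pi> by (simp add: \<theta>_def)
    have "\<forall>\<^sub>F x in at_top. x \<ge> x3 / ?d \<and> x \<ge> x4 / ?d \<and> x > 0 \<and> F (x * ?d) \<le> 2 * ?d powr (-\<alpha>) * F x"
      by (intro eventually_conj eventually_ge_at_top eventually_gt_at_top eventually_tail_ratio d)
    note ev1 = X.eventually_in_regions[OF ac Inf this]
    have "(\<lambda>n. real n * F (Inf (\<Lambda> n))) \<longlonglongrightarrow> 0" using ac by (simp add: anti_clustering_def)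
    then have ev2: "\<forall>\<^sub>F n in sequentially. real n * F (Inf (\<Lambda> n)) < \<epsilon> / (2 * \<theta>)"
      using \<open>\<epsilon> > 0\<close> \<theta> by (intro order_tendstoD(2)) auto
    have "e / (2 * \<kappa>) > 0" using \<open>e > 0\<close> \<kappa> by simp
    from ev1 ev2 growth[OF this] eventually_ge_at_top[of "1::nat"] show ?case
    proof eventually_elim
      case (elim n)
      show ?case
      proof
        fix x assume xin: "x \<in> \<Lambda> n"
        then have x: "x \<ge> x3 / ?d" "x \<ge> x4 / ?d" "x > 0" and FL: "F (x * ?d) \<le> 2 * ?d powr (-\<alpha>) * F x" using elim(1) by auto
        let ?L = "x * ?d"
        have L: "x3 \<le> ?L" "x4 \<le> ?L" "?L > 0" using x d by (simp_all add: field_simps)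
        let ?N = "real n * F x"
        have N: "?N > 0" using elim(4) F_pos[of x] by simp
        have bdd: "bdd_below (\<Lambda> n)"
        proof -
          have "\<Lambda> n \<subseteq> {0<..}" using ac elim(4) by (simp add: anti_clustering_def)
          then show ?thesis by (intro bdd_belowI[of _ 0]) auto
        qed
        have N_small: "?N < \<epsilon> / (2 * \<theta>)"
        proof -
          have "?N \<le> real n * F (Inf (\<Lambda> n))" by (intro mult_left_mono F_anti cInf_lower[OF xin bdd]) auto
          then show ?thesis using elim(2) by simp
        qed
        let ?f = "\<lambda>y. small_part ?L (h y)"
        let ?W = "expectation (\<lambda>\<omega>. damped r ?L (\<Phi> 0 \<omega>) ^ (2 * m))"
        obtain c where c: "c * \<pi> = expectation (\<lambda>\<omega>. ?f (\<Phi> 0 \<omega>))"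
          and iR: "integrable M (\<lambda>\<omega>. ((\<Sum>i=1..n. ?f (\<Phi> (int i) \<omega>)) - c * (\<Sum>i<n. indicator A (\<Phi> (int i) \<omega>))) ^ (2 * m))"
          and ER: "expectation (\<lambda>\<omega>. ((\<Sum>i=1..n. ?f (\<Phi> (int i) \<omega>)) - c * (\<Sum>i<n. indicator A (\<Phi> (int i) \<omega>))) ^ (2 * m))
             \<le> Q * (real n ^ m + real n * ?W)"
          using mom[OF dom[OF L(1)] elim(4)] unfolding \<pi>_def by blast
        let ?R = "\<lambda>\<omega>. (\<Sum>i=1..n. ?f (\<Phi> (int i) \<omega>)) - c * (\<Sum>i<n. indicator A (\<Phi> (int i) \<omega>))"
        \<comment> \<open>At most n visits occur, so their contribution is at most \<theta> x times
          n F x. Monotonicity of F makes n F x small uniformly on \<open>\<Lambda> n\<close>, from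
          its value at the infimum.\<close>
        have cn: "\<bar>c\<bar> * real n \<le> \<epsilon> * x / 2"
        proof -
          have "\<bar>c\<bar> * \<pi> = \<bar>expectation (\<lambda>\<omega>. ?f (\<Phi> 0 \<omega>))\<bar>" using c \<pi> by (metis abs_mult abs_of_pos)
          also have "\<dots> \<le> C4 * ?L * F ?L" by (rule C4(3)[OF L(2)])
          also have "\<dots> \<le> C4 * ?L * (2 * ?d powr (-\<alpha>) * F x)" using FL C4 L by (intro mult_left_mono) auto
          also have "\<dots> = (\<theta> * x * F x) * \<pi>" using d \<pi> by (simp add: \<theta>_def powr_diff powr_minus field_simps)
          finally have "\<bar>c\<bar> \<le> \<theta> * x * F x" using \<pi> by simp
          then have "\<bar>c\<bar> * real n \<le> \<theta> * x * F x * real n" by (intro mult_right_mono) auto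
          also have "\<dots> = (\<theta> * x) * ?N" by simp
          also have "\<dots> \<le> (\<theta> * x) * (\<epsilon> / (2 * \<theta>))" using N_small \<theta> x by (intro mult_left_mono) auto
          also have "\<dots> = \<epsilon> * x / 2" using \<theta> by simp
          finally show ?thesis .
        qed
        have "\<P>(\<omega> in M. \<bar>\<Sum>i=1..n. small_part ?L (X (int i) \<omega>)\<bar> > \<epsilon> * x) \<le> \<P>(\<omega> in M. ?R \<omega> ^ (2 * m) > (\<epsilon> * x / 2) ^ (2 * m))"
        proof (rule finite_measure_mono)
          show "{\<omega> \<in> space M. \<bar>\<Sum>i=1..n. small_part ?L (X (int i) \<omega>)\<bar> > \<epsilon> * x} \<subseteq> {\<omega> \<in> space M. ?R \<omega> ^ (2 * m) > (\<epsilon> * x / 2) ^ (2 * m)}"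
          proof safe
            fix \<omega> assume *: "\<bar>\<Sum>i=1..n. small_part ?L (X (int i) \<omega>)\<bar> > \<epsilon> * x"
            have s0: "0 \<le> (\<Sum>i<n. indicat_real A (\<Phi> (int i) \<omega>))" by (intro sum_nonneg) auto
            have "(\<Sum>i<n. indicat_real A (\<Phi> (int i) \<omega>)) \<le> (\<Sum>i<n. 1)" by (intro sum_mono) (auto split: split_indicator)
            then have "\<bar>c * (\<Sum>i<n. indicat_real A (\<Phi> (int i) \<omega>))\<bar> \<le> \<bar>c\<bar> * real n"
              using s0 by (simp add: abs_mult mult_left_mono)
            then have "\<epsilon> * x / 2 < \<bar>?R \<omega>\<bar>" using * cn by linarith
            then have "(\<epsilon> * x / 2) ^ (2 * m) < \<bar>?R \<omega>\<bar> ^ (2 * m)"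
              using m(1) x \<open>\<epsilon> > 0\<close> by (intro power_strict_mono) auto
            then show "(\<epsilon> * x / 2) ^ (2 * m) < ?R \<omega> ^ (2 * m)" by (simp add: power_even_abs)
          qed
        qed measurable
        also have "\<dots> \<le> expectation (\<lambda>\<omega>. ?R \<omega> ^ (2 * m)) / (\<epsilon> * x / 2) ^ (2 * m)"
          using iR x \<open>\<epsilon> > 0\<close> by (intro prob_gt_le) auto
        also have "\<dots> \<le> Q * (real n ^ m + real n * ?W) / (\<epsilon> * x / 2) ^ (2 * m)"
          using ER by (intro divide_right_mono) auto
        also have "\<dots> = \<kappa> * (real n ^ m / x ^ (2 * m)) + \<kappa> * (real n * ?W / x ^ (2 * m))"
          using x \<open>\<epsilon> > 0\<close> by (simp add: \<kappa>_def power_divide power_mult_distrib field_simps)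
        also have "\<dots> \<le> e / 2 * ?N + e / 2 * ?N"
        proof (rule add_mono)
          have "\<kappa> * (real n ^ m / x ^ (2 * m)) \<le> \<kappa> * (e / (2 * \<kappa>) * ?N)"
            using elim(3) xin \<kappa> by (intro mult_left_mono) auto
          then show "\<kappa> * (real n ^ m / x ^ (2 * m)) \<le> e / 2 * ?N" using \<kappa> by simp
          have "?W \<le> C3 * ?L ^ (2 * m) * F ?L" by (rule C3(4)[OF L(1)])
          also have "\<dots> \<le> C3 * ?L ^ (2 * m) * (2 * ?d powr (-\<alpha>) * F x)" using FL C3 L by (intro mult_left_mono) auto
          also have "\<dots> = (C3 * 2 * ?d powr (real (2 * m) - \<alpha>) * F x) * x ^ (2 * m)"
          proof -
            have "?d powr (real (2 * m) - \<alpha>) = ?d ^ (2 * m) * ?d powr (-\<alpha>)"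
              using d by (simp only: powr_diff powr_realpow powr_minus_divide) simp
            then show ?thesis by (simp add: power_mult_distrib)
          qed
          finally have "?W / x ^ (2 * m) \<le> C3 * 2 * ?d powr (real (2 * m) - \<alpha>) * F x"
            using x by (simp add: pos_divide_le_eq)
          then have "\<kappa> * real n * (?W / x ^ (2 * m)) \<le> \<kappa> * real n * (C3 * 2 * ?d powr (real (2 * m) - \<alpha>) * F x)"
            using \<kappa> by (intro mult_left_mono) auto
          also have "\<dots> = (\<kappa> * C3 * 2 * ?d powr (real (2 * m) - \<alpha>)) * ?N" by simp
          also have "\<dots> \<le> e / 2 * ?N" using ek N by (intro mult_right_mono) auto
          finally show "\<kappa> * (real n * ?W / x ^ (2 * m)) \<le> e / 2 * ?N" by simp
        qed
        also have "\<dots> = e * ?N" by simp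
        finally show "\<P>(\<omega> in M. \<bar>\<Sum>i=1..n. small_part ?L (X (int i) \<omega>)\<bar> > \<epsilon> * x) \<le> e * (real n * F x)" .
      qed
    qed
  qed
qed

end

section \<open>The large deviation theorem\<close>

text \<open>The lower tail bound with an exponent q strictly between \<alpha> and s leaves a spare
  factor x powr (-(s - q)), which tends to 0 and beats any constant.\<close>

lemma (in rv_tail) eventually_powr_le_tail:
  assumes "s > \<alpha>" "e > 0"
  shows "\<forall>\<^sub>F x in at_top. x powr (-s) \<le> e * F x"
proof -
  define q where "q = (\<alpha> + s) / 2"
  have q: "\<alpha> < q" "q < s" using assms by (auto simp: q_def)
  obtain c x0 where c: "c > 0" "x0 > 0" "\<And>x. x0 \<le> x \<Longrightarrow> F x \<ge> c * x powr (-q)"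
    using tail_lower_bound[OF q(1)] by blast
  have "((\<lambda>x. x powr (-(s - q))) \<longlongrightarrow> 0) at_top"
    using q by (intro tendsto_neg_powr filterlim_ident) auto
  then have "\<forall>\<^sub>F x in at_top. x powr (-(s - q)) < e * c"
    using assms c by (intro order_tendstoD(2)) auto
  then show ?thesis using eventually_ge_at_top[of x0]
  proof eventually_elim
    case (elim x)
    have "x powr (-s) = x powr (-(s - q)) * x powr (-q)" by (simp add: powr_add[symmetric])
    also have "\<dots> \<le> e * c * x powr (-q)" using elim by (intro mult_right_mono) auto
    also have "\<dots> \<le> e * F x" using c(3)[OF elim(2)] assms by (simp add: mult.assoc)
    finally show ?case .
  qed
qed

context chain_functional
begin

text \<open>Below index two the first moment drift and second moments suffice. Above index two all moment
  exponents \<open>2 m\<close> exceeding the index are admissible, and a large \<open>m\<close> makes the Gaussian term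
  \<open>n ^ m / x ^ (2 * m)\<close> negligible beyond \<open>n powr \<rho>\<close>, \<open>\<rho> > 1/2\<close>.\<close>

lemma truncation_negligible:
  fixes \<delta> :: "nat \<Rightarrow> real" and \<Lambda> :: "nat \<Rightarrow> real set" and \<rho> :: real
  assumes ac: "anti_clustering M X \<alpha> \<delta> \<Lambda>"
    and Inf: "filterlim (\<lambda>n. Inf (\<Lambda> n)) at_top sequentially"
    and centred: "integrable M (X 0) \<longrightarrow> expectation (X 0) = 0"
    and drift: "\<And>p. 0 < p \<Longrightarrow> p < \<alpha> \<Longrightarrow> \<exists>A. atom E K A \<and> drift_condition E K h A p"
    and "\<alpha> \<noteq> 1" "\<alpha> \<noteq> 2"
    and low: "\<alpha> > 1 \<Longrightarrow> \<rho> > 1/2" "\<And>n x. \<alpha> > 1 \<Longrightarrow> n \<ge> 1 \<Longrightarrow> x \<in> \<Lambda> n \<Longrightarrow> x \<ge> real n powr \<rho>"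
    and "e > 0" "\<epsilon> > 0"
  shows "\<forall>\<^sub>F k in sequentially. \<forall>\<^sub>F n in sequentially. \<forall>x\<in>\<Lambda> n.
       \<P>(\<omega> in M. \<bar>\<Sum>i=1..n. small_part (x * \<delta> k) (X (int i) \<omega>)\<bar> > \<epsilon> * x) \<le> e * (real n * F x)"
proof -
  consider "\<alpha> < 1" | "1 < \<alpha>" "\<alpha> < 2" | "2 < \<alpha>" using assms(5,6) by linarith
  then show ?thesis
  proof cases
    case 1
    then show ?thesis using assms by (intro truncation_negligible_small_index)
  next
    case 2
    have EX: "expectation (X 0) = 0"
      using integrable_and_truncated_mean[OF 2(1)] centred by blast
    obtain A where A: "atom E K A" "drift_condition E K h A 1" using drift[of 1] 2 by auto
    from drift_off_atom[OF A] obtain \<beta> B where \<beta>: "0 < \<beta>" "\<beta> < 1" "0 \<le> B"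
      and d: "\<And>y. y \<in> space E \<Longrightarrow> (\<integral>\<^sup>+z. ennreal (\<bar>h z\<bar> powr 1) \<partial>K y) \<le> ennreal (if y \<in> A then B else \<beta> * \<bar>h y\<bar> powr 1)"
      by blast
    show ?thesis
    proof (rule truncation_negligible_large_index[where m = 1 and A = A and \<beta> = \<beta> and B = B])
      \<comment> \<open>With m = 1 the factor n stands on both sides, and x powr (-2) is o(F x)
        because \<alpha> < 2.\<close>
      fix e' :: real assume "e' > 0"
      have "\<forall>\<^sub>F x in at_top. x powr (-2) \<le> e' * F x \<and> x > 0"
        using 2 \<open>e' > 0\<close> by (intro eventually_conj eventually_powr_le_tail eventually_gt_at_top)
      from X.eventually_in_regions[OF ac Inf this]
      show "\<forall>\<^sub>F n in sequentially. \<forall>x\<in>\<Lambda> n. real n ^ 1 / x ^ (2 * 1) \<le> e' * (real n * F x)"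
      proof eventually_elim
        case (elim n)
        show ?case
        proof
          fix x assume "x \<in> \<Lambda> n"
          then have x: "x powr (-2) \<le> e' * F x" "x > 0" using elim by auto
          have "real n ^ 1 / x ^ (2 * 1) = real n * x powr (-2)"
            using x(2) by (simp add: powr_minus powr_numeral divide_inverse)
          also have "\<dots> \<le> real n * (e' * F x)" using x(1) by (intro mult_left_mono) auto
          finally show "real n ^ 1 / x ^ (2 * 1) \<le> e' * (real n * F x)" by (simp add: mult_ac)
        qed
      qed
    next
      show "(\<integral>\<^sup>+z. ennreal \<bar>h z\<bar> \<partial>K y) \<le> ennreal (if y \<in> A then B else \<beta> * \<bar>h y\<bar>)" if "y \<in> space E" for y
        using d[OF that] by (cases "y \<in> A") auto
    qed (use 2 A \<beta> assms EX in auto)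
  next
    case 3
    then have "1 < \<alpha>" by simp
    then have EX: "expectation (X 0) = 0"
      using integrable_and_truncated_mean centred by blast
    obtain A where A: "atom E K A" "drift_condition E K h A 2" using drift[of 2] 3 by auto
    from drift_off_atom[OF A] obtain \<beta> B where \<beta>: "0 < \<beta>" "\<beta> < 1" "0 \<le> B"
      and d: "\<And>y. y \<in> space E \<Longrightarrow> (\<integral>\<^sup>+z. ennreal (\<bar>h z\<bar> powr 2) \<partial>K y) \<le> ennreal (if y \<in> A then B else \<beta> * \<bar>h y\<bar> powr 2)"
      by blast
    have d2: "(\<integral>\<^sup>+z. ennreal ((h z)\<^sup>2) \<partial>K y) \<le> ennreal (if y \<in> A then B else \<beta> * (h y)\<^sup>2)" if "y \<in> space E" for y
      using d[OF that] by (cases "y \<in> A") auto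
    \<comment> \<open>The root of the drift of order two has constants sqrt \<beta> and sqrt B.
      Enlarging to sqrt \<beta> and \<open>B'\<close> gives one pair of constants valid for both
      orders.\<close>
    define B' where "B' = max B (sqrt B)"
    have sq: "\<beta> \<le> sqrt \<beta>" "sqrt \<beta> < 1" "0 < sqrt \<beta>"
      using \<beta> by (auto intro!: real_le_rsqrt simp: power2_eq_square mult_left_le)
    have \<rho>: "\<rho> > 1/2" using low 3 by simp
    \<comment> \<open>From n <= x powr (1 / \<rho>) one gets n^m / x^(2m) <= x powr (-\<sigma> m);
      positivity of \<sigma> is the condition \<rho> > 1/2.\<close>
    define \<sigma> where "\<sigma> = 2 - 1 / \<rho>"
    have \<sigma>: "\<sigma> > 0" using \<rho> by (simp add: \<sigma>_def field_simps)
    \<comment> \<open>m > \<alpha> / \<sigma> makes x powr (-\<sigma> m) negligible against F x; m >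
      \<alpha> secures 2m > \<alpha>.\<close>
    obtain m :: nat where m: "real m > max 2 (max \<alpha> (\<alpha> / \<sigma>))" using reals_Archimedean2 by blast
    have s: "\<sigma> * real m > \<alpha>" using m \<sigma> by (simp add: field_simps)
    show ?thesis
    proof (rule truncation_negligible_large_index[where m = m and A = A and \<beta> = "sqrt \<beta>" and B = B'])
      fix e' :: real assume "e' > 0"
      have "\<forall>\<^sub>F x in at_top. x powr (-(\<sigma> * real m)) \<le> e' * F x \<and> x > 0"
        using s \<open>e' > 0\<close> by (intro eventually_conj eventually_powr_le_tail eventually_gt_at_top)
      from X.eventually_in_regions[OF ac Inf this] eventually_ge_at_top[of "1::nat"]
      show "\<forall>\<^sub>F n in sequentially. \<forall>x\<in>\<Lambda> n. real n ^ m / x ^ (2 * m) \<le> e' * (real n * F x)"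
      proof eventually_elim
        case (elim n)
        show ?case
        proof
          fix x assume xn: "x \<in> \<Lambda> n"
          then have x: "x powr (-(\<sigma> * real m)) \<le> e' * F x" "x > 0" using elim by auto
          have n: "real n > 0" using elim(2) by simp
          have "real n powr \<rho> \<le> x" using low(2)[of n x] 3 elim(2) xn by simp
          then have "(real n powr \<rho>) powr (1 / \<rho>) \<le> x powr (1 / \<rho>)" using \<rho> by (intro powr_mono2) auto
          then have "real n \<le> x powr (1 / \<rho>)" using \<rho> n by (simp add: powr_powr)
          then have "real n ^ m \<le> (x powr (1 / \<rho>)) ^ m" by (intro power_mono) auto
          also have "\<dots> = x powr (real m / \<rho>)" using x(2) by (simp add: powr_realpow[symmetric] powr_powr)
          finally have "real n ^ m / x ^ (2 * m) \<le> x powr (real m / \<rho>) / x ^ (2 * m)"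
            using x(2) by (intro divide_right_mono) auto
          also have "\<dots> = x powr (real m / \<rho> - real (2 * m))" using x(2) by (simp only: powr_diff powr_realpow)
          also have "real m / \<rho> - real (2 * m) = -(\<sigma> * real m)" by (simp add: \<sigma>_def algebra_simps)
          also have "x powr (-(\<sigma> * real m)) \<le> 1 * (e' * F x)" using x(1) by simp
          also have "\<dots> \<le> real n * (e' * F x)"
            using elim(2) \<open>e' > 0\<close> F_pos[of x] by (intro mult_right_mono) auto
          finally show "real n ^ m / x ^ (2 * m) \<le> e' * (real n * F x)" by (simp add: mult_ac)
        qed
      qed
    next
      show "(\<integral>\<^sup>+z. ennreal \<bar>h z\<bar> \<partial>K y) \<le> ennreal (if y \<in> A then B' else sqrt \<beta> * \<bar>h y\<bar>)" if "y \<in> space E" for y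
      proof -
        have "(\<integral>\<^sup>+z. ennreal \<bar>h z\<bar> \<partial>K y) \<le> ennreal (if y \<in> A then sqrt B else sqrt \<beta> * \<bar>h y\<bar>)"
          by (rule drift_root[OF h_meas \<beta> d2 that])
        also have "\<dots> \<le> ennreal (if y \<in> A then B' else sqrt \<beta> * \<bar>h y\<bar>)"
          by (intro ennreal_leI) (auto simp: B'_def)
        finally show ?thesis .
      qed
      show "(\<integral>\<^sup>+z. ennreal ((h z)\<^sup>2) \<partial>K y) \<le> ennreal (if y \<in> A then B' else sqrt \<beta> * (h y)\<^sup>2)" if "y \<in> space E" for y
      proof -
        have "ennreal (if y \<in> A then B else \<beta> * (h y)\<^sup>2) \<le> ennreal (if y \<in> A then B' else sqrt \<beta> * (h y)\<^sup>2)"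
          using sq by (intro ennreal_leI) (auto simp: B'_def intro: mult_right_mono)
        with d2[OF that] show ?thesis by (rule order_trans)
      qed
    qed (use 3 m A \<beta> sq assms EX in \<open>auto simp: B'_def\<close>)
  qed
qed

end

theorem theorem4p6:
  fixes M :: "'w measure" and E :: "'e measure"
    and K :: "'e \<Rightarrow> 'e measure" and \<Phi> :: "int \<Rightarrow> 'w \<Rightarrow> 'e"
    and A :: "'e set" and h :: "'e \<Rightarrow> real" and X :: "int \<Rightarrow> 'w \<Rightarrow> real"
    and \<alpha> bp :: real and \<delta> b c :: "nat \<Rightarrow> real" and \<Lambda> :: "nat \<Rightarrow> real set"
  assumes "prob_space M"
    and "markov_chain M E K \<Phi>" and "stationary M E \<Phi>"
    and "atom E K A"
    and "h \<in> borel_measurable E"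
    and X_def: "X = (\<lambda>t \<omega>. h (\<Phi> t \<omega>))"
    and "\<alpha> > 0"
    and i: "regularly_varying M X \<alpha>"
    and ii: "anti_clustering M X \<alpha> \<delta> \<Lambda>"
      "\<delta> \<in> o(\<lambda>k. real k powr (-2))"
      "filterlim (\<lambda>n. Inf (\<Lambda> n)) at_top sequentially"
    and iii: "(\<lambda>k. b_plus M X (k + 1) - b_plus M X k) \<longlonglongrightarrow> bp"
    and iv: "integrable M (X 0) \<longrightarrow> (\<integral>\<omega>. X 0 \<omega> \<partial>M) = 0"
    and v: "\<And>p. 0 < p \<Longrightarrow> p < \<alpha> \<Longrightarrow> \<exists>A'. atom E K A' \<and> drift_condition E K h A' p"
    and regions:
      "(\<alpha> < 1 \<and>
          (\<forall>n\<ge>1. \<Lambda> n = {b n<..}) \<and>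
          (\<lambda>n. real n * abs_tail M X (b n)) \<longlonglongrightarrow> 0)
       \<or>
       (\<alpha> > 1 \<and> \<alpha> \<noteq> 2 \<and>
          (\<forall>n\<ge>1. \<Lambda> n = {b n<..<c n}) \<and>
          (\<exists>\<eta>>0. \<forall>n\<ge>1. b n = real n powr (max (1 / \<alpha>) (1 / 2) + \<eta>)) \<and>
          (\<forall>n\<ge>1. c n > b n) \<and>
          (\<lambda>n. \<P>(\<omega> in M. hitting_time \<Phi> A \<omega> > enat n)) \<in> o(\<lambda>n. real n * abs_tail M X (c n)))"
  shows "(\<lambda>n. SUP x\<in>\<Lambda> n. ereal \<bar>\<P>(\<omega> in M. partial_sum X n \<omega> > x)
                              / (real n * abs_tail M X x) - bp\<bar>) \<longlonglongrightarrow> 0"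
proof -
  interpret stationary_chain M E K \<Phi>
    using assms(1-3) by (simp add: stationary_chain_def stationary_chain_axioms_def)
  have X_meas: "X t \<in> borel_measurable M" for t
    unfolding X_def using \<open>h \<in> borel_measurable E\<close> by measurable
  have st: "stationary M borel X"
    unfolding X_def by (rule stationary_image[OF \<open>stationary M E \<Phi>\<close> \<Phi>_meas \<open>h \<in> borel_measurable E\<close>])
  interpret chain_functional M E K \<Phi> h \<alpha>
    using regularly_varying_tails(1)[OF \<open>prob_space M\<close> X_meas st \<open>\<alpha> > 0\<close> i] \<open>h \<in> borel_measurable E\<close>
    unfolding X_def by unfold_locales (auto simp: rv_tail_def)
  \<comment> \<open>For \<alpha> > 1 the exponent of b n itself is taken: it exceeds 1/2 by at least
    \<eta>, and every x in the region lies above b n.\<close>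
  obtain \<rho> where low: "\<alpha> > 1 \<Longrightarrow> \<rho> > 1/2"
    "\<And>n x. \<alpha> > 1 \<Longrightarrow> n \<ge> 1 \<Longrightarrow> x \<in> \<Lambda> n \<Longrightarrow> x \<ge> real n powr \<rho>"
  proof (cases "\<alpha> > 1")
    case True
    then obtain \<eta> where \<Lambda>: "\<And>n. n \<ge> 1 \<Longrightarrow> \<Lambda> n = {b n<..<c n}" and "\<eta> > 0"
      and b: "\<And>n. n \<ge> 1 \<Longrightarrow> b n = real n powr (max (1 / \<alpha>) (1 / 2) + \<eta>)"
      using regions by auto
    show ?thesis
    proof (rule that[of "max (1 / \<alpha>) (1 / 2) + \<eta>"])
      show "max (1 / \<alpha>) (1 / 2) + \<eta> > 1/2" using \<open>\<eta> > 0\<close> by linarith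
      show "x \<ge> real n powr (max (1 / \<alpha>) (1 / 2) + \<eta>)" if "n \<ge> 1" "x \<in> \<Lambda> n" for n x
        using \<Lambda>[OF that(1)] b[OF that(1)] that(2) by simp
    qed
  next
    case False
    \<comment> \<open>Both requirements on \<rho> are conditional on \<alpha> > 1, so 1 is an
      arbitrary value.\<close>
    then show ?thesis using that[of 1] by simp
  qed
  have "\<alpha> \<noteq> 1" "\<alpha> \<noteq> 2" using regions by auto
  then show ?thesis
    using X.large_deviations_of_negligible_truncation[OF \<open>\<alpha> > 0\<close> i[unfolded X_def] ii(1)[unfolded X_def] ii(2,3)
        iii[unfolded X_def] truncation_negligible[OF ii(1)[unfolded X_def] ii(3) iv[unfolded X_def] v _ _ low]]
    unfolding X_def by blast
qed

end
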